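(* Let $\Gamma=\langle\tau,\mu\rangle$ be the Brunner–Sidki–Vieira group acting on the rooted binary tree $\{0,1\}^*$, let $(\Gamma_n)_{n\ge1}$ be its $2$-dimension series, and let $\ell_n=\dim_{\mathbb F_2}\Gamma_n/\Gamma_{n+1}$. Then the ranks $\ell_n$ satisfy $$\ell_n=\begin{cases} i+2 & \text{if } n=2^i \text{ for some } i;\\ \max\{\,i+1 : 2^i \text{ divides } n\,\} & \text{otherwise.}\end{cases}$$ As a consequence, if $\varpi$ denotes the augmentation ideal of the group algebra $\mathbb F_2\Gamma$, then $$\dim_{\mathbb F_2}\varpi^n/\varpi^{n+1}=\sum_{i=0}^n p(i),$$ the number of partitions of numbers up to $n$ (where $p(i)$ is the number of partitions of $i$); and the word growth of $\Gamma$ is at least $e^{\sqrt n}$ (in the usual asymptotic sense for growth functions of groups).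
   Context: The group: let $\Sigma=\{0,1\}$ and let $\Sigma^*$ be the free monoid on $\Sigma$, regarded as the rooted binary tree. Define permutations $\tau,\mu$ of $\Sigma^*$ (tree automorphisms, acting on the right, written as exponents) recursively by: both fix the empty word; $(0\sigma_2\dots\sigma_n)^\tau=1\sigma_2\dots\sigma_n$ and $(1\sigma_2\dots\sigma_n)^\tau=0(\sigma_2\dots\sigma_n)^\tau$; $(0\sigma_2\dots\sigma_n)^\mu=1\sigma_2\dots\sigma_n$ and $(1\sigma_2\dots\sigma_n)^\mu=0(\sigma_2\dots\sigma_n)^{\mu^{-1}}$. The Brunner–Sidki–Vieira group $\Gamma$ is the group of permutations of $\Sigma^*$ generated by $\tau$ and $\mu$. The $2$-dimension series of $\Gamma$ is defined by $\Gamma_1=\Gamma$ and, for $n\ge2$, $\Gamma_n=[\Gamma,\Gamma_{n-1}]\,\Gamma_{\lceil n/2\rceil}^2$, where $H^2$ denotes the subgroup of $H$ generated by the squares of its elements. Equivalently, $\Gamma_n=\{g\in\Gamma : g-1\in\varpi^n\}$, where $\varpi$ is the augmentation ideal of $\mathbb F_2\Gamma$. Each $\Gamma_n/\Gamma_{n+1}$ is an elementary abelian $2$-group, viewed as an $\mathbb F_2$-vector space. By convention $\varpi^0=\mathbb F_2\Gamma$ and $p(0)=1$; the formula for $\ell_n$ concerns $n\ge1$ with $i$ ranging over integers $i\ge0$, and the formula for $\dim\varpi^n/\varpi^{n+1}$ concerns $n\ge0$. The word growth of $\Gamma$ is the function $n\mapsto f_n$, where $f_n$ is the number of elements of $\Gamma$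 of length at most $n$ in the generators. It is compared with $e^{\sqrt n}$ asymptotically, as is usual for growth functions of groups; no pointwise inequality for every $n$ is asserted. *)

theory Defs
  imports
    Complex_Main
    "HOL-Library.FuncSet"
    "HOL-Library.Multiset"
    "HOL-Number_Theory.Residues"
    "HOL-Algebra.Generated_Groups"
    "HOL-Algebra.Ideal_Product"
    "Jordan_Normal_Form.Missing_VectorSpace"
begin

section \<open>The Brunner--Sidki--Vieira group\<close>

text \<open>Vertices of the rooted binary tree are words over the alphabet \<^typ>\<open>bool\<close>, with
  \<^const>\<open>False\<close> for the letter 0 and \<^const>\<open>True\<close> for the letter 1.\<close>

fun tau :: "bool list \<Rightarrow> bool list" where
  "tau [] = []"
| "tau (False # w) = True # w"
| "tau (True # w) = False # tau w"

text \<open>The recursion for \<open>mu\<close> involves its inverse, so both are defined simultaneously; the lemmas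
  \<open>mu_inv_mu\<close> and \<open>mu_mu_inv\<close> justify the name of the second function.\<close>

fun mu mu_inv :: "bool list \<Rightarrow> bool list" where
  "mu [] = []"
| "mu (False # w) = True # w"
| "mu (True # w) = False # mu_inv w"
| "mu_inv [] = []"
| "mu_inv (True # w) = False # w"
| "mu_inv (False # w) = True # mu w"

lemma mu_inv_mu: "mu_inv (mu w) = w" and mu_mu_inv: "mu (mu_inv w) = w"
  by (induction w and w rule: mu_mu_inv.induct) simp_all

lemma bij_mu: "bij mu"
  by (rule o_bij[where g = mu_inv]) (auto simp: mu_inv_mu mu_mu_inv)

lemma bij_tau: "bij tau"
proof (rule bijI)
  have "tau v = tau w \<Longrightarrow> v = w" for v w
  proof (induction v arbitrary: w rule: tau.induct)
    case 1 then show ?case by (cases w rule: tau.cases) auto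
  next
    case (2 v) then show ?case by (cases w rule: tau.cases) auto
  next
    case (3 v) then show ?case by (cases w rule: tau.cases) auto
  qed
  then show "inj tau" by (rule injI)
  have "\<exists>v. tau v = w" for w
  proof (induction w)
    case Nil show ?case by (rule exI[of _ "[]"]) simp
  next
    case (Cons b w)
    then obtain v where "tau v = w" by blast
    then have "tau (if b then False # w else True # v) = b # w" by simp
    then show ?case by blast
  qed
  then show "surj tau" by (metis surjI)
qed

text \<open>Permutations act on the right: the product of \<open>f\<close> and \<open>g\<close> applies \<open>f\<close> first.\<close>

definition right_perm_group :: "('a \<Rightarrow> 'a) monoid" where
  "right_perm_group = \<lparr>carrier = {f. bij f}, monoid.mult = (\<lambda>f g. g \<circ> f), one = id\<rparr>"

lemma group_right_perm_group: "group right_perm_group"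
proof (rule groupI)
  fix f :: "'a \<Rightarrow> 'a"
  assume "f \<in> carrier right_perm_group"
  then have "bij f" by (simp add: right_perm_group_def)
  then show "\<exists>g \<in> carrier right_perm_group.
      g \<otimes>\<^bsub>right_perm_group\<^esub> f = \<one>\<^bsub>right_perm_group\<^esub>"
    by (intro bexI[of _ "inv_into UNIV f"])
      (auto simp: right_perm_group_def bij_imp_bij_inv bij_is_surj fun_eq_iff surj_f_inv_f)
qed (auto simp: right_perm_group_def bij_comp comp_assoc)

definition bsv_group :: "(bool list \<Rightarrow> bool list) monoid" where
  "bsv_group = subgroup_generated right_perm_group {tau, mu}"

lemma group_bsv_group: "group bsv_group"
  unfolding bsv_group_def
  by (rule group.group_subgroup_generated[OF group_right_perm_group])


section \<open>Vector spaces over the field with two elements\<close>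

abbreviation F2 :: "int ring" where
  "F2 \<equiv> residue_ring 2"

text \<open>\<open>vectorspace.dim\<close> is a least cardinality of a finite generating set, hence carries information
  only together with \<open>vectorspace.fin_dim\<close>.\<close>

definition has_dim :: "('k, 'c) ring_scheme \<Rightarrow> ('k, 'v, 'd) module_scheme \<Rightarrow> nat \<Rightarrow> bool" where
  "has_dim K V d \<longleftrightarrow>
     vectorspace K V \<and> vectorspace.fin_dim K V \<and> vectorspace.dim K V = d"

text \<open>A (multiplicatively written) elementary abelian group regarded as a vector space: vector
  addition is the group operation and the scalar \<open>a\<close> acts as the \<open>a\<close>-th power. The ring
  multiplication fields of the \<^type>\<open>module\<close> record are irrelevant.\<close>

definition power_module :: "('a, 'b) monoid_scheme \<Rightarrow> (int, 'a) module" where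
  "power_module G =
     \<lparr>carrier = carrier G, monoid.mult = undefined, one = undefined,
      zero = \<one>\<^bsub>G\<^esub>, add = (\<lambda>x y. x \<otimes>\<^bsub>G\<^esub> y), smult = (\<lambda>a x. x [^]\<^bsub>G\<^esub> a)\<rparr>"

text \<open>The quotient \<open>U/W\<close> of two submodules \<open>W \<subseteq> U\<close> of a module \<open>M\<close>. The scalar action is
  \<open>a (W + x) = W + a x\<close>,
  written without choosing a representative.\<close>

definition subquotient ::
    "('k, 'v, 'd) module_scheme \<Rightarrow> 'v set \<Rightarrow> 'v set \<Rightarrow> ('k, 'v set) module" where
  "subquotient M U W =
     \<lparr>carrier = a_rcosets\<^bsub>M\<lparr>carrier := U\<rparr>\<^esub> W, monoid.mult = undefined, one = undefined,
      zero = W, add = (\<lambda>X Y. X <+>\<^bsub>M\<^esub> Y),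
      smult = (\<lambda>a X. \<Union>x\<in>X. W +>\<^bsub>M\<^esub> (a \<odot>\<^bsub>M\<^esub> x))\<rparr>"


section \<open>The 2-dimension series\<close>

definition commutator_subgroup :: "('a, 'b) monoid_scheme \<Rightarrow> 'a set \<Rightarrow> 'a set \<Rightarrow> 'a set" where
  "commutator_subgroup G H K =
     generate G {inv\<^bsub>G\<^esub> h \<otimes>\<^bsub>G\<^esub> inv\<^bsub>G\<^esub> k \<otimes>\<^bsub>G\<^esub> h \<otimes>\<^bsub>G\<^esub> k | h k. h \<in> H \<and> k \<in> K}"

definition square_subgroup :: "('a, 'b) monoid_scheme \<Rightarrow> 'a set \<Rightarrow> 'a set" where
  "square_subgroup G H = generate G {h \<otimes>\<^bsub>G\<^esub> h | h. h \<in> H}"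

text \<open>Here \<open>(n + 1) div 2\<close> is the ceiling of \<open>n/2\<close>. The index 0 is not used.\<close>

function dim_series :: "('a, 'b) monoid_scheme \<Rightarrow> nat \<Rightarrow> 'a set" where
  "dim_series G n =
     (if n \<le> 1 then carrier G
      else commutator_subgroup G (carrier G) (dim_series G (n - 1))
             <#>\<^bsub>G\<^esub> square_subgroup G (dim_series G ((n + 1) div 2)))"
  by pat_completeness auto
termination by (relation "Wellfounded.measure snd") auto

declare dim_series.simps [simp del]

definition dim_layer :: "('a, 'b) monoid_scheme \<Rightarrow> nat \<Rightarrow> (int, 'a set) module" where
  "dim_layer G n = power_module (G\<lparr>carrier := dim_series G n\<rparr> Mod dim_series G (n + 1))"


section \<open>The group ring and its augmentation ideal\<close>

text \<open>Elements are the finitely supported functions from the group to the coefficient ring, extended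
  by \<^const>\<open>undefined\<close> outside the carrier; the product is convolution.\<close>

definition supp :: "('k, 'c) ring_scheme \<Rightarrow> ('a, 'b) monoid_scheme \<Rightarrow> ('a \<Rightarrow> 'k) \<Rightarrow> 'a set" where
  "supp R G f = {x \<in> carrier G. f x \<noteq> \<zero>\<^bsub>R\<^esub>}"

definition group_ring ::
    "('k, 'c) ring_scheme \<Rightarrow> ('a, 'b) monoid_scheme \<Rightarrow> ('k, 'a \<Rightarrow> 'k) module" where
  "group_ring R G =
     \<lparr>carrier = {f \<in> carrier G \<rightarrow>\<^sub>E carrier R. finite (supp R G f)},
      monoid.mult = (\<lambda>f h. \<lambda>x\<in>carrier G.
        \<Oplus>\<^bsub>R\<^esub>y\<in>supp R G f. f y \<otimes>\<^bsub>R\<^esub> h (inv\<^bsub>G\<^esub> y \<otimes>\<^bsub>G\<^esub> x)),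
      one = (\<lambda>x\<in>carrier G. if x = \<one>\<^bsub>G\<^esub> then \<one>\<^bsub>R\<^esub> else \<zero>\<^bsub>R\<^esub>),
      zero = (\<lambda>x\<in>carrier G. \<zero>\<^bsub>R\<^esub>),
      add = (\<lambda>f h. \<lambda>x\<in>carrier G. f x \<oplus>\<^bsub>R\<^esub> h x),
      smult = (\<lambda>a f. \<lambda>x\<in>carrier G. a \<otimes>\<^bsub>R\<^esub> f x)\<rparr>"

definition augmentation ::
    "('k, 'c) ring_scheme \<Rightarrow> ('a, 'b) monoid_scheme \<Rightarrow> ('a \<Rightarrow> 'k) \<Rightarrow> 'k" where
  "augmentation R G f = (\<Oplus>\<^bsub>R\<^esub>x\<in>supp R G f. f x)"

definition augmentation_ideal ::
    "('k, 'c) ring_scheme \<Rightarrow> ('a, 'b) monoid_scheme \<Rightarrow> ('a \<Rightarrow> 'k) set" where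
  "augmentation_ideal R G = a_kernel (group_ring R G) R (augmentation R G)"

text \<open>Powers are taken with respect to \<^const>\<open>ideal_prod\<close>, whose unit is the whole ring.\<close>

definition augmentation_power ::
    "('k, 'c) ring_scheme \<Rightarrow> ('a, 'b) monoid_scheme \<Rightarrow> nat \<Rightarrow> ('a \<Rightarrow> 'k) set" where
  "augmentation_power R G n = augmentation_ideal R G [^]\<^bsub>ideals_set (group_ring R G)\<^esub> n"

definition augmentation_layer ::
    "('k, 'c) ring_scheme \<Rightarrow> ('a, 'b) monoid_scheme \<Rightarrow> nat \<Rightarrow> ('k, ('a \<Rightarrow> 'k) set) module" where
  "augmentation_layer R G n =
     subquotient (group_ring R G) (augmentation_power R G n) (augmentation_power R G (n + 1))"


section \<open>Partition numbers and word growth\<close>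

definition partition_number :: "nat \<Rightarrow> nat" where
  "partition_number n = card {P :: nat multiset. 0 \<notin># P \<and> sum_mset P = n}"

definition word_growth :: "('a, 'b) monoid_scheme \<Rightarrow> 'a set \<Rightarrow> nat \<Rightarrow> nat" where
  "word_growth G S n =
     card {foldr (\<lambda>x y. x \<otimes>\<^bsub>G\<^esub> y) w \<one>\<^bsub>G\<^esub> | w.
             length w \<le> n \<and> set w \<subseteq> S \<union> (\<lambda>s. inv\<^bsub>G\<^esub> s) ` S}"

text \<open>The usual comparison of growth functions, in which the argument may be rescaled.\<close>

definition growth_le :: "(nat \<Rightarrow> real) \<Rightarrow> (nat \<Rightarrow> real) \<Rightarrow> bool" where
  "growth_le f g \<longleftrightarrow> (\<exists>C>0. eventually (\<lambda>n. f n \<le> g (C * n)) sequentially)"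

end

theory Submission
  imports Defs "HOL-Library.Poly_Mapping" "HOL-Library.Z2" "HOL-Library.Discrete_Functions"
begin

text \<open>
  Write \<open>\<langle>\<langle>g, h\<rangle>\<rangle>\<close> for the automorphism fixing the first level with sections \<open>g\<close> and \<open>h\<close>, let
  \<open>c = [\<tau>, \<mu>]\<close> and let \<open>H\<close> be the kernel of the two exponent homomorphisms. Then \<open>H \<times> H \<subseteq> H\<close>
  with infinite cyclic quotient generated by \<open>c\<close>, so \<open>\<Gamma>\<close> is filtered by the groups \<open>H\<^sup>N\<close>,
  \<open>N = 2\<^sup>i\<close>, placed at the vertices of level \<open>i\<close>. Since \<open>c c\<^sup>\<tau> = \<langle>\<langle>(c\<^sup>-\<^sup>1)\<^sup>\<tau>, 1\<rangle>\<rangle>\<close>, the copy \<open>x\<close> of \<open>c\<close> at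
  the leftmost vertex of level \<open>i\<close> lies in \<open>\<Gamma>\<^bsub>N+1\<^esub>\<close>, and the commutators \<open>[x, \<tau>, \<dots>, \<tau>]\<close> generate
  that layer with weights \<open>N + 1, \<dots>, 2N\<close>. Hence \<open>\<mu>\<close>, \<open>\<tau>\<close> and these elements give one polycyclic
  generator \<open>g\<^sub>m\<close> of each weight \<open>m \<ge> 1\<close>, apart from an additional one of weight 1, and the ordered
  monomials in the \<open>g\<^sub>m - 1\<close> of weight at most \<open>n\<close> span \<open>\<F>\<^sub>2\<Gamma>/\<varpi>\<^bsup>n+1\<^esup>\<close>.

  They are independent: if \<open>a\<^sub>v(g)\<close> is the exponent of \<open>\<tau>\<close> in the section of \<open>g\<close> at \<open>v\<close> and \<open>b(g)\<close> that
  of \<open>\<mu>\<close> in \<open>g\<close>, then \<open>g \<mapsto> (1 + w)\<^bsup>b(g)\<^esup> \<Prod>\<^sub>v (1 + x\<^sub>v)\<^bsup>a\<^sub>v(g)\<^esup>\<close>, \<open>v\<close> of length \<open>k\<close>, is a cocycle for the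
  permutation action on polynomials over \<open>\<F>\<^sub>2\<close>. A tree automorphism is unipotent on linear forms, so
  with weights \<open>1, \<dots>, 2\<^sup>k\<close> for a suitable basis of the forms \<open>x\<^sub>v\<close> and weight 1 for \<open>w\<close> the power
  \<open>\<varpi>\<^sup>n\<close> is mapped into weight at least \<open>n\<close>. Modulo weight \<open>n + 1\<close> the induced map is onto, and its target
  is as large as the monomials allow.
\<close>

text \<open>The group is given by its action and not by a presentation, so already the exponent
  homomorphisms need proof: exponent pairs of words for the same element must agree, which is a
  2-adic descent along sections. Inside the group, only lower bounds for the depth of elements are
  proved: the weights of the generators, and g - 1 \<in> \<varpi>^n for g in the n-th term. That
  nothing lies deeper than its weight predicts comes from counting: ordered monomials and
  polynomials are indexed by the same finite set of multisets, so a surjection between the spans is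
  a bijection. The ranks come from (g - 1)^q = g^q - 1 for 2-powers q: the powers of generators that
  have weight exactly n are single monomials, hence independent in the layer, and the normal form
  shows that they generate it. For the growth, the ball of radius n spans modulo \<varpi>^(n+1), so
  it has at least as many elements as there are monomials of weight at most n; products of distinct
  generators already give 2^j of them when j^2 \<le> n.\<close>

lemma carrier_bsv: "carrier bsv_group = generate right_perm_group {tau, mu}"
proof -
  have "{f. bij f} \<inter> {tau, mu} = {tau, mu}"
    using bij_tau bij_mu by auto
  then show ?thesis
    by (simp add: bsv_group_def subgroup_generated_def right_perm_group_def)
qed

lemma mult_bsv [simp]: "f \<otimes>\<^bsub>bsv_group\<^esub> g = g \<circ> f"
  and one_bsv [simp]: "\<one>\<^bsub>bsv_group\<^esub> = id"
  by (simp_all add: bsv_group_def subgroup_generated_def right_perm_group_def)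

interpretation bsv: group bsv_group
  by (rule group_bsv_group)

typedef bsv = "carrier bsv_group"
  using bsv.one_closed by blast

setup_lifting type_definition_bsv

text \<open>The group is written additively, since convolution on \<^typ>\<open>'a \<Rightarrow>\<^sub>0 'b\<close> is
  defined along addition; the first summand acts first.\<close>

instantiation bsv :: group_add
begin

lift_definition zero_bsv :: bsv is "\<one>\<^bsub>bsv_group\<^esub>" by (rule bsv.one_closed)

lift_definition plus_bsv :: "bsv \<Rightarrow> bsv \<Rightarrow> bsv" is "\<lambda>f g. f \<otimes>\<^bsub>bsv_group\<^esub> g"
  by (rule bsv.m_closed)

lift_definition uminus_bsv :: "bsv \<Rightarrow> bsv" is "\<lambda>f. inv\<^bsub>bsv_group\<^esub> f"
  by (rule bsv.inv_closed)

definition minus_bsv :: "bsv \<Rightarrow> bsv \<Rightarrow> bsv" where "minus_bsv x y = x + - y"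

instance
  apply (standard; (unfold minus_bsv_def)?)
      apply (transfer, simp only: bsv.m_assoc)
     apply (transfer, simp only: bsv.l_one)
    apply (transfer, simp only: bsv.r_one)
   apply (transfer, simp only: bsv.l_inv)
  apply (rule refl)
  done

end

abbreviation app :: "bsv \<Rightarrow> bool list \<Rightarrow> bool list" where "app \<equiv> Rep_bsv"

lemma app_zero [simp]: "app 0 w = w"
  by (simp add: zero_bsv.rep_eq)

lemma app_add [simp]: "app (x + y) w = app y (app x w)"
  by (simp add: plus_bsv.rep_eq)

lemma app_uminus_app [simp]: "app (- x) (app x w) = w"
  by (metis app_add app_zero right_minus)

lemma app_app_uminus [simp]: "app x (app (- x) w) = w"
  by (metis app_add app_zero left_minus)

lemma app_inj: "(\<And>w. app x w = app y w) \<Longrightarrow> x = y"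
  by (metis Rep_bsv_inject ext)

lift_definition gtau :: bsv is tau
  by (simp add: carrier_bsv generate.incl)

lift_definition gmu :: bsv is mu
  by (simp add: carrier_bsv generate.incl)

lemma app_gtau [simp]: "app gtau = tau" and app_gmu [simp]: "app gmu = mu"
  by (simp_all add: gtau.rep_eq gmu.rep_eq)

lemma bsv_induct [case_names zero tau mu tau_inv mu_inv]:
  assumes "P 0" "\<And>x. P x \<Longrightarrow> P (x + gtau)" "\<And>x. P x \<Longrightarrow> P (x + gmu)"
    "\<And>x. P x \<Longrightarrow> P (x - gtau)" "\<And>x. P x \<Longrightarrow> P (x - gmu)"
  shows "P x"
proof -
  \<comment> \<open>Generation is taken in the full permutation group, whereas \<open>uminus\<close>
    on \<open>bsv\<close> is inversion in the subgroup; on the generators the two agree.\<close>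
  have inv_eq: "inv\<^bsub>right_perm_group\<^esub> f = inv\<^bsub>bsv_group\<^esub> f" if "f \<in> {tau, mu}" for f
  proof -
    have "f \<in> carrier bsv_group" using that by (auto simp: carrier_bsv generate.incl)
    then show ?thesis
      unfolding bsv_group_def
      by (metis bij_mu bij_tau group.inv_subgroup_generated group_right_perm_group)
  qed
  \<comment> \<open>\<open>generate\<close> is closed under arbitrary products rather than under
    appending letters, so the induction carries the claim that right multiplication by the element
    preserves \<open>P\<close>; it is applied to 0 at the end.\<close>
  have "\<forall>y. P y \<longrightarrow> P (y + Abs_bsv f)" if "f \<in> generate right_perm_group {tau, mu}" for f
    using that
  proof induction
    case one
    have "Abs_bsv \<one>\<^bsub>right_perm_group\<^esub> = 0"
      by (simp add: zero_bsv_def right_perm_group_def)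
    then show ?case by simp
  next
    case (incl h)
    then show ?case using assms(2,3) by (auto simp: gtau_def gmu_def)
  next
    case (inv h)
    have "Abs_bsv (inv\<^bsub>right_perm_group\<^esub> h) = - Abs_bsv h"
      using inv by (subst inv_eq) (auto simp: uminus_bsv.abs_eq carrier_bsv generate.incl eq_onp_def)
    then show ?case using inv assms(4,5) by (auto simp: gtau_def gmu_def)
  next
    case (eng h1 h2)
    have "Abs_bsv (h1 \<otimes>\<^bsub>right_perm_group\<^esub> h2) = Abs_bsv h1 + Abs_bsv h2"
      using eng by (subst plus_bsv.abs_eq) (auto simp: eq_onp_def carrier_bsv right_perm_group_def)
    then show ?case using eng by (metis add.assoc)
  qed
  from this[of "Rep_bsv x"] have "P (0 + Abs_bsv (Rep_bsv x))"
    using assms(1) Rep_bsv[of x] carrier_bsv by blast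
  then show ?thesis by (simp add: Rep_bsv_inverse)
qed

section \<open>Self-similarity: root permutations and sections\<close>

lemma app_uminus_eqI: "app x v = w \<Longrightarrow> app (- x) w = v"
  by auto

lemma app_gtau_inv [simp]:
  "app (- gtau) [] = []" "app (- gtau) (True # w) = False # w"
  "app (- gtau) (False # w) = True # app (- gtau) w"
  using app_uminus_eqI[of gtau "[]" "[]"] app_uminus_eqI[of gtau "False # w" "True # w"]
    app_uminus_eqI[of gtau "True # app (- gtau) w" "False # w"] app_app_uminus[of gtau w]
  by simp_all

lemma app_gmu_inv [simp]:
  "app (- gmu) [] = []" "app (- gmu) (True # w) = False # w"
  "app (- gmu) (False # w) = True # app gmu w"
  using app_uminus_eqI[of gmu "[]" "[]"] app_uminus_eqI[of gmu "False # w" "True # w"]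
    app_uminus_eqI[of gmu "True # mu w" "False # w"]
  by (simp_all add: mu_inv_mu)

lemma mu_inv_eq: "mu_inv w = app (- gmu) w"
  by (rule sym, rule app_uminus_eqI) (simp add: mu_mu_inv)

text \<open>Each section of a generator or of its inverse is trivial, a generator or the inverse of
  one, and the section of a product is a product of sections, the second one taken at the image of
  the letter. Hence sections stay in the group.\<close>

lemma ex_section: "\<exists>c h. \<forall>w. app g (b # w) = c # app h w"
proof (induction g arbitrary: b rule: bsv_induct)
  case zero
  have "\<forall>w. app 0 (b # w) = b # app 0 w" by simp
  then show ?case by blast
next
  have add: "\<exists>c h. \<forall>w. app (x + s) (b # w) = c # app h w"
    if x: "\<And>b. \<exists>c h. \<forall>w. app x (b # w) = c # app h w"
      and s: "\<And>b. \<exists>c h. \<forall>w. app s (b # w) = c # app h w" for x s b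
  proof -
    obtain c h where 1: "\<And>w. app x (b # w) = c # app h w" using x by blast
    obtain c' h' where 2: "\<And>w. app s (c # w) = c' # app h' w" using s by blast
    have "\<forall>w. app (x + s) (b # w) = c' # app (h + h') w" by (simp add: 1 2)
    then show ?thesis by blast
  qed
  have gen: "\<exists>c h. \<forall>w. app s (b # w) = c # app h w"
    if "\<forall>w. app s (True # w) = False # app h w" "\<forall>w. app s (False # w) = True # app h' w" for s h h' b
    using that by (cases b) auto
  {
    case (tau x) then show ?case
      by (rule add) (rule gen[of _ gtau 0], simp_all)
  next
    case (mu x) then show ?case
      by (rule add) (rule gen[of _ "- gmu" 0], simp_all add: mu_inv_eq)
  next
    case (tau_inv x)
    show ?case unfolding diff_conv_add_uminus using tau_inv
      by (rule add) (rule gen[of _ 0 "- gtau"], simp_all)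
  next
    case (mu_inv x)
    show ?case unfolding diff_conv_add_uminus using mu_inv
      by (rule add) (rule gen[of _ 0 gmu], simp_all)
  }
qed

lemma app_Nil [simp]: "app g [] = []"
  by (induction g rule: bsv_induct) (simp_all only: app_add diff_conv_add_uminus, auto)

definition root_perm :: "bsv \<Rightarrow> bool \<Rightarrow> bool" where
  "root_perm g b = hd (app g [b])"

definition tree_sec :: "bool \<Rightarrow> bsv \<Rightarrow> bsv" where
  "tree_sec b g = (SOME h. \<forall>w. app g (b # w) = root_perm g b # app h w)"

lemma app_Cons [simp]: "app g (b # w) = root_perm g b # app (tree_sec b g) w"
proof -
  obtain c h where "\<forall>w. app g (b # w) = c # app h w" using ex_section by blast
  moreover from this have "root_perm g b = c" by (simp add: root_perm_def)
  ultimately have "\<forall>w. app g (b # w) = root_perm g b # app h w" by simp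
  then have "\<forall>w. app g (b # w) = root_perm g b # app (tree_sec b g) w"
    unfolding tree_sec_def by (rule someI)
  then show ?thesis by blast
qed

lemma root_perm_tree_sec_eqI:
  assumes "\<And>w. app g (b # w) = c # app h w"
  shows "root_perm g b = c" "tree_sec b g = h"
proof -
  show "root_perm g b = c" using assms[of "[]"] by simp
  have "app (tree_sec b g) w = app h w" for w using assms[of w] by simp
  then show "tree_sec b g = h" by (rule app_inj)
qed

lemma root_perm_zero [simp]: "root_perm 0 b = b" and tree_sec_zero [simp]: "tree_sec b 0 = 0"
  by (rule root_perm_tree_sec_eqI[where c = b and h = 0 and g = 0 and b = b], simp del: app_Cons)+

lemma root_perm_add [simp]: "root_perm (g + h) b = root_perm h (root_perm g b)"
  and tree_sec_add [simp]: "tree_sec b (g + h) = tree_sec b g + tree_sec (root_perm g b) h"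
  by (rule root_perm_tree_sec_eqI[where g = "g + h" and b = b and c = "root_perm h (root_perm g b)"
        and h = "tree_sec b g + tree_sec (root_perm g b) h"], subst app_add, simp)+

lemma root_perm_uminus_root_perm [simp]: "root_perm (- g) (root_perm g b) = b"
  and root_perm_root_perm_uminus [simp]: "root_perm g (root_perm (- g) b) = b"
  by (metis root_perm_add root_perm_zero left_minus right_minus)+

lemma tree_sec_uminus: "tree_sec b (- g) = - tree_sec (root_perm (- g) b) g"
proof -
  have "tree_sec b (- g) + tree_sec (root_perm (- g) b) g = tree_sec b (- g + g)" by (simp only: tree_sec_add)
  then have "tree_sec b (- g) + tree_sec (root_perm (- g) b) g = 0" by simp
  then show ?thesis by (simp only: eq_neg_iff_add_eq_0)
qed

lemma root_perm_Not: "root_perm g (\<not> b) = (\<not> root_perm g b)"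
proof -
  have "root_perm g (\<not> b) \<noteq> root_perm g b"
  proof
    assume "root_perm g (\<not> b) = root_perm g b"
    then have "root_perm (- g) (root_perm g (\<not> b)) = root_perm (- g) (root_perm g b)" by simp
    then show False by (simp only: root_perm_uminus_root_perm) simp
  qed
  then show ?thesis by auto
qed

lemma tree_sec_gtau [simp]: "tree_sec False gtau = 0" "tree_sec True gtau = gtau"
  and root_perm_gtau [simp]: "root_perm gtau b = (\<not> b)"
  and tree_sec_gmu [simp]: "tree_sec False gmu = 0" "tree_sec True gmu = - gmu"
  and root_perm_gmu [simp]: "root_perm gmu b = (\<not> b)"
  using root_perm_tree_sec_eqI[of gtau False True 0] root_perm_tree_sec_eqI[of gtau True False gtau]
    root_perm_tree_sec_eqI[of gmu False True 0] root_perm_tree_sec_eqI[of gmu True False "- gmu"]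
  by (simp_all add: mu_inv_eq del: app_Cons) (cases b; simp)+

lemma root_perm_gtau_inv [simp]: "root_perm (- gtau) b = (\<not> b)"
  and root_perm_gmu_inv [simp]: "root_perm (- gmu) b = (\<not> b)"
  by (metis root_perm_gtau root_perm_root_perm_uminus, metis root_perm_gmu root_perm_root_perm_uminus)

lemma tree_sec_inv_simps [simp]:
  "tree_sec False (- gtau) = - gtau" "tree_sec True (- gtau) = 0"
  "tree_sec False (- gmu) = gmu" "tree_sec True (- gmu) = 0"
  by (simp_all add: tree_sec_uminus)

lemma bsv_eqI:
  assumes "root_perm g False = root_perm h False" "tree_sec False g = tree_sec False h" "tree_sec True g = tree_sec True h"
  shows "g = h"
proof (rule app_inj)
  fix w
  have "root_perm g b = root_perm h b" for b using assms(1) by (metis (full_types) root_perm_Not)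
  moreover have "tree_sec b g = tree_sec b h" for b using assms by (cases b) auto
  ultimately show "app g w = app h w" by (cases w) auto
qed

lemma length_app [simp]: "length (app g w) = length w"
  by (induction w arbitrary: g) auto

section \<open>The exponent homomorphisms\<close>

text \<open>Exponent sums are first attached to words: \<open>has_expo g a b\<close> says that some
  word for \<open>g\<close> has these sums. That they depend on \<open>g\<close> alone is
  \<open>has_expo_unique\<close>.\<close>

inductive has_expo :: "bsv \<Rightarrow> int \<Rightarrow> int \<Rightarrow> bool" where
  zero: "has_expo 0 0 0"
| tau: "has_expo g a b \<Longrightarrow> has_expo (g + gtau) (a + 1) b"
| mu: "has_expo g a b \<Longrightarrow> has_expo (g + gmu) a (b + 1)"
| tau_inv: "has_expo g a b \<Longrightarrow> has_expo (g - gtau) (a - 1) b"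
| mu_inv: "has_expo g a b \<Longrightarrow> has_expo (g - gmu) a (b - 1)"

lemma has_expo_total: "\<exists>a b. has_expo g a b"
  by (induction g rule: bsv_induct) (blast intro: has_expo.intros)+

lemma has_expo_add: "has_expo h c d \<Longrightarrow> has_expo g a b \<Longrightarrow> has_expo (g + h) (a + c) (b + d)"
proof (induction rule: has_expo.induct)
  case zero then show ?case by simp
next
  case (tau h c d)
  from has_expo.tau[OF tau.IH[OF tau.prems]] show ?case by (simp add: add.assoc)
next
  case (mu h c d)
  from has_expo.mu[OF mu.IH[OF mu.prems]] show ?case by (simp add: add.assoc)
next
  case (tau_inv h c d)
  from has_expo.tau_inv[OF tau_inv.IH[OF tau_inv.prems]] show ?case
    by (simp add: diff_conv_add_uminus add.assoc del: add_uminus_conv_diff)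
next
  case (mu_inv h c d)
  from has_expo.mu_inv[OF mu_inv.IH[OF mu_inv.prems]] show ?case
    by (simp add: diff_conv_add_uminus add.assoc del: add_uminus_conv_diff)
qed

lemma has_expo_gtau: "has_expo gtau 1 0" and has_expo_gmu: "has_expo gmu 0 1"
  and has_expo_gtau_inv: "has_expo (- gtau) (- 1) 0" and has_expo_gmu_inv: "has_expo (- gmu) 0 (- 1)"
  using has_expo.tau[OF has_expo.zero] has_expo.mu[OF has_expo.zero] has_expo.tau_inv[OF has_expo.zero]
    has_expo.mu_inv[OF has_expo.zero] by simp_all

lemma has_expo_induct_add [consumes 1, case_names zero tau mu tau_inv mu_inv add]:
  assumes "has_expo g a b" "P 0 0 0" "P gtau 1 0" "P gmu 0 1" "P (- gtau) (- 1) 0" "P (- gmu) 0 (- 1)"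
    "\<And>g a b h c d. P g a b \<Longrightarrow> P h c d \<Longrightarrow> P (g + h) (a + c) (b + d)"
  shows "P g a b"
  using assms(1)
proof induction
  case zero then show ?case using assms(2) .
next
  case (tau g a b) then show ?case using assms(7)[OF tau.IH assms(3)] by simp
next
  case (mu g a b) then show ?case using assms(7)[OF mu.IH assms(4)] by simp
next
  case (tau_inv g a b) then show ?case using assms(7)[OF tau_inv.IH assms(5)] by simp
next
  case (mu_inv g a b) then show ?case using assms(7)[OF mu_inv.IH assms(6)] by simp
qed

lemma has_expo_uminus: "has_expo g a b \<Longrightarrow> has_expo (- g) (- a) (- b)"
proof (induction rule: has_expo_induct_add)
  case (add g a b h c d)
  have "- (a + c) = - c + - a" "- (b + d) = - d + - b" by simp_all
  with has_expo_add[OF add.IH(1) add.IH(2)] show ?case by (simp only: minus_add)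
qed (use has_expo.zero has_expo_gtau has_expo_gmu has_expo_gtau_inv has_expo_gmu_inv in simp_all)

text \<open>Both generators flip the first letter and leave a trace in the section only when passing
  from letter 1 to letter 0: \<tau> raises the \<tau>-exponent there, \<mu> lowers the
  \<mu>-exponent. Either way the difference of the two exponents grows by 1, so in the section at
  letter c it counts the carries of a binary counter started at c, which is
  \<open>(a + b + c) div 2\<close>.\<close>

definition has_expo_split :: "bsv \<Rightarrow> int \<Rightarrow> int \<Rightarrow> int \<Rightarrow> int \<Rightarrow> int \<Rightarrow> int \<Rightarrow> bool" where
  "has_expo_split g a b a0 b0 a1 b1 \<longleftrightarrow> has_expo (tree_sec False g) a0 b0 \<and> has_expo (tree_sec True g) a1 b1 \<and>
    a0 + a1 = a \<and> b0 + b1 = - b \<and> a0 - b0 = (a + b) div 2 \<and> a1 - b1 = (a + b + 1) div 2 \<and>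
    root_perm g False = odd (a + b)"

lemma has_expo_split_add:
  assumes "has_expo_split g a b a0 b0 a1 b1" "has_expo_split h c d c0 d0 c1 d1"
  shows "\<exists>a0 b0 a1 b1. has_expo_split (g + h) (a + c) (b + d) a0 b0 a1 b1"
proof (cases "even (a + b)")
  case True
  then have r: "root_perm g False = False" "root_perm g True = True"
    using assms(1) root_perm_Not[of g False] by (auto simp: has_expo_split_def)
  obtain k where k: "a + b = 2 * k" using True by blast
  have half: "(a + c + (b + d)) div 2 = k + (c + d) div 2" "(a + b) div 2 = k" "(a + b + 1) div 2 = k"
    "(a + c + (b + d) + 1) div 2 = k + (c + d + 1) div 2" "odd (a + c + (b + d)) = odd (c + d)"
    using k by presburger+
  have "has_expo_split (g + h) (a + c) (b + d) (a0 + c0) (b0 + d0) (a1 + c1) (b1 + d1)"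
    using assms unfolding has_expo_split_def half
    by (intro conjI) (simp_all only: r tree_sec_add root_perm_add has_expo_add, linarith+)
  then show ?thesis by blast
next
  case False
  then have r: "root_perm g False = True" "root_perm g True = False"
    using assms(1) root_perm_Not[of g False] by (auto simp: has_expo_split_def)
  obtain k where k: "a + b = 2 * k + 1" using False by (rule oddE)
  have *: "root_perm h True = (\<not> root_perm h False)" using root_perm_Not[of h False] by simp
  have half: "(a + c + (b + d)) div 2 = k + (c + d + 1) div 2" "(a + b) div 2 = k"
    "(a + b + 1) div 2 = k + 1" "(a + c + (b + d) + 1) div 2 = k + 1 + (c + d) div 2"
    "odd (a + c + (b + d)) = even (c + d)"
    using k by presburger+
  \<comment> \<open>The first factor swaps the letters, so the sections of the second are added in
    exchanged order.\<close>
  have "has_expo_split (g + h) (a + c) (b + d) (a0 + c1) (b0 + d1) (a1 + c0) (b1 + d0)"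
    using assms unfolding has_expo_split_def half
    by (intro conjI) (simp_all only: r * tree_sec_add root_perm_add has_expo_add not_not, linarith+)
  then show ?thesis by blast
qed

lemma has_expo_sections:
  assumes "has_expo g a b"
  shows "\<exists>a0 b0 a1 b1. has_expo_split g a b a0 b0 a1 b1"
  using assms
proof (induction rule: has_expo_induct_add)
  case zero
  have "has_expo_split 0 0 0 0 0 0 0" using has_expo.zero by (simp add: has_expo_split_def)
  then show ?case by blast
next
  case tau
  have "has_expo_split gtau 1 0 0 0 1 0" using has_expo.zero has_expo_gtau by (simp add: has_expo_split_def)
  then show ?case by blast
next
  case mu
  have "has_expo_split gmu 0 1 0 0 0 (- 1)" using has_expo.zero has_expo_gmu_inv by (simp add: has_expo_split_def)
  then show ?case by blast
next
  case tau_inv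
  have "has_expo_split (- gtau) (- 1) 0 (- 1) 0 0 0"
    using has_expo.zero has_expo_gtau_inv by (simp add: has_expo_split_def)
  then show ?case by blast
next
  case mu_inv
  have "has_expo_split (- gmu) 0 (- 1) 0 1 0 0"
    using has_expo.zero has_expo_gmu by (simp add: has_expo_split_def)
  then show ?case by blast
next
  case (add g a b h c d)
  then show ?case using has_expo_split_add by blast
qed

text \<open>For \<open>n = a + b\<close> and \<open>p = a - b\<close> the sections of an element satisfy
  \<open>p\<^sub>0 = n div 2\<close> and \<open>n\<^sub>0 + n\<^sub>1 = p\<close>; an element acting trivially has trivial sections, so each
  2-power dividing all possible \<open>p\<close> yields the next one for \<open>n\<close>, and then for \<open>p\<close>.\<close>

lemma has_expo_zero_dvd: "has_expo 0 a b \<Longrightarrow> 2 ^ j dvd a + b \<and> 2 ^ j dvd a - b"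
proof (induction j arbitrary: a b)
  case 0 then show ?case by simp
next
  case (Suc j)
  obtain a0 b0 a1 b1 where s: "has_expo 0 a0 b0" "has_expo 0 a1 b1" "a0 + a1 = a" "b0 + b1 = - b"
    "a0 - b0 = (a + b) div 2" "a1 - b1 = (a + b + 1) div 2" "even (a + b)"
    using has_expo_sections[OF Suc.prems] by (auto simp: has_expo_split_def)
  have half: "2 ^ Suc j dvd a + b" if E: "has_expo 0 a b" for a b :: int
  proof -
    obtain a0 b0 where s: "has_expo 0 a0 b0" "a0 - b0 = (a + b) div 2" "even (a + b)"
      using has_expo_sections[OF E] by (auto simp: has_expo_split_def)
    with Suc.IH[OF s(1)] have "2 ^ j dvd (a + b) div 2" by simp
    then have "2 * 2 ^ j dvd 2 * ((a + b) div 2)" by (rule mult_dvd_mono[OF dvd_refl])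
    with s(3) show ?thesis by simp
  qed
  have "a - b = (a0 + b0) + (a1 + b1)" using s by simp
  then show ?case using dvd_add[OF half half, OF s(1) s(2)] half[OF Suc.prems] by simp
qed

lemma has_expo_zero: assumes "has_expo 0 a b" shows "a = 0" "b = 0"
proof -
  have *: "n = 0" if "\<And>j. 2 ^ j dvd n" for n :: int
  proof (rule ccontr)
    assume "n \<noteq> 0"
    then have "2 ^ nat \<bar>n\<bar> \<le> \<bar>n\<bar>" using that[of "nat \<bar>n\<bar>"] by (meson dvd_imp_le_int abs_ge_self dual_order.trans)
    moreover have "int (nat \<bar>n\<bar>) < 2 ^ nat \<bar>n\<bar>" by (metis of_nat_less_two_power)
    ultimately show False by simp
  qed
  have "a + b = 0" "a - b = 0" using has_expo_zero_dvd[OF assms] * by blast+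
  then show "a = 0" "b = 0" by auto
qed

lemma has_expo_unique: "has_expo g a b \<Longrightarrow> has_expo g c d \<Longrightarrow> a = c \<and> b = d"
  using has_expo_zero[of "a - c" "b - d"] has_expo_add[OF has_expo_uminus, of g c d g a b] by fastforce

definition tau_exp :: "bsv \<Rightarrow> int" where "tau_exp g = (THE a. \<exists>b. has_expo g a b)"
definition mu_exp :: "bsv \<Rightarrow> int" where "mu_exp g = (THE b. \<exists>a. has_expo g a b)"

lemma has_expo_iff: "has_expo g a b \<longleftrightarrow> a = tau_exp g \<and> b = mu_exp g"
proof -
  obtain c d where cd: "has_expo g c d" using has_expo_total by blast
  then have "tau_exp g = c" "mu_exp g = d" unfolding tau_exp_def mu_exp_def by (blast dest: has_expo_unique)+
  then show ?thesis using cd has_expo_unique by blast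
qed

lemma tau_exp_add [simp]: "tau_exp (g + h) = tau_exp g + tau_exp h" and mu_exp_add [simp]: "mu_exp (g + h) = mu_exp g + mu_exp h"
  using has_expo_add[of h "tau_exp h" "mu_exp h" g "tau_exp g" "mu_exp g"] by (simp_all add: has_expo_iff)

lemma tau_exp_simps [simp]: "tau_exp 0 = 0" "tau_exp gtau = 1" "tau_exp gmu = 0" "tau_exp (- g) = - tau_exp g"
  and mu_exp_simps [simp]: "mu_exp 0 = 0" "mu_exp gtau = 0" "mu_exp gmu = 1" "mu_exp (- g) = - mu_exp g"
  using has_expo.zero has_expo_gtau has_expo_gmu has_expo_uminus[of g "tau_exp g" "mu_exp g"] by (simp_all add: has_expo_iff)

lemma tau_exp_diff [simp]: "tau_exp (g - h) = tau_exp g - tau_exp h" and mu_exp_diff [simp]: "mu_exp (g - h) = mu_exp g - mu_exp h"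
  by (simp_all only: diff_conv_add_uminus tau_exp_add mu_exp_add tau_exp_simps mu_exp_simps)

lemma tau_exp_sections: "tau_exp (tree_sec False g) + tau_exp (tree_sec True g) = tau_exp g"
  and mu_exp_sections: "mu_exp (tree_sec False g) + mu_exp (tree_sec True g) = - mu_exp g"
  and tau_exp_mu_exp_False: "tau_exp (tree_sec False g) - mu_exp (tree_sec False g) = (tau_exp g + mu_exp g) div 2"
  and tau_exp_mu_exp_True: "tau_exp (tree_sec True g) - mu_exp (tree_sec True g) = (tau_exp g + mu_exp g + 1) div 2"
  and root_perm_False: "root_perm g False = odd (tau_exp g + mu_exp g)"
  using has_expo_sections[of g "tau_exp g" "mu_exp g"] by (auto simp: has_expo_split_def has_expo_iff)

section \<open>Subgroups and the 2-dimension series\<close>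

lemmas grp_norm = diff_conv_add_uminus add.assoc minus_add minus_minus left_minus right_minus
  add_minus_cancel minus_add_cancel add_0_left add_0_right minus_zero

text \<open>These notions live on the class \<open>group_add\<close>, so that they apply both to
  \<open>bsv\<close> and to the additive group of its group algebra; \<open>has_dim_quotient\<close>
  is used for both.\<close>

definition subgrp :: "'g::group_add set \<Rightarrow> bool" where
  "subgrp H \<longleftrightarrow> 0 \<in> H \<and> (\<forall>x\<in>H. \<forall>y\<in>H. x + y \<in> H) \<and> (\<forall>x\<in>H. - x \<in> H)"

definition nsubgrp :: "'g::group_add set \<Rightarrow> bool" where
  "nsubgrp H \<longleftrightarrow> subgrp H \<and> (\<forall>g. \<forall>x\<in>H. - g + x + g \<in> H)"

lemma subgrpD: "subgrp H \<Longrightarrow> 0 \<in> H" "subgrp H \<Longrightarrow> x \<in> H \<Longrightarrow> y \<in> H \<Longrightarrow> x + y \<in> H"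
  "subgrp H \<Longrightarrow> x \<in> H \<Longrightarrow> - x \<in> H"
  by (auto simp: subgrp_def)

lemma nrmD: "nsubgrp H \<Longrightarrow> subgrp H" "nsubgrp H \<Longrightarrow> x \<in> H \<Longrightarrow> - g + x + g \<in> H"
  by (auto simp: nsubgrp_def)

lemma nsubgrp_conj: "nsubgrp H \<Longrightarrow> x \<in> H \<Longrightarrow> g + x + - g \<in> H"
  using nrmD(2)[of H x "- g"] by (simp only: minus_minus)

lemma subgrp_cancel:
  assumes "subgrp H" "y \<in> H" shows "x + y \<in> H \<longleftrightarrow> x \<in> H" "y + x \<in> H \<longleftrightarrow> x \<in> H"
proof -
  have "x = (x + y) + - y" "x = - y + (y + x)" by (simp_all only: grp_norm)
  then show "x + y \<in> H \<longleftrightarrow> x \<in> H" "y + x \<in> H \<longleftrightarrow> x \<in> H"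
    using assms subgrpD by metis+
qed

inductive_set gen :: "'g::group_add set \<Rightarrow> 'g set" for S where
  zero: "0 \<in> gen S"
| incl: "x \<in> S \<Longrightarrow> x \<in> gen S"
| add: "x \<in> gen S \<Longrightarrow> y \<in> gen S \<Longrightarrow> x + y \<in> gen S"
| neg: "x \<in> gen S \<Longrightarrow> - x \<in> gen S"

lemma subgrp_gen: "subgrp (gen S)"
  by (auto simp: subgrp_def intro: gen.intros)

lemma gen_least: "subgrp H \<Longrightarrow> S \<subseteq> H \<Longrightarrow> gen S \<subseteq> H"
proof
  fix x assume "x \<in> gen S" "subgrp H" "S \<subseteq> H"
  then show "x \<in> H" by induction (auto dest: subgrpD)
qed

lemma gen_mono: "S \<subseteq> T \<Longrightarrow> gen S \<subseteq> gen T"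
  by (meson gen.incl gen_least subgrp_gen subset_iff)

lemma conj_add: "- g + (x + y) + g = (- g + x + g) + (- g + y + (g::'g::group_add))"
  and conj_neg: "- g + - x + g = - (- g + x + (g::'g::group_add))"
  by (simp_all only: grp_norm)

lemma nsubgrp_gen:
  assumes "\<And>g x. x \<in> S \<Longrightarrow> - g + x + g \<in> S"
  shows "nsubgrp (gen S)"
proof -
  have "- g + x + g \<in> gen S" if "x \<in> gen S" for x g
    using that
  proof induction
    case zero then show ?case by (simp add: gen.zero)
  next
    case (incl x) then show ?case using assms by (blast intro: gen.incl)
  next
    case (add x y) show ?case unfolding conj_add by (rule gen.add[OF add.IH])
  next
    case (neg x) show ?case unfolding conj_neg by (rule gen.neg[OF neg.IH])
  qed
  then show ?thesis by (simp add: nsubgrp_def subgrp_gen)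
qed

definition setsum :: "'g::group_add set \<Rightarrow> 'g set \<Rightarrow> 'g set" where
  "setsum A B = {x + y | x y. x \<in> A \<and> y \<in> B}"

lemma nsubgrp_setsum:
  assumes "nsubgrp A" "nsubgrp B" shows "nsubgrp (setsum A B)"
proof -
  note A = subgrpD[OF nrmD(1)[OF assms(1)]] and B = subgrpD[OF nrmD(1)[OF assms(2)]]
  show ?thesis unfolding nsubgrp_def subgrp_def
  proof (intro conjI ballI allI)
    show "0 \<in> setsum A B" unfolding setsum_def using A(1) B(1) by force
  next
    fix z w assume "z \<in> setsum A B" "w \<in> setsum A B"
    then obtain x y x' y' where z: "z = x + y" "x \<in> A" "y \<in> B" "w = x' + y'" "x' \<in> A" "y' \<in> B"
      by (auto simp: setsum_def)
    have "z + w = (x + x') + ((- x' + y + x') + y')" unfolding z by (simp only: grp_norm)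
    moreover have "x + x' \<in> A" using z A by blast
    moreover have "(- x' + y + x') + y' \<in> B" using B(2) nrmD(2)[OF assms(2)] z by blast
    ultimately show "z + w \<in> setsum A B" unfolding setsum_def by blast
  next
    fix z assume "z \<in> setsum A B"
    then obtain x y where z: "z = x + y" "x \<in> A" "y \<in> B" by (auto simp: setsum_def)
    have "- z = - x + (x + - y + - x)" unfolding z by (simp only: grp_norm)
    moreover have "- x \<in> A" "x + - y + - x \<in> B"
      using A(3) B(3) z nsubgrp_conj[OF assms(2)] by blast+
    ultimately show "- z \<in> setsum A B" unfolding setsum_def by blast
  next
    fix z g assume "z \<in> setsum A B"
    then obtain x y where z: "z = x + y" "x \<in> A" "y \<in> B" by (auto simp: setsum_def)
    have "- g + z + g = (- g + x + g) + (- g + y + g)" unfolding z by (rule conj_add)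
    then show "- g + z + g \<in> setsum A B"
      unfolding setsum_def using z nrmD(2)[OF assms(1)] nrmD(2)[OF assms(2)] by blast
  qed
qed

lemma setsum_left: "0 \<in> B \<Longrightarrow> A \<subseteq> setsum A B" and setsum_right: "0 \<in> A \<Longrightarrow> B \<subseteq> setsum A B"
  by (force simp: setsum_def)+

definition comm :: "'g::group_add \<Rightarrow> 'g \<Rightarrow> 'g" where
  "comm x y = - x + - y + x + y"

lemma comm_flip: "comm y x = - comm x y"
  and comm_add_right: "comm x (y + z) = comm x z + (- z + comm x y + z)"
  and comm_add_left: "comm (x + y) z = (- y + comm x z + y) + comm y z"
  and comm_uminus_right: "comm x (- y) = y + - comm x y + - y"
  and comm_zero_right: "comm x 0 = 0"
  and conj_comm: "- g + comm x y + g = comm (- g + x + g) (- g + y + g)"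
  and conj_eq_comm: "- y + x + y = x + comm x y"
  by (simp_all only: comm_def grp_norm)

function dimser :: "nat \<Rightarrow> 'g::group_add set" where
  "dimser n = (if n \<le> 1 then UNIV
     else setsum (gen {comm g x | g x. x \<in> dimser (n - 1)}) (gen {x + x | x. x \<in> dimser ((n + 1) div 2)}))"
  by pat_completeness auto
termination by (relation "Wellfounded.measure id") auto

declare dimser.simps [simp del]

lemma dimser_le_1: "n \<le> 1 \<Longrightarrow> dimser n = UNIV"
  by (simp add: dimser.simps)

lemma nsubgrp_dimser: "nsubgrp (dimser n :: 'g::group_add set)"
proof (induction n rule: less_induct)
  case (less n)
  show ?case
  proof (cases "n \<le> 1")
    case True then show ?thesis by (simp add: dimser_le_1 nsubgrp_def subgrp_def)
  next
    case False
    have 1: "nsubgrp (gen {comm g x | g x. x \<in> (dimser (n - 1) :: 'g set)})"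
    proof (rule nsubgrp_gen)
      fix h y assume "y \<in> {comm g x | g x. x \<in> (dimser (n - 1) :: 'g set)}"
      then obtain g x where "y = comm g x" "x \<in> dimser (n - 1)" by blast
      moreover have "nsubgrp (dimser (n - 1) :: 'g set)" using less False by simp
      ultimately show "- h + y + h \<in> {comm g x | g x. x \<in> (dimser (n - 1) :: 'g set)}"
        using conj_comm nrmD(2) by blast
    qed
    have 2: "nsubgrp (gen {x + x | x. x \<in> (dimser ((n + 1) div 2) :: 'g set)})"
    proof (rule nsubgrp_gen)
      fix h y assume "y \<in> {x + x | x. x \<in> (dimser ((n + 1) div 2) :: 'g set)}"
      then obtain x where "y = x + x" "x \<in> dimser ((n + 1) div 2)" by blast
      moreover have "nsubgrp (dimser ((n + 1) div 2) :: 'g set)" using less False by simp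
      ultimately show "- h + y + h \<in> {x + x | x. x \<in> (dimser ((n + 1) div 2) :: 'g set)}"
        using conj_add nrmD(2) by blast
    qed
    show ?thesis using False nsubgrp_setsum[OF 1 2] by (simp add: dimser.simps[of n])
  qed
qed

lemmas subgrp_dimser = nrmD(1)[OF nsubgrp_dimser]
lemmas dimserD = subgrpD[OF subgrp_dimser]

lemma comm_in_dimser:
  assumes "x \<in> dimser n" shows "comm g x \<in> dimser (Suc n)" "comm x g \<in> dimser (Suc n)"
proof -
  show *: "comm g x \<in> dimser (Suc n)"
  proof (cases "n = 0")
    case True then show ?thesis by (simp add: dimser_le_1)
  next
    case False
    have "comm g x \<in> gen {comm g x | g x. x \<in> dimser n}" using assms by (blast intro: gen.incl)
    then have "comm g x \<in> setsum (gen {comm g x | g x. x \<in> dimser n})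
        (gen {x + x | x. x \<in> dimser ((Suc n + 1) div 2)})"
      using setsum_left gen.zero by blast
    then show ?thesis using False by (simp add: dimser.simps[of "Suc n"])
  qed
  show "comm x g \<in> dimser (Suc n)" using dimserD(3)[OF *] by (simp only: comm_flip[of x g])
qed

lemma double_in_dimser: assumes "x \<in> dimser n" shows "x + x \<in> dimser (2 * n)"
proof (cases "n = 0")
  case True then show ?thesis by (simp add: dimser_le_1)
next
  case False
  have "x + x \<in> gen {x + x | x. x \<in> dimser n}" using assms by (blast intro: gen.incl)
  then have "x + x \<in> setsum (gen {comm g x | g x. x \<in> dimser (2 * n - 1)}) (gen {x + x | x. x \<in> dimser n})"
    using setsum_right gen.zero by blast
  then show ?thesis using False by (simp add: dimser.simps[of "2 * n"])
qed

lemma dimser_Suc: "dimser (Suc n) \<subseteq> (dimser n :: 'g::group_add set)"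
proof (induction n rule: less_induct)
  case (less n)
  show ?case
  proof (cases "n \<le> 1")
    case True then show ?thesis by (simp add: dimser_le_1)
  next
    case False
    have sub: "dimser n \<subseteq> (dimser (n - 1) :: 'g set)"
      using less[of "n - 1"] False by simp
    have "dimser ((Suc n + 1) div 2) \<subseteq> (dimser ((n + 1) div 2) :: 'g set)"
    proof (cases "even n")
      case True
      then have "(Suc n + 1) div 2 = Suc ((n + 1) div 2)" "(n + 1) div 2 < n" using False by presburger+
      then show ?thesis using less by simp
    next
      case odd: False
      then have "(Suc n + 1) div 2 = (n + 1) div 2" using False by presburger
      then show ?thesis by simp
    qed
    then have "gen {x + x | x. x \<in> (dimser ((Suc n + 1) div 2) :: 'g set)}
        \<subseteq> gen {x + x | x. x \<in> dimser ((n + 1) div 2)}" by (intro gen_mono) blast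
    moreover have "gen {comm g x | g x. x \<in> (dimser n :: 'g set)}
        \<subseteq> gen {comm g x | g x. x \<in> dimser (n - 1)}" using sub by (intro gen_mono) blast
    ultimately show ?thesis
      using False by (simp add: dimser.simps[of "Suc n"] dimser.simps[of n] setsum_def) blast
  qed
qed

lemma dimser_antimono: "m \<le> n \<Longrightarrow> dimser n \<subseteq> (dimser m :: 'g::group_add set)"
  using lift_Suc_antimono_le[of dimser, OF dimser_Suc] by blast

primrec npow :: "nat \<Rightarrow> 'g::group_add \<Rightarrow> 'g" where
  "npow 0 x = 0"
| "npow (Suc n) x = x + npow n x"

lemma npow_add: "npow (m + n) x = npow m x + npow n x"
  by (induction m) (simp_all add: add.assoc)

lemma npow_one [simp]: "npow 1 x = x" "npow (Suc 0) x = x" by simp_all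

lemma npow_mult: "npow (m * n) x = npow m (npow n x)"
  by (induction m) (simp_all add: npow_add)

lemma npow_double: "npow (2 * n) x = npow n x + npow n x"
  by (simp only: mult_2 npow_add)

lemma npow_comm: "x + npow n x = npow n x + x"
  using npow_add[of n 1 x] by simp

lemma npow_in: "subgrp H \<Longrightarrow> x \<in> H \<Longrightarrow> npow n x \<in> H"
  by (induction n) (auto dest: subgrpD)

lemma npow_two_in_dimser: "x \<in> dimser n \<Longrightarrow> npow (2 ^ j) x \<in> dimser (2 ^ j * n)"
proof (induction j)
  case 0 then show ?case by simp
next
  case (Suc j) then show ?case
    using double_in_dimser[of "npow (2 ^ j) x" "2 ^ j * n"] by (simp add: npow_double mult.assoc)
qed

text \<open>With s the power for \<open>i\<close> and y = [x, s], the identity [x, s^2] = y^2 [y, s]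
  doubles the exponent. The square has weight 2 (w + 2^i), at least w + 2^(i+1), and [y, s] gains
  2^i twice. Commuting with a 2-power of \<open>t\<close> thus gains the full exponent and not just
  1.\<close>

lemma comm_npow_two_in_dimser:
  assumes "x \<in> dimser w" shows "comm x (npow (2 ^ i) t) \<in> dimser (w + 2 ^ i)"
  using assms
proof (induction i arbitrary: x w)
  case 0 then show ?case using comm_in_dimser(2) by simp
next
  case (Suc i)
  let ?s = "npow (2 ^ i) t"
  let ?y = "comm x ?s"
  have y: "?y \<in> dimser (w + 2 ^ i)" using Suc by blast
  have "?y + ?y \<in> dimser (2 * (w + 2 ^ i))" using y by (rule double_in_dimser)
  then have 1: "?y + ?y \<in> dimser (w + 2 ^ Suc i)"
    using dimser_antimono[of "w + 2 ^ Suc i" "2 * (w + 2 ^ i)"] by auto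
  have 2: "comm ?y ?s \<in> dimser (w + 2 ^ Suc i)" using Suc.IH[OF y] by (simp add: mult_2 add.assoc)
  have "comm x (npow (2 ^ Suc i) t) = ?y + ?y + comm ?y ?s"
    by (simp only: power_Suc npow_double comm_add_right, simp only: conj_eq_comm, simp only: add.assoc)
  then show ?case using 1 2 dimserD(2) by metis
qed

text \<open>The element \<open>x\<close> normalizes \<open>Y\<close> and has a positive power in it,
  so natural exponents are enough: x^(-e) is x^(e (r-1)) times an element of \<open>Y\<close>. All
  normal forms below are built by this one-generator extension.\<close>

lemma subgrp_extend:
  assumes Y: "subgrp Y" and c: "\<And>y. y \<in> Y \<Longrightarrow> comm y x \<in> Y" "\<And>y. y \<in> Y \<Longrightarrow> comm y (- x) \<in> Y"
    and r: "npow r x \<in> Y" "r > 0"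
  shows "subgrp {npow e x + y | e y. y \<in> Y}" (is "subgrp ?Z")
proof -
  have c1: "- npow e x + y + npow e x \<in> Y" if "y \<in> Y" for e y
    using that
  proof (induction e arbitrary: y)
    case (Suc e)
    have "- npow (Suc e) x + y + npow (Suc e) x = - npow e x + (- x + y + x) + npow e x"
      by (simp only: npow.simps grp_norm)
    moreover have "- x + y + x \<in> Y" unfolding conj_eq_comm using c(1) Y Suc.prems subgrpD by blast
    ultimately show ?case using Suc.IH by metis
  qed simp
  have c2: "npow e x + y + - npow e x \<in> Y" if "y \<in> Y" for e y
    using that
  proof (induction e arbitrary: y)
    case (Suc e)
    have "npow (Suc e) x + y + - npow (Suc e) x = npow e x + (- (- x) + y + - x) + - npow e x"
      unfolding npow.simps npow_comm by (simp only: npow.simps grp_norm)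
    moreover have "- (- x) + y + - x \<in> Y" unfolding conj_eq_comm using c(2) Y Suc.prems subgrpD by blast
    ultimately show ?case using Suc.IH by metis
  qed simp
  show ?thesis unfolding subgrp_def
  proof (intro conjI ballI)
    have "0 = npow 0 x + 0" by simp
    then show "0 \<in> ?Z" using subgrpD(1)[OF Y] by blast
  next
    fix z w assume "z \<in> ?Z" "w \<in> ?Z"
    then obtain e y e' y' where z: "z = npow e x + y" "y \<in> Y" "w = npow e' x + y'" "y' \<in> Y" by blast
    have "z + w = npow (e + e') x + ((- npow e' x + y + npow e' x) + y')"
      unfolding z npow_add by (simp only: grp_norm)
    then show "z + w \<in> ?Z" using z c1 subgrpD(2)[OF Y] by blast
  next
    fix z assume "z \<in> ?Z"
    then obtain e y where z: "z = npow e x + y" "y \<in> Y" by blast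
    have *: "npow (e * r) x \<in> Y" unfolding npow_mult[of e r x] using r(1) Y by (rule npow_in[rotated])
    let ?q = "npow (e * (r - 1)) x"
    have "e * r = e + e * (r - 1)" using r(2) by (cases r) auto
    then have pq: "npow (e * r) x = npow e x + ?q" by (simp only: npow_add)
    have "- z = ?q + ((- ?q + - y + ?q) + - npow (e * r) x)"
      unfolding z pq by (simp only: grp_norm)
    moreover have "(- ?q + - y + ?q) + - npow (e * r) x \<in> Y"
      using c1 z(2) * subgrpD(2,3)[OF Y] by blast
    ultimately show "- z \<in> ?Z" by blast
  qed
qed


section \<open>Branching structure\<close>

text \<open>The group H of the overview. It is the derived subgroup and the normal closure of
  [\<tau>, \<mu>], by \<open>comm_in_kerexp\<close> and \<open>kerexp_least\<close>.\<close>

definition kerexp :: "bsv set" where "kerexp = {h. tau_exp h = 0 \<and> mu_exp h = 0}"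

lemma nsubgrp_kerexp: "nsubgrp kerexp"
  by (auto simp: nsubgrp_def subgrp_def kerexp_def)

lemmas subgrp_kerexp = nrmD(1)[OF nsubgrp_kerexp]
lemmas kerexpD = subgrpD[OF subgrp_kerexp]

lemma comm_in_kerexp: "comm x y \<in> kerexp"
  by (simp add: kerexp_def comm_def)

lemma root_perm_kerexp: "h \<in> kerexp \<Longrightarrow> root_perm h b = b"
  using root_perm_False[of h] root_perm_Not[of h False] by (cases b) (auto simp: kerexp_def)

abbreviation tau_mu_comm :: bsv where "tau_mu_comm \<equiv> comm gtau gmu"

text \<open>Modulo \<open>E\<close> the two generators commute, hence everything does: the
  commutator rules pass from generators to all elements in the right argument, and
  \<open>comm_flip\<close> gives access to the left one.\<close>

lemma all_comm_in:
  assumes E: "nsubgrp E" "tau_mu_comm \<in> E" shows "comm x y \<in> E"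
proof -
  note E' = subgrpD[OF nrmD(1)[OF E(1)]]
  have step: "comm x y \<in> E" if "comm x gtau \<in> E" "comm x gmu \<in> E" for x y :: bsv
  proof (induction y rule: bsv_induct)
    case zero show ?case using E' by (simp add: comm_zero_right)
  next
    case (tau y)
    show ?case unfolding comm_add_right by (rule E'(2)[OF that(1) nrmD(2)[OF E(1) tau]])
  next
    case (mu y)
    show ?case unfolding comm_add_right by (rule E'(2)[OF that(2) nrmD(2)[OF E(1) mu]])
  next
    case (tau_inv y)
    show ?case unfolding diff_conv_add_uminus comm_add_right comm_uminus_right
      by (rule E'(2)[OF nsubgrp_conj[OF E(1) E'(3)[OF that(1)]] nrmD(2)[OF E(1) tau_inv]])
  next
    case (mu_inv y)
    show ?case unfolding diff_conv_add_uminus comm_add_right comm_uminus_right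
      by (rule E'(2)[OF nsubgrp_conj[OF E(1) E'(3)[OF that(2)]] nrmD(2)[OF E(1) mu_inv]])
  qed
  have self: "comm x x = 0" for x :: bsv by (simp only: comm_def grp_norm)
  have "comm gtau x \<in> E" by (rule step) (use E E' self in auto)
  moreover have "comm gmu x \<in> E"
    by (rule step) (use E E' self in \<open>auto simp: comm_flip[of gmu gtau]\<close>)
  ultimately have "comm x gtau \<in> E" "comm x gmu \<in> E"
    using E'(3) by (simp_all add: comm_flip[of x])
  then show ?thesis by (rule step)
qed

lemma kerexp_least:
  assumes E: "nsubgrp E" "tau_mu_comm \<in> E" shows "kerexp \<subseteq> E"
proof -
  note E' = subgrpD[OF nrmD(1)[OF E(1)]]
  have sw: "- (v + u) + (u + v) \<in> E" for u v :: bsv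
    using all_comm_in[OF E, of u v] by (simp only: comm_def grp_norm)
  have cn: "- g + x + g \<in> E" if "x \<in> E" for x g using nrmD(2)[OF E(1) that] .
  let ?w = "\<lambda>n m. npow n gtau + npow m gmu"
  \<comment> \<open>Modulo \<open>E\<close> every element is \<tau>^a \<mu>^b, but
    \<open>npow\<close> has natural exponents only; a and b are written as differences by putting a
    word with natural exponents in front of \<open>g\<close>. If both exponents of \<open>g\<close>
    are 0, the two words coincide and cancel.\<close>
  have rep: "\<exists>n m n' m'. - ?w n' m' + (?w n m + g) \<in> E \<and> int n' = int n + tau_exp g \<and> int m' = int m + mu_exp g" for g
  proof (induction g rule: bsv_induct)
    case zero show ?case using E'(1) by (intro exI[of _ 0]) simp
  next
    case (tau g)
    then obtain n m n' m' where e: "- ?w n' m' + (?w n m + g) \<in> E"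
      and i: "int n' = int n + tau_exp g" "int m' = int m + mu_exp g" by blast
    have "- ?w (Suc n') m' + (?w n m + (g + gtau))
      = (- (gtau + ?w n' m') + (?w n' m' + gtau)) + (- gtau + (- ?w n' m' + (?w n m + g)) + gtau)"
      by (simp only: npow.simps grp_norm)
    then have "- ?w (Suc n') m' + (?w n m + (g + gtau)) \<in> E" using E'(2)[OF sw cn[OF e]] by simp
    moreover have "int (Suc n') = int n + tau_exp (g + gtau)" "int m' = int m + mu_exp (g + gtau)" using i by simp_all
    ultimately show ?case by blast
  next
    case (mu g)
    then obtain n m n' m' where e: "- ?w n' m' + (?w n m + g) \<in> E"
      and i: "int n' = int n + tau_exp g" "int m' = int m + mu_exp g" by blast
    have "- ?w n' (Suc m') + (?w n m + (g + gmu)) = - gmu + (- ?w n' m' + (?w n m + g)) + gmu"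
      by (simp only: npow.simps npow_comm) (simp only: grp_norm)
    then have "- ?w n' (Suc m') + (?w n m + (g + gmu)) \<in> E" using cn[OF e] by simp
    moreover have "int n' = int n + tau_exp (g + gmu)" "int (Suc m') = int m + mu_exp (g + gmu)" using i by simp_all
    ultimately show ?case by blast
  next
    case (tau_inv g)
    then obtain n m n' m' where e: "- ?w n' m' + (?w n m + g) \<in> E"
      and i: "int n' = int n + tau_exp g" "int m' = int m + mu_exp g" by blast
    have "- ?w n' m' + (?w (Suc n) m + (g - gtau))
      = (- ?w n' m' + (?w n m + g)) + comm (?w n m + g) (- gtau)"
      by (simp only: npow.simps comm_def grp_norm)
    then have "- ?w n' m' + (?w (Suc n) m + (g - gtau)) \<in> E"
      using E'(2)[OF e all_comm_in[OF E]] by simp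
    moreover have "int n' = int (Suc n) + tau_exp (g - gtau)" "int m' = int m + mu_exp (g - gtau)" using i by simp_all
    ultimately show ?case by blast
  next
    case (mu_inv g)
    then obtain n m n' m' where e: "- ?w n' m' + (?w n m + g) \<in> E"
      and i: "int n' = int n + tau_exp g" "int m' = int m + mu_exp g" by blast
    have "- ?w n' m' + (?w n (Suc m) + (g - gmu)) = (- ?w n' m' + (?w n m + g)) + comm g (- gmu)"
      by (simp only: npow.simps npow_comm) (simp only: comm_def grp_norm)
    then have "- ?w n' m' + (?w n (Suc m) + (g - gmu)) \<in> E"
      using E'(2)[OF e all_comm_in[OF E]] by simp
    moreover have "int n' = int n + tau_exp (g - gmu)" "int m' = int (Suc m) + mu_exp (g - gmu)" using i by simp_all
    ultimately show ?case by blast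
  qed
  show ?thesis
  proof
    fix h assume "h \<in> kerexp"
    then obtain n m n' m' where "- ?w n' m' + (?w n m + h) \<in> E" "int n' = int n" "int m' = int m"
      using rep[of h] by (auto simp: kerexp_def)
    then have "- ?w n m + (?w n m + h) \<in> E" by simp
    then show "h \<in> E" by (simp only: minus_add_cancel)
  qed
qed

section \<open>Sections of the first-level stabilizer and embeddings of H at vertices\<close>

lemma tree_sec_stab_add: "root_perm g False = False \<Longrightarrow> tree_sec b (g + h) = tree_sec b g + tree_sec b h"
  using root_perm_Not[of g False] by (cases b) simp_all

lemma root_perm_id: "root_perm g False = False \<Longrightarrow> root_perm g b = b"
  using root_perm_Not[of g False] by (cases b) simp_all

lemma tree_sec_stab_uminus: "root_perm g False = False \<Longrightarrow> tree_sec b (- g) = - tree_sec b g"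
proof -
  assume "root_perm g False = False"
  then have "root_perm (- g) b = b" using root_perm_id[of g b] root_perm_uminus_root_perm[of g b] by simp
  then show ?thesis by (simp add: tree_sec_uminus)
qed

lemma root_perm_stab_uminus: "root_perm g False = False \<Longrightarrow> root_perm (- g) b = b"
  using root_perm_id[of g b] root_perm_uminus_root_perm[of g b] by simp

text \<open>\<tau>^2 has both sections equal to \<tau> and \<mu>^(-2) has both equal to \<mu>; on
  the stabilizer the section map is a homomorphism, so it is onto.\<close>

lemma stab_section: "\<exists>f. root_perm f False = False \<and> tree_sec b f = g"
proof (induction g rule: bsv_induct)
  case zero show ?case by (rule exI[of _ 0]) simp
next
  have add: "\<exists>f. root_perm f False = False \<and> tree_sec b f = g + h"
    if g: "\<exists>f. root_perm f False = False \<and> tree_sec b f = g" and h: "\<exists>f. root_perm f False = False \<and> tree_sec b f = h" for g h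
  proof -
    obtain f f' where "root_perm f False = False" "tree_sec b f = g" "root_perm f' False = False" "tree_sec b f' = h"
      using g h by blast
    then have "root_perm (f + f') False = False \<and> tree_sec b (f + f') = g + h" by (simp only: root_perm_add tree_sec_stab_add)
    then show ?thesis by blast
  qed
  have neg: "\<exists>f. root_perm f False = False \<and> tree_sec b f = - g"
    if g: "\<exists>f. root_perm f False = False \<and> tree_sec b f = g" for g
  proof -
    obtain f where "root_perm f False = False" "tree_sec b f = g" using g by blast
    then have "root_perm (- f) False = False \<and> tree_sec b (- f) = - g" by (simp only: root_perm_stab_uminus tree_sec_stab_uminus)
    then show ?thesis by blast
  qed
  have t: "\<exists>f. root_perm f False = False \<and> tree_sec b f = gtau"
    by (rule exI[of _ "gtau + gtau"]) (cases b; simp)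
  have m: "\<exists>f. root_perm f False = False \<and> tree_sec b f = gmu"
    by (rule exI[of _ "- gmu + - gmu"]) (cases b; simp del: add_uminus_conv_diff)
  {
    case (tau x) then show ?case by (rule add[OF _ t])
  next
    case (mu x) then show ?case by (rule add[OF _ m])
  next
    case (tau_inv x) then show ?case unfolding diff_conv_add_uminus by (rule add[OF _ neg[OF t]])
  next
    case (mu_inv x) then show ?case unfolding diff_conv_add_uminus by (rule add[OF _ neg[OF m]])
  }
qed

lemma tree_sec_tau_mu_comm: "tree_sec False tau_mu_comm = - gtau + - gmu" "tree_sec True tau_mu_comm = gmu + gtau"
  by (simp_all add: comm_def add.assoc del: add_uminus_conv_diff)

lemma tau_mu_comm_add_conj: 
  "root_perm (tau_mu_comm + (- gtau + tau_mu_comm + gtau)) False = False"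
  "tree_sec True (tau_mu_comm + (- gtau + tau_mu_comm + gtau)) = 0"
  "tree_sec False (tau_mu_comm + (- gtau + tau_mu_comm + gtau)) = - gtau + - tau_mu_comm + gtau"
  by (simp_all add: comm_def del: add_uminus_conv_diff) (simp_all only: grp_norm)

text \<open>The \<open>h\<close> that occur as <<h, 1>> form a subgroup, normal because conjugating
  elements lift by \<open>stab_section\<close>; it contains a conjugate of the inverse of
  [\<tau>, \<mu>] by \<open>tau_mu_comm_add_conj\<close>, hence all of H. Conjugation by \<tau>
  moves the copy to the other vertex.\<close>

lemma kerexp_branch: 
  assumes "h \<in> kerexp" shows "\<exists>g. root_perm g False = False \<and> tree_sec b g = h \<and> tree_sec (\<not> b) g = 0"
proof -
  let ?P = "\<lambda>h g. root_perm g False = False \<and> tree_sec False g = h \<and> tree_sec True g = 0"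
  let ?E = "{h. \<exists>g. ?P h g}"
  have conj: "- k + h + k \<in> ?E" if H: "h \<in> ?E" for h k
  proof -
    obtain g where g: "?P h g" using H by blast
    obtain f where f: "root_perm f False = False" "tree_sec False f = k" using stab_section by blast
    have "?P (- k + h + k) (- f + g + f)"
      using g f root_perm_id[of g True] root_perm_id[of f True]
      by (simp add: tree_sec_stab_uminus root_perm_stab_uminus del: add_uminus_conv_diff)
    then show ?thesis by blast
  qed
  have "nsubgrp ?E" unfolding nsubgrp_def subgrp_def
  proof (intro conjI ballI allI conj)
    show "0 \<in> ?E" by (auto intro!: exI[of _ 0])
  next
    fix x y assume "x \<in> ?E" "y \<in> ?E"
    then obtain g h where "?P x g" "?P y h" by blast
    then have "?P (x + y) (g + h)" using root_perm_id[of g True] by simp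
    then show "x + y \<in> ?E" by blast
  next
    fix x assume "x \<in> ?E"
    then obtain g where "?P x g" by blast
    then have "?P (- x) (- g)" by (simp add: tree_sec_stab_uminus root_perm_stab_uminus)
    then show "- x \<in> ?E" by blast
  qed
  moreover have "tau_mu_comm \<in> ?E"
  proof -
    have "- gtau + - tau_mu_comm + gtau \<in> ?E" using tau_mu_comm_add_conj by blast
    then have "- tau_mu_comm \<in> ?E" using nsubgrp_conj[OF \<open>nsubgrp ?E\<close>, of _ gtau] by (metis (no_types, lifting) add.assoc add_minus_cancel right_minus add_0_right)
    then show ?thesis using subgrpD(3)[OF nrmD(1)[OF \<open>nsubgrp ?E\<close>]] by (metis (no_types, lifting) minus_minus)
  qed
  ultimately have "h \<in> ?E" using kerexp_least assms by blast
  then obtain g where g: "?P h g" by blast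
  have "root_perm (- gtau + g + gtau) False = False" "tree_sec True (- gtau + g + gtau) = h" "tree_sec False (- gtau + g + gtau) = 0"
    using g root_perm_id[of g True] by (simp_all del: add_uminus_conv_diff)
  then show ?thesis using g by (cases b) (simp only: not_True_eq_False, blast, auto)
qed

definition node_embed :: "bool \<Rightarrow> bsv \<Rightarrow> bsv" where
  "node_embed b h = (SOME g. root_perm g False = False \<and> tree_sec b g = h \<and> tree_sec (\<not> b) g = 0)"

lemma node_embed:
  assumes "h \<in> kerexp"
  shows "root_perm (node_embed b h) c = c" "tree_sec b (node_embed b h) = h" "tree_sec (\<not> b) (node_embed b h) = 0"
proof -
  have *: "root_perm (node_embed b h) False = False \<and> tree_sec b (node_embed b h) = h \<and> tree_sec (\<not> b) (node_embed b h) = 0"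
    unfolding node_embed_def by (rule someI_ex[OF kerexp_branch[OF assms]])
  then show "tree_sec b (node_embed b h) = h" "tree_sec (\<not> b) (node_embed b h) = 0" by auto
  show "root_perm (node_embed b h) c = c" using * root_perm_id by blast
qed

lemma node_embed_tree_sec: "h \<in> kerexp \<Longrightarrow> tree_sec c (node_embed b h) = (if c = b then h else 0)"
  using node_embed(2,3)[of h b] by (cases b; cases c) auto

lemma node_embed_eqI:
  "h \<in> kerexp \<Longrightarrow> root_perm g False = False \<Longrightarrow> tree_sec b g = h \<Longrightarrow> tree_sec (\<not> b) g = 0 \<Longrightarrow> g = node_embed b h"
  by (rule bsv_eqI; cases b) (auto simp: node_embed node_embed_tree_sec)

lemma node_embed_in: assumes "h \<in> kerexp" shows "node_embed b h \<in> kerexp"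
proof -
  have "tau_exp (tree_sec False (node_embed b h)) = 0" "tau_exp (tree_sec True (node_embed b h)) = 0"
    "mu_exp (tree_sec False (node_embed b h)) = 0" "mu_exp (tree_sec True (node_embed b h)) = 0"
    using assms by (auto simp: node_embed_tree_sec kerexp_def)
  then show ?thesis using tau_exp_sections[of "node_embed b h"] mu_exp_sections[of "node_embed b h"] by (simp add: kerexp_def)
qed

lemma node_embed_add: "h \<in> kerexp \<Longrightarrow> k \<in> kerexp \<Longrightarrow> node_embed b (h + k) = node_embed b h + node_embed b k"
  by (rule sym, rule node_embed_eqI) (simp_all add: kerexpD node_embed tree_sec_stab_add node_embed_tree_sec)

lemma node_embed_zero: "node_embed b 0 = 0"
  by (rule sym, rule node_embed_eqI) (simp_all add: kerexpD)

lemma node_embed_uminus: "h \<in> kerexp \<Longrightarrow> node_embed b (- h) = - node_embed b h"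
  by (rule sym, rule node_embed_eqI) (simp_all add: kerexpD node_embed tree_sec_stab_uminus root_perm_stab_uminus node_embed_tree_sec)

lemma node_embed_conj:
  assumes "h \<in> kerexp" "root_perm f False = False" "tree_sec b f = k"
  shows "node_embed b (- k + h + k) = - f + node_embed b h + f"
  by (rule sym, rule node_embed_eqI)
    (use assms root_perm_id[OF assms(2), of b] root_perm_id[OF assms(2), of "\<not> b"] in
      \<open>auto simp: nrmD(2)[OF nsubgrp_kerexp] node_embed root_perm_stab_uminus tree_sec_stab_uminus node_embed_tree_sec\<close>)

lemma node_embed_True: "h \<in> kerexp \<Longrightarrow> node_embed True h = - gtau + node_embed False h + gtau"
  by (rule sym, rule node_embed_eqI) (simp_all add: node_embed node_embed_tree_sec del: add_uminus_conv_diff)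

lemma node_embed_decomp:
  assumes "root_perm k False = False" "tree_sec False k \<in> kerexp" "tree_sec True k \<in> kerexp"
  shows "k = node_embed False (tree_sec False k) + node_embed True (tree_sec True k)"
  by (rule bsv_eqI) (use assms in \<open>simp_all add: node_embed node_embed_tree_sec\<close>)

primrec vertex_embed :: "bool list \<Rightarrow> bsv \<Rightarrow> bsv" where
  "vertex_embed [] h = h"
| "vertex_embed (b # v) h = node_embed b (vertex_embed v h)"

lemma vertex_embed_in [simp]: "h \<in> kerexp \<Longrightarrow> vertex_embed v h \<in> kerexp"
  by (induction v) (simp_all add: node_embed_in)

lemma vertex_embed_append: "vertex_embed (v @ w) h = vertex_embed v (vertex_embed w h)"
  by (induction v) simp_all

lemma vertex_embed_zero [simp]: "vertex_embed v 0 = 0"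
  by (induction v) (simp_all add: node_embed_zero)

lemma vertex_embed_add: "h \<in> kerexp \<Longrightarrow> k \<in> kerexp \<Longrightarrow> vertex_embed v (h + k) = vertex_embed v h + vertex_embed v k"
  by (induction v) (simp_all add: node_embed_add)

lemma vertex_embed_uminus: "h \<in> kerexp \<Longrightarrow> vertex_embed v (- h) = - vertex_embed v h"
  by (induction v) (simp_all add: node_embed_uminus)

text \<open>Lifting \<open>g\<close> through \<open>stab_section\<close> at every vertex on the path
  gives one \<open>f\<close> that serves all \<open>h\<close>. So a condition on the copies at
  \<open>v\<close> that is invariant under conjugation in the whole group is also invariant under
  conjugating \<open>h\<close> itself.\<close>

lemma vertex_embed_conj: "\<exists>f. \<forall>h\<in>kerexp. vertex_embed v (- g + h + g) = - f + vertex_embed v h + f"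
proof (induction v)
  case Nil show ?case by auto
next
  case (Cons b v)
  then obtain f' where f': "\<forall>h\<in>kerexp. vertex_embed v (- g + h + g) = - f' + vertex_embed v h + f'" by blast
  obtain f where f: "root_perm f False = False" "tree_sec b f = f'" using stab_section by blast
  have "\<forall>h\<in>kerexp. vertex_embed (b # v) (- g + h + g) = - f + vertex_embed (b # v) h + f"
    using f' node_embed_conj[OF _ f] by simp
  then show ?case by blast
qed

lemma npow_gtau_double: "root_perm (npow (2 * n) gtau) b = b" "tree_sec b (npow (2 * n) gtau) = npow n gtau"
proof -
  have "root_perm (npow (2 * n) gtau) b = b \<and> tree_sec b (npow (2 * n) gtau) = npow n gtau"
    by (induction n) (cases b; simp add: add.assoc)+
  then show "root_perm (npow (2 * n) gtau) b = b" "tree_sec b (npow (2 * n) gtau) = npow n gtau" by auto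
qed

lemma vertex_embed_zeros_conj:
  "h \<in> kerexp \<Longrightarrow> vertex_embed (replicate i False) (- gtau + h + gtau)
    = - npow (2 ^ i) gtau + vertex_embed (replicate i False) h + npow (2 ^ i) gtau"
  by (induction i) (simp_all add: node_embed_conj npow_gtau_double)

text \<open>\<tau> is the binary odometer with the least significant digit first: \<tau>^j moves the
  leftmost vertex to \<open>v\<close>, where j is the number with digits \<open>v\<close>. The bound
  on \<open>j\<close> matters in \<open>branch_generated\<close>.\<close>

lemma vertex_embed_transitive:
  "\<exists>j<2 ^ length v. \<forall>h\<in>kerexp. vertex_embed v h
    = - npow j gtau + vertex_embed (replicate (length v) False) h + npow j gtau"
proof (induction v)
  case Nil show ?case by (rule exI[of _ 0]) simp
next
  case (Cons b v)
  then obtain j where j: "j < 2 ^ length v"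
    "\<forall>h\<in>kerexp. vertex_embed v h = - npow j gtau + vertex_embed (replicate (length v) False) h + npow j gtau" by blast
  have F: "node_embed False (vertex_embed v h) = - npow (2 * j) gtau
      + vertex_embed (replicate (length (b # v)) False) h + npow (2 * j) gtau" if "h \<in> kerexp" for h
    using j(2) that by (simp add: node_embed_conj npow_gtau_double)
  show ?case
  proof (cases b)
    case False
    then show ?thesis using F j(1) by (intro exI[of _ "2 * j"]) auto
  next
    case True
    have "vertex_embed (b # v) h = - npow (Suc (2 * j)) gtau
      + vertex_embed (replicate (length (b # v)) False) h + npow (Suc (2 * j)) gtau" if "h \<in> kerexp" for h
      using that True F[OF that] by (simp only: vertex_embed.simps node_embed_True vertex_embed_in npow.simps npow_comm) (simp only: grp_norm)
    then show ?thesis using j(1) by (intro exI[of _ "Suc (2 * j)"]) auto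
  qed
qed

text \<open>Induction step: \<open>c c\<^sup>\<tau>\<close> is a conjugate of \<open>c\<^sup>-\<^sup>1\<close> placed at vertex 0, and \<open>\<tau>\<^bsup>N\<^esup>\<close>, \<open>N = 2\<^sup>i\<close>, acts as
  \<open>\<tau>\<close> below every vertex of level \<open>i\<close>; so the copy of that conjugate at level \<open>i + 1\<close> is
  \<open>x x\<^bsup>\<tau>^N\<^esup> = x\<^sup>2 [x, \<tau>\<^bsup>N\<^esup>]\<close>, where \<open>x\<close> is the copy of \<open>c\<close> at level \<open>i\<close>.\<close>

lemma vertex_embed_in_dimser:
  "h \<in> kerexp \<Longrightarrow> vertex_embed v h \<in> dimser (2 ^ length v + 1)"
proof (induction "length v" arbitrary: v h)
  case 0
  have "tau_mu_comm \<in> dimser (Suc 1)" by (rule comm_in_dimser) (simp add: dimser_le_1)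
  then have "kerexp \<subseteq> dimser 2"
    by (intro kerexp_least nsubgrp_dimser) (simp add: numeral_2_eq_2)
  with 0 show ?case by (auto simp: numeral_2_eq_2)
next
  case (Suc i)
  let ?z = "replicate i False" and ?n = "2 ^ Suc i + 1 :: nat"
  define x where "x = vertex_embed ?z tau_mu_comm"
  have tau_mu_comm: "tau_mu_comm \<in> kerexp" by (rule comm_in_kerexp)
  let ?c' = "- gtau + - tau_mu_comm + gtau"
  have c': "?c' \<in> kerexp" "- gtau + tau_mu_comm + gtau \<in> kerexp"
    using nrmD(2)[OF nsubgrp_kerexp] kerexpD(3)[OF tau_mu_comm] tau_mu_comm by blast+
  have x: "x \<in> dimser (2 ^ i + 1)" using Suc.hyps(1)[of ?z tau_mu_comm] tau_mu_comm by (simp add: x_def)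
  have e: "tau_mu_comm + (- gtau + tau_mu_comm + gtau) = node_embed False ?c'"
    by (rule node_embed_eqI) (use tau_mu_comm_add_conj c' in simp_all)
  have "vertex_embed (replicate (Suc i) False) ?c' = vertex_embed ?z (tau_mu_comm + (- gtau + tau_mu_comm + gtau))"
    unfolding e by (simp only: replicate_Suc replicate_append_same[symmetric] vertex_embed_append vertex_embed.simps)
  also have "\<dots> = x + x + comm x (npow (2 ^ i) gtau)"
    using tau_mu_comm c' by (simp only: vertex_embed_add vertex_embed_zeros_conj x_def) (simp only: conj_eq_comm, simp only: add.assoc)
  also have "\<dots> \<in> dimser ?n"
  proof (rule dimserD(2))
    show "comm x (npow (2 ^ i) gtau) \<in> dimser ?n"
      using comm_npow_two_in_dimser[OF x, of i gtau] by (simp add: mult_2 add_ac)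
    have "x + x \<in> dimser (2 * (2 ^ i + 1))" using x by (rule double_in_dimser)
    then show "x + x \<in> dimser ?n" using dimser_antimono[of ?n "2 * (2 ^ i + 1)"] by auto
  qed
  finally have c'_in: "vertex_embed (replicate (Suc i) False) ?c' \<in> dimser ?n" .
  \<comment> \<open>One conjugate of the inverse of [\<tau>, \<mu>] is settled; normality of this
    set carries the result to all of H at the leftmost vertex, and
    \<open>vertex_embed_transitive\<close> to the rest of the level.\<close>
  let ?E = "{h \<in> kerexp. vertex_embed (replicate (Suc i) False) h \<in> dimser ?n}"
  have "nsubgrp ?E" unfolding nsubgrp_def subgrp_def
  proof (intro conjI ballI allI)
    show "0 \<in> ?E" using kerexpD(1) by (auto simp: dimserD(1) simp del: vertex_embed.simps replicate.simps)
  next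
    fix x y assume "x \<in> ?E" "y \<in> ?E" then show "x + y \<in> ?E"
      by (auto simp: vertex_embed_add kerexpD(2) dimserD(2) simp del: vertex_embed.simps replicate.simps power_Suc)
  next
    fix x assume "x \<in> ?E" then show "- x \<in> ?E"
      by (auto simp: vertex_embed_uminus kerexpD(3) dimserD(3) simp del: vertex_embed.simps replicate.simps power_Suc)
  next
    fix x g assume x: "x \<in> ?E"
    obtain f where "\<forall>h\<in>kerexp. vertex_embed (replicate (Suc i) False) (- g + h + g)
      = - f + vertex_embed (replicate (Suc i) False) h + f" using vertex_embed_conj by blast
    then show "- g + x + g \<in> ?E" using x
      by (auto simp: nrmD(2)[OF nsubgrp_dimser] nrmD(2)[OF nsubgrp_kerexp] simp del: vertex_embed.simps replicate.simps power_Suc)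
  qed
  moreover have "tau_mu_comm \<in> ?E"
  proof -
    have "?c' \<in> ?E" using c'_in c' by simp
    then have "gtau + ?c' + - gtau \<in> ?E" using nsubgrp_conj[OF \<open>nsubgrp ?E\<close>] by blast
    then have "- tau_mu_comm \<in> ?E" by (simp only: grp_norm)
    then have "- (- tau_mu_comm) \<in> ?E" using subgrpD(3)[OF nrmD(1)[OF \<open>nsubgrp ?E\<close>]] by blast
    then show ?thesis by (simp only: minus_minus)
  qed
  ultimately have h: "vertex_embed (replicate (Suc i) False) h \<in> dimser ?n" using kerexp_least Suc.prems by blast
  obtain j where "vertex_embed v h = - npow j gtau + vertex_embed (replicate (Suc i) False) h + npow j gtau"
    using vertex_embed_transitive[of v] Suc.prems Suc.hyps(2) by metis
  then have "vertex_embed v h \<in> dimser ?n" using h by (simp only: nrmD(2)[OF nsubgrp_dimser])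
  then show ?case by (simp only: Suc.hyps(2)[symmetric])
qed


section \<open>Layers and normal forms\<close>

text \<open>H^N placed on level \<open>i\<close>, with N = 2^i: the elements that fix the level
  pointwise and whose sections there all lie in H.\<close>

primrec branch :: "nat \<Rightarrow> bsv set" where
  "branch 0 = kerexp"
| "branch (Suc i) = {k. root_perm k False = False \<and> tree_sec False k \<in> branch i \<and> tree_sec True k \<in> branch i}"

lemma branch_Suc: "branch (Suc i) \<subseteq> branch i"
proof (induction i)
  case 0
  show ?case
  proof
    fix k assume "k \<in> branch (Suc 0)"
    then show "k \<in> branch 0"
      using tau_exp_sections[of k] mu_exp_sections[of k] by (auto simp: kerexp_def)
  qed
next
  case (Suc i) then show ?case by auto
qed

lemma branch_kerexp: "branch i \<subseteq> kerexp"
  using lift_Suc_antimono_le[of branch, OF branch_Suc, of 0 i] by simp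

lemma nsubgrp_branch: "nsubgrp (branch i)"
proof (induction i)
  case 0 then show ?case by (simp add: nsubgrp_kerexp)
next
  case (Suc i)
  note K = subgrpD[OF nrmD(1)[OF Suc]]
  show ?case unfolding nsubgrp_def subgrp_def
  proof (intro conjI ballI allI)
    show "0 \<in> branch (Suc i)" using K(1) by simp
  next
    fix x y assume "x \<in> branch (Suc i)" "y \<in> branch (Suc i)"
    then show "x + y \<in> branch (Suc i)" using K(2) root_perm_id[of x True] by simp
  next
    fix x assume "x \<in> branch (Suc i)"
    then show "- x \<in> branch (Suc i)" using K(3) by (simp add: tree_sec_stab_uminus root_perm_stab_uminus)
  next
    fix x g assume "x \<in> branch (Suc i)"
    then have x: "root_perm x c = c" "tree_sec c x \<in> branch i" for c using root_perm_id[of x c] by (cases c; simp)+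
    have "tree_sec c (- g + x + g) = - tree_sec (root_perm (- g) c) g + tree_sec (root_perm (- g) c) x + tree_sec (root_perm (- g) c) g" for c
      by (simp add: x tree_sec_uminus)
    then have "tree_sec c (- g + x + g) \<in> branch i" for c using nrmD(2)[OF Suc] x(2) by simp
    moreover have "root_perm (- g + x + g) False = False" by (simp add: x)
    ultimately show "- g + x + g \<in> branch (Suc i)" by simp
  qed
qed

lemmas KKD = subgrpD[OF nrmD(1)[OF nsubgrp_branch]]

lemma vertex_embed_in_branch: "h \<in> kerexp \<Longrightarrow> vertex_embed v h \<in> branch (length v)"
proof (induction v)
  case Nil then show ?case by simp
next
  case (Cons b v)
  then show ?case using KKD(1) by (simp add: node_embed node_embed_tree_sec)
qed

lemma branch_decomp: "k \<in> branch (Suc i) \<Longrightarrow> k = node_embed False (tree_sec False k) + node_embed True (tree_sec True k)"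
  using branch_kerexp[of i] by (intro node_embed_decomp) auto

lemma vertex_embed_branch_in:
  assumes "subgrp Y" "\<And>v h. length v = i \<Longrightarrow> h \<in> kerexp \<Longrightarrow> vertex_embed v h \<in> Y"
  shows "j \<le> i \<Longrightarrow> length u = i - j \<Longrightarrow> h \<in> branch j \<Longrightarrow> vertex_embed u h \<in> Y"
proof (induction j arbitrary: u h)
  case 0 then show ?case using assms(2) by simp
next
  case (Suc j)
  have k: "tree_sec b h \<in> branch j" for b using Suc.prems by (cases b) auto
  then have "tree_sec b h \<in> kerexp" for b using branch_kerexp by blast
  then have "vertex_embed u h = vertex_embed (u @ [False]) (tree_sec False h) + vertex_embed (u @ [True]) (tree_sec True h)"
    by (subst branch_decomp[OF Suc.prems(3)]) (simp add: vertex_embed_add vertex_embed_append node_embed_in)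
  moreover have "vertex_embed (u @ [b]) (tree_sec b h) \<in> Y" for b
    using Suc.prems k by (intro Suc.IH) auto
  ultimately show ?case using subgrpD(2)[OF assms(1)] by simp
qed

lemma branch_least:
  assumes "subgrp Y" "\<And>v h. length v = i \<Longrightarrow> h \<in> kerexp \<Longrightarrow> vertex_embed v h \<in> Y"
  shows "branch i \<subseteq> Y"
  using vertex_embed_branch_in[OF assms(1), where i = i and j = i and u = "[]"] assms(2) by auto

lemma branch_dimser: "branch i \<subseteq> dimser (2 ^ i + 1)"
  by (rule branch_least) (use vertex_embed_in_dimser subgrp_dimser in blast)+

text \<open>An element of H fixes both letters, so the sections of a commutator are commutators of
  sections and have exponents 0. Consecutive quotients of the branch groups are therefore
  abelian.\<close>

lemma comm_branch: "x \<in> branch i \<Longrightarrow> y \<in> branch i \<Longrightarrow> comm x y \<in> branch (Suc i)"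
proof (induction i arbitrary: x y)
  case 0
  then have root_perm: "root_perm x b = b" "root_perm y b = b" "root_perm (- x) b = b" "root_perm (- y) b = b" for b
    by (simp_all add: root_perm_kerexp kerexpD)
  then show ?case
    by (simp add: comm_def kerexp_def tree_sec_uminus del: add_uminus_conv_diff)
next
  case (Suc i)
  have root_perm: "root_perm x b = b" "root_perm y b = b" "root_perm (- x) b = b" "root_perm (- y) b = b" for b
    using Suc.prems by (simp_all add: root_perm_id root_perm_stab_uminus)
  have s: "tree_sec b (comm x y) = comm (tree_sec b x) (tree_sec b y)" for b
    by (simp add: comm_def tree_sec_uminus root_perm del: add_uminus_conv_diff)
  have "tree_sec b (comm x y) \<in> branch (Suc i)" for b
    unfolding s by (rule Suc.IH; cases b) (use Suc.prems in auto)
  moreover have "root_perm (comm x y) False = False" by (simp add: comm_def root_perm del: add_uminus_conv_diff)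
  ultimately show ?case by simp
qed

text \<open>In H the exponents of the two sections cancel and, the carries being 0, the \<tau>- and
  \<mu>-exponents agree within each section. One integer z thus describes \<open>h\<close> modulo
  \<open>branch 1\<close>, and it is 1 for [\<tau>, \<mu>]. The two disjuncts are the two signs of
  z.\<close>

lemma kerexp_decomp:
  assumes "h \<in> kerexp"
  shows "\<exists>e k. k \<in> branch 1 \<and> (h = npow e tau_mu_comm + k \<or> h = - npow e tau_mu_comm + k)"
proof -
  define z where "z = tau_exp (tree_sec True h)"
  have h: "tau_exp (tree_sec True h) = z" "tau_exp (tree_sec False h) = - z" "mu_exp (tree_sec False h) = - z" "mu_exp (tree_sec True h) = z" "root_perm h False = False"
    using assms tau_exp_sections[of h] mu_exp_sections[of h] tau_exp_mu_exp_False[of h] tau_exp_mu_exp_True[of h] root_perm_False[of h]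
    by (auto simp: kerexp_def z_def)
  have r: "root_perm tau_mu_comm b = b" for b by (simp add: root_perm_kerexp comm_in_kerexp)
  have np: "root_perm (npow e tau_mu_comm) b = b \<and> tau_exp (tree_sec False (npow e tau_mu_comm)) = - int e \<and> mu_exp (tree_sec False (npow e tau_mu_comm)) = - int e
      \<and> tau_exp (tree_sec True (npow e tau_mu_comm)) = int e \<and> mu_exp (tree_sec True (npow e tau_mu_comm)) = int e" for e b
    by (induction e) (simp_all add: r tree_sec_tau_mu_comm)
  let ?n = "npow (nat \<bar>z\<bar>) tau_mu_comm"
  note np' = np[of "nat \<bar>z\<bar>"]
  have inv: "root_perm (- ?n) b = b" "tree_sec b (- ?n) = - tree_sec b ?n" for b
    using np' by (simp_all add: root_perm_stab_uminus tree_sec_stab_uminus)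
  show ?thesis
  proof (cases "z \<ge> 0")
    case True
    have "- ?n + h \<in> branch 1" using True h np' inv by (simp add: kerexp_def)
    moreover have "h = ?n + (- ?n + h)" by (simp only: grp_norm)
    ultimately show ?thesis by blast
  next
    case False
    have "?n + h \<in> branch 1" using False h np' by (simp add: kerexp_def)
    moreover have "h = - ?n + (?n + h)" by (simp only: grp_norm)
    ultimately show ?thesis by blast
  qed
qed

section \<open>Polycyclic generators, their weights and normal forms\<close>

primrec layer_gen :: "nat \<Rightarrow> nat \<Rightarrow> bsv" where
  "layer_gen i 0 = vertex_embed (replicate i False) tau_mu_comm"
| "layer_gen i (Suc r) = comm (layer_gen i r) gtau"

lemma layer_gen_dimser: "layer_gen i r \<in> dimser (2 ^ i + 1 + r)"
proof (induction r)
  case 0 then show ?case using vertex_embed_in_dimser[of tau_mu_comm "replicate i False"] by (simp add: comm_in_kerexp)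
next
  case (Suc r) then show ?case using comm_in_dimser(2)[OF Suc] by simp
qed

lemma layer_gen_branch: "layer_gen i r \<in> branch i"
proof (induction r)
  case 0 then show ?case using vertex_embed_in_branch[of tau_mu_comm "replicate i False"] by (simp add: comm_in_kerexp)
next
  case (Suc r)
  have "comm (layer_gen i r) gtau = - layer_gen i r + (- gtau + layer_gen i r + gtau)" by (simp only: comm_def grp_norm)
  then show ?case using Suc KKD nrmD(2)[OF nsubgrp_branch] by simp
qed

text \<open>Generators number \<open>2\<^sup>i + 1, \<dots>, 2\<^bsup>i+1\<^esup>\<close> belong to level \<open>i\<close>; number \<open>m\<close> has weight \<open>m\<close>, except that
  number 0, which is \<open>\<mu>\<close>, has weight 1.\<close>

definition pc_gen :: "nat \<Rightarrow> bsv" where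
  "pc_gen m = (if m = 0 then gmu else if m = 1 then gtau
     else layer_gen (floor_log (m - 1)) (m - 1 - 2 ^ floor_log (m - 1)))"

lemma pc_gen_simps: "pc_gen 0 = gmu" "pc_gen (Suc 0) = gtau" "r < 2 ^ i \<Longrightarrow> pc_gen (2 ^ i + 1 + r) = layer_gen i r"
proof -
  assume r: "r < 2 ^ i"
  then have "floor_log (2 ^ i + r) = i" by (intro floor_log_eqI) auto
  then show "pc_gen (2 ^ i + 1 + r) = layer_gen i r" by (simp add: pc_gen_def)
qed (simp_all add: pc_gen_def)

definition wt :: "nat \<Rightarrow> nat" where "wt m = (if m = 0 then 1 else m)"

lemma wt_pos [simp]: "wt m > 0" by (simp add: wt_def)

lemma pc_gen_dimser: "pc_gen m \<in> dimser (wt m)"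
proof (cases "m \<le> 1")
  case True then show ?thesis by (simp add: wt_def dimser_le_1)
next
  case False
  define i where "i = floor_log (m - 1)"
  have i: "2 ^ i \<le> m - 1" unfolding i_def using False by (intro floor_log_exp2_le) simp
  have "pc_gen m = layer_gen i (m - 1 - 2 ^ i)" using False by (simp add: pc_gen_def i_def)
  then show ?thesis using layer_gen_dimser[of i "m - 1 - 2 ^ i"] i False by (simp add: wt_def)
qed

primrec nf :: "bsv set \<Rightarrow> nat list \<Rightarrow> bsv set" where
  "nf B [] = B"
| "nf B (m # ms) = {npow e (pc_gen m) + y | e y. y \<in> nf B ms}"

lemma nf_superset: "nf B ms \<subseteq> nf B (m # ms)"
proof
  fix y assume "y \<in> nf B ms"
  moreover have "y = npow 0 (pc_gen m) + y" by simp
  ultimately show "y \<in> nf B (m # ms)" by (auto simp del: npow.simps)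
qed

text \<open>Deliberately crude: the purpose is that every generator has 2-power order modulo
  \<open>dimser n\<close>, so that the natural exponents in \<open>nf\<close> reach inverses as
  well.\<close>

lemma pc_gen_npow_dimser: "npow (2 ^ n) (pc_gen m) \<in> dimser n"
proof -
  have "npow (2 ^ n) (pc_gen m) \<in> dimser (2 ^ n * wt m)" by (rule npow_two_in_dimser[OF pc_gen_dimser])
  moreover have "n \<le> 2 ^ n * wt m" using less_exp[of n] wt_pos[of m]
    by (metis less_imp_le_nat mult.right_neutral mult_le_mono One_nat_def Suc_leI)
  ultimately show ?thesis using dimser_antimono by blast
qed


lemma comm_in_nsubgrp: "nsubgrp B \<Longrightarrow> b \<in> B \<Longrightarrow> comm b y \<in> B" "nsubgrp B \<Longrightarrow> b \<in> B \<Longrightarrow> comm y b \<in> B"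
proof -
  assume B: "nsubgrp B" "b \<in> B"
  have "comm b y = - b + (- y + b + y)" by (simp only: comm_def grp_norm)
  then show "comm b y \<in> B" using B nrmD(2) subgrpD(2,3)[OF nrmD(1)] by metis
  then show "comm y b \<in> B" using B subgrpD(3)[OF nrmD(1)] by (metis comm_flip)
qed

lemma comm_setsum_branch:
  assumes B: "nsubgrp B" and x: "x \<in> setsum (branch i) B" and y: "y \<in> setsum (branch i) B"
  shows "comm x y \<in> setsum (branch (Suc i)) B"
proof -
  let ?L = "setsum (branch (Suc i)) B"
  have L: "nsubgrp ?L" by (rule nsubgrp_setsum[OF nsubgrp_branch B])
  note L' = subgrpD[OF nrmD(1)[OF L]]
  have BL: "B \<subseteq> ?L" and KL: "branch (Suc i) \<subseteq> ?L"
    using setsum_left setsum_right KKD(1) subgrpD(1)[OF nrmD(1)[OF B]] by blast+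
  obtain k b where x': "x = k + b" "k \<in> branch i" "b \<in> B" using x by (auto simp: setsum_def)
  obtain l c where y': "y = l + c" "l \<in> branch i" "c \<in> B" using y by (auto simp: setsum_def)
  have "comm k l \<in> ?L" using comm_branch x' y' KL by blast
  moreover have "comm k c \<in> ?L" "comm b y \<in> ?L" using comm_in_nsubgrp[OF B] x' y' BL by blast+
  ultimately show ?thesis
    unfolding x'(1) comm_add_left unfolding y'(1) comm_add_right[of k]
    using L'(2) nrmD(2)[OF L] y'(1) by metis
qed

lemma vertex_embed_branch: "k \<in> branch j \<Longrightarrow> vertex_embed v k \<in> branch (length v + j)"
proof (induction v)
  case Nil then show ?case by simp
next
  case (Cons b v)
  then have "vertex_embed v k \<in> branch (length v + j)" "vertex_embed v k \<in> kerexp" using branch_kerexp[of j] vertex_embed_in by blast+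
  then show ?case using KKD(1) by (simp add: node_embed node_embed_tree_sec)
qed

lemma vertex_embed_npow: "h \<in> kerexp \<Longrightarrow> vertex_embed v (npow e h) = npow e (vertex_embed v h)"
  by (induction e) (simp_all add: vertex_embed_add npow_in[OF subgrp_kerexp])

text \<open>By construction conjugation by \<tau> turns the generator x_r of the level into x_r
  x_(r+1). Iterating, a conjugate by \<tau>^j involves only indices from r to r + j, and
  \<open>r + j < 2 ^ i\<close> keeps them in range.\<close>

lemma layer_gen_conj_in:
  assumes "subgrp Y" "\<And>s. s < 2 ^ i \<Longrightarrow> layer_gen i s \<in> Y"
  shows "r + j < 2 ^ i \<Longrightarrow> - npow j gtau + layer_gen i r + npow j gtau \<in> Y"
proof (induction j arbitrary: r)
  case 0 then show ?case using assms by simp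
next
  case (Suc j)
  have "- npow (Suc j) gtau + layer_gen i r + npow (Suc j) gtau = - npow j gtau + (layer_gen i r + layer_gen i (Suc r)) + npow j gtau"
    unfolding layer_gen.simps conj_eq_comm[symmetric] npow.simps by (simp only: grp_norm)
  also have "\<dots> = (- npow j gtau + layer_gen i r + npow j gtau) + (- npow j gtau + layer_gen i (Suc r) + npow j gtau)"
    by (rule conj_add)
  also have "\<dots> \<in> Y" using Suc.IH[of r] Suc.IH[of "Suc r"] Suc.prems subgrpD(2)[OF assms(1)] by simp
  finally show ?case .
qed

text \<open>Modulo the next level each vertex contributes only its copy of [\<tau>, \<mu>], by
  \<open>kerexp_decomp\<close>. That copy is a conjugate of the leftmost one by some \<tau>^j with j
  < 2^i, hence lies in the subgroup generated by the 2^i listed elements.\<close>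

lemma branch_generated:
  assumes Y: "subgrp Y" "\<And>s. s < 2 ^ i \<Longrightarrow> layer_gen i s \<in> Y" "branch (Suc i) \<subseteq> Y"
  shows "branch i \<subseteq> Y"
proof (rule branch_least[OF Y(1)])
  fix v :: "bool list" and h assume v: "length v = i" and h: "h \<in> kerexp"
  have tau_mu_comm: "tau_mu_comm \<in> kerexp" by (rule comm_in_kerexp)
  obtain j where j: "j < 2 ^ i" "\<forall>h\<in>kerexp. vertex_embed v h = - npow j gtau + vertex_embed (replicate i False) h + npow j gtau"
    using vertex_embed_transitive[of v] v by auto
  then have "vertex_embed v tau_mu_comm = - npow j gtau + layer_gen i 0 + npow j gtau" using tau_mu_comm by simp
  then have "vertex_embed v tau_mu_comm \<in> Y" using layer_gen_conj_in[OF Y(1,2), of 0 j] j(1) by simp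
  then have n: "npow e (vertex_embed v tau_mu_comm) \<in> Y" for e by (rule npow_in[OF Y(1)])
  obtain e k where k: "k \<in> branch 1" "h = npow e tau_mu_comm + k \<or> h = - npow e tau_mu_comm + k"
    using kerexp_decomp[OF h] by blast
  have "vertex_embed v k \<in> Y" using vertex_embed_branch[OF k(1), of v] v Y(3) by auto
  moreover have kk: "k \<in> kerexp" using k(1) branch_kerexp by blast
  have nn: "npow e tau_mu_comm \<in> kerexp" by (rule npow_in[OF subgrp_kerexp tau_mu_comm])
  have "vertex_embed v h = npow e (vertex_embed v tau_mu_comm) + vertex_embed v k \<or> vertex_embed v h = - npow e (vertex_embed v tau_mu_comm) + vertex_embed v k"
    using k(2)
  proof
    assume "h = npow e tau_mu_comm + k"
    then show ?thesis using vertex_embed_add[OF nn kk, of v] vertex_embed_npow[OF tau_mu_comm, of v e] by simp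
  next
    assume "h = - npow e tau_mu_comm + k"
    then show ?thesis
      using vertex_embed_add[OF kerexpD(3)[OF nn] kk, of v] vertex_embed_uminus[OF nn, of v] vertex_embed_npow[OF tau_mu_comm, of v e] by simp
  qed
  ultimately show "vertex_embed v h \<in> Y" using n[of e] subgrpD(2,3)[OF Y(1)] by auto
qed

text \<open>The generators of the level are adjoined from the last to the first. Every intermediate
  set lies between two consecutive branch groups times \<open>B\<close>, whose quotient is abelian,
  so each step is an instance of \<open>subgrp_extend\<close>; \<open>branch_generated\<close> shows
  that the whole level is reached.\<close>

lemma nf_layer:
  assumes B: "nsubgrp B" "\<And>m. npow (2 ^ q) (pc_gen m) \<in> B"
    and rest: "nf B [2 ^ Suc i + 1..<M] = setsum (branch (Suc i)) B" "2 ^ Suc i + 1 \<le> M"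
  shows "nf B [2 ^ i + 1..<M] = setsum (branch i) B"
proof -
  let ?L = "\<lambda>i. setsum (branch i) B" and ?Y = "\<lambda>r. nf B [2 ^ i + 1 + r..<M]"
  have L: "nsubgrp (?L i)" for i by (rule nsubgrp_setsum[OF nsubgrp_branch B(1)])
  note L' = subgrpD[OF nrmD(1)[OF L]]
  have BL: "B \<subseteq> ?L i" for i using setsum_right KKD(1) by blast
  have KL: "branch i \<subseteq> ?L i" for i using setsum_left subgrpD(1)[OF nrmD(1)[OF B(1)]] by blast
  have LL: "?L (Suc i) \<subseteq> ?L i" using branch_Suc[of i] by (auto simp: setsum_def)
  have Y: "subgrp (?Y r) \<and> ?L (Suc i) \<subseteq> ?Y r \<and> ?Y r \<subseteq> ?L i \<and> (\<forall>s. r \<le> s \<longrightarrow> s < 2 ^ i \<longrightarrow> layer_gen i s \<in> ?Y r)"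
    if "r \<le> 2 ^ i" for r
    using that
  proof (induction rule: inc_induct)
    case base
    have "?Y (2 ^ i) = ?L (Suc i)" using rest(1) by (simp add: mult_2 del: branch.simps)
    then show ?case using LL nrmD(1)[OF L] by (simp del: branch.simps)
  next
    case (step r)
    note IH = step.IH
    have "2 ^ i + 1 + r < M" using step.hyps rest(2) by simp
    then have u: "[2 ^ i + 1 + r..<M] = (2 ^ i + 1 + r) # [2 ^ i + 1 + Suc r..<M]"
      by (simp add: upt_conv_Cons)
    have g: "pc_gen (2 ^ i + 1 + r) = layer_gen i r" using pc_gen_simps(3) step.hyps by simp
    have x: "layer_gen i r \<in> ?L i" "- layer_gen i r \<in> ?L i" using layer_gen_branch KL L'(3) by blast+
    have Yr: "?Y r = {npow e (layer_gen i r) + y | e y. y \<in> ?Y (Suc r)}" unfolding u nf.simps g ..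
    have "subgrp (?Y r)" unfolding Yr
    proof (rule subgrp_extend)
      show "subgrp (?Y (Suc r))" using IH by blast
      show "npow (2 ^ q) (layer_gen i r) \<in> ?Y (Suc r)" using B(2)[of "2 ^ i + 1 + r"] BL IH unfolding g by blast
    next
      fix y assume "y \<in> ?Y (Suc r)"
      then have "y \<in> ?L i" using IH by blast
      then show "comm y (layer_gen i r) \<in> ?Y (Suc r)" "comm y (- layer_gen i r) \<in> ?Y (Suc r)"
        using comm_setsum_branch[OF B(1)] x IH by blast+
    qed simp
    moreover have sup: "?Y (Suc r) \<subseteq> ?Y r" unfolding u by (rule nf_superset)
    moreover have "?Y r \<subseteq> ?L i" unfolding Yr using IH npow_in[OF nrmD(1)[OF L] x(1)] L'(2) by blast
    moreover have layer_gen: "layer_gen i r \<in> ?Y r"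
    proof -
      have "layer_gen i r = npow 1 (layer_gen i r) + 0" by simp
      moreover have "0 \<in> ?Y (Suc r)" using IH subgrpD(1) by blast
      ultimately show ?thesis unfolding Yr by blast
    qed
    moreover have "layer_gen i s \<in> ?Y r" if "r \<le> s" "s < 2 ^ i" for s
      using that layer_gen IH sup by (cases "s = r") (auto simp del: nf.simps)
    moreover have "?L (Suc i) \<subseteq> ?Y r" using IH sup by blast
    ultimately show ?case by blast
  qed
  have Y0: "subgrp (?Y 0)" "?L (Suc i) \<subseteq> ?Y 0" "?Y 0 \<subseteq> ?L i" "\<And>s. s < 2 ^ i \<Longrightarrow> layer_gen i s \<in> ?Y 0"
    using Y[of 0] by (simp_all del: branch.simps)
  have K0: "branch i \<subseteq> ?Y 0"
    by (rule branch_generated[OF Y0(1,4) order_trans[OF KL Y0(2)]])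
  have B0: "B \<subseteq> ?Y 0" by (rule order_trans[OF BL Y0(2)])
  have "?L i \<subseteq> ?Y 0"
  proof
    fix x assume "x \<in> ?L i"
    then obtain k b where x: "x = k + b" "k \<in> branch i" "b \<in> B" unfolding setsum_def by blast
    show "x \<in> ?Y 0" unfolding x(1)
      by (rule subgrpD(2)[OF Y0(1) subsetD[OF K0 x(2)] subsetD[OF B0 x(3)]])
  qed
  then show ?thesis using Y0(3) by simp
qed

lemma nf_branch:
  assumes B: "nsubgrp B" "\<And>m. npow (2 ^ q) (pc_gen m) \<in> B" "branch k \<subseteq> B" and "i \<le> k"
  shows "nf B [2 ^ i + 1..<2 ^ k + 1] = setsum (branch i) B"
  using \<open>i \<le> k\<close>
proof (induction rule: inc_induct)
  case base
  have "setsum (branch k) B \<subseteq> B" using B(3) subgrpD(2)[OF nrmD(1)[OF B(1)]] by (auto simp: setsum_def)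
  moreover have "B \<subseteq> setsum (branch k) B" using setsum_right KKD(1) by blast
  ultimately show ?case by simp
next
  case (step i)
  have "(2::nat) ^ Suc i \<le> 2 ^ k" using step.hyps by (intro power_increasing) auto
  then show ?case using nf_layer[OF B(1,2) step.IH] by simp
qed

text \<open>On top of H only \<tau> and \<mu> remain, and all commutators already lie in H. The
  assumption on \<open>branch k\<close> makes the levels from \<open>k\<close> on invisible modulo
  \<open>B\<close>, so finitely many generators suffice.\<close>

lemma nf_UNIV:
  assumes B: "nsubgrp B" "\<And>m. npow (2 ^ q) (pc_gen m) \<in> B" "branch k \<subseteq> B"
  shows "nf B [0..<2 ^ k + 1] = UNIV"
proof -
  let ?L = "setsum kerexp B"
  have L: "nsubgrp ?L" by (rule nsubgrp_setsum[OF nsubgrp_kerexp B(1)])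
  have KL: "comm x y \<in> ?L" for x y
    using setsum_left[of B kerexp] subgrpD(1)[OF nrmD(1)[OF B(1)]] comm_in_kerexp by blast
  have BL: "B \<subseteq> ?L" using setsum_right kerexpD(1) by blast
  have L2: "nf B [2..<2 ^ k + 1] = ?L" using nf_branch[OF B, of 0] by (simp add: numeral_2_eq_2)
  have ex: "subgrp {npow e (pc_gen m) + y | e y. y \<in> Y}" if "subgrp Y" "?L \<subseteq> Y" for Y m
    using that KL B(2)[of m] BL by (intro subgrp_extend[where r = "2 ^ q"]) auto
  have u: "[1..<2 ^ k + 1] = 1 # [2..<2 ^ k + 1]" "[0..<2 ^ k + 1] = 0 # [1..<2 ^ k + 1]"
    by (simp_all add: upt_conv_Cons numeral_2_eq_2 del: upt_Suc)
  let ?Y = "nf B [1..<2 ^ k + 1]" and ?Z = "nf B [0..<2 ^ k + 1]"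
  have sY: "subgrp ?Y" "?L \<subseteq> ?Y"
    using ex[OF nrmD(1)[OF L] order_refl, of 1] nf_superset[of B "[2..<2 ^ k + 1]" 1]
    unfolding u(1) nf.simps L2 by blast+
  have sZ: "subgrp ?Z" "?Y \<subseteq> ?Z"
    using ex[OF sY, of 0] nf_superset[of B "[1..<2 ^ k + 1]" 0] unfolding u(2) nf.simps by blast+
  have mem: "pc_gen m \<in> nf B (m # ms)" if "0 \<in> nf B ms" for m ms
  proof -
    have "pc_gen m = npow 1 (pc_gen m) + 0" by simp
    with that show ?thesis unfolding nf.simps by blast
  qed
  have "pc_gen 1 \<in> ?Y" unfolding u(1) by (rule mem) (simp only: L2 subgrpD(1)[OF nrmD(1)[OF L]])
  then have "gtau \<in> ?Z" using sZ(2) pc_gen_simps(2) by auto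
  moreover have "pc_gen 0 \<in> ?Z" unfolding u(2) by (rule mem[OF subgrpD(1)[OF sY(1)]])
  then have "gmu \<in> ?Z" by (simp only: pc_gen_simps(1))
  ultimately have "x \<in> ?Z" for x
    using subgrpD[OF sZ(1)] by (induction x rule: bsv_induct) (simp_all del: upt_Suc nf.simps add: diff_conv_add_uminus del: add_uminus_conv_diff)
  then show ?thesis by blast
qed

lemma nf_explicit:
  "g \<in> nf B ms \<Longrightarrow> distinct ms \<Longrightarrow> \<exists>e. \<exists>y\<in>B. g = sum_list (map (\<lambda>m. npow (e m) (pc_gen m)) ms) + y"
proof (induction ms arbitrary: g)
  case Nil then show ?case by simp
next
  case (Cons m ms)
  then obtain a z where z: "g = npow a (pc_gen m) + z" "z \<in> nf B ms" by auto
  then obtain e y where e: "y \<in> B" "z = sum_list (map (\<lambda>m. npow (e m) (pc_gen m)) ms) + y"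
    using Cons.IH[OF z(2)] Cons.prems(2) by auto
  let ?e = "e(m := a)"
  have *: "map (\<lambda>m. npow (?e m) (pc_gen m)) ms = map (\<lambda>m. npow (e m) (pc_gen m)) ms"
    using Cons.prems(2) by (intro map_cong) auto
  have "g = sum_list (map (\<lambda>m. npow (?e m) (pc_gen m)) (m # ms)) + y"
    unfolding list.map sum_list.Cons * using z e by (simp add: add.assoc)
  then show ?case using e by blast
qed

lemma normal_form:
  assumes "n \<le> 2 ^ k + 1"
  shows "\<exists>e. \<exists>y\<in>dimser n. g = sum_list (map (\<lambda>m. npow (e m) (pc_gen m)) [0..<2 ^ k + 1]) + y"
proof -
  have "branch k \<subseteq> dimser n" using branch_dimser dimser_antimono[OF assms] by blast
  then have "nf (dimser n) [0..<2 ^ k + 1] = UNIV"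
    by (intro nf_UNIV[OF nsubgrp_dimser pc_gen_npow_dimser])
  then show ?thesis using nf_explicit[of g "dimser n"] distinct_upt by blast
qed

section \<open>Prescribing exponents on a level\<close>

primrec tree_secs :: "bool list \<Rightarrow> bsv \<Rightarrow> bsv" where
  "tree_secs [] g = g"
| "tree_secs (b # v) g = tree_secs v (tree_sec b g)"

lemma tau_exp_npow: "tau_exp (npow n x) = int n * tau_exp x" and mu_exp_npow: "mu_exp (npow n x) = int n * mu_exp x"
  by (induction n) (simp_all add: algebra_simps)

lemma ex_exponents: "\<exists>f. tau_exp f = A \<and> mu_exp f = B"
proof -
  have 1: "\<exists>f. tau_exp f = A \<and> mu_exp f = 0" for A
  proof (cases "A \<ge> 0")
    case True then show ?thesis by (intro exI[of _ "npow (nat A) gtau"]) (simp add: tau_exp_npow mu_exp_npow)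
  next
    case False then show ?thesis by (intro exI[of _ "- npow (nat (- A)) gtau"]) (simp add: tau_exp_npow mu_exp_npow)
  qed
  have 2: "\<exists>f. tau_exp f = 0 \<and> mu_exp f = B" for B
  proof (cases "B \<ge> 0")
    case True then show ?thesis by (intro exI[of _ "npow (nat B) gmu"]) (simp add: tau_exp_npow mu_exp_npow)
  next
    case False then show ?thesis by (intro exI[of _ "- npow (nat (- B)) gmu"]) (simp add: tau_exp_npow mu_exp_npow)
  qed
  obtain f g where "tau_exp f = A" "mu_exp f = 0" "tau_exp g = 0" "mu_exp g = B" using 1 2 by metis
  then show ?thesis by (intro exI[of _ "f + g"]) simp
qed

lemma ex_section_exponent: "\<exists>f. tau_exp f = A \<and> mu_exp f = B \<and> tau_exp (tree_sec False f) = C"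
proof -
  have r: "root_perm tau_mu_comm b = b" for b by (simp add: root_perm_kerexp comm_in_kerexp)
  have np: "root_perm (npow e tau_mu_comm) b = b \<and> tau_exp (tree_sec False (npow e tau_mu_comm)) = - int e \<and> npow e tau_mu_comm \<in> kerexp" for e b
    by (induction e) (simp_all add: r tree_sec_tau_mu_comm kerexpD comm_in_kerexp)
  have "\<exists>h\<in>kerexp. root_perm h False = False \<and> tau_exp (tree_sec False h) = z" for z
  proof (cases "z \<le> 0")
    case True then show ?thesis using np[of "nat (- z)"] by (intro bexI[of _ "npow (nat (- z)) tau_mu_comm"]) auto
  next
    case False then show ?thesis using np[of "nat z"]
      by (intro bexI[of _ "- npow (nat z) tau_mu_comm"]) (auto simp: tree_sec_stab_uminus root_perm_stab_uminus kerexpD)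
  qed
  moreover obtain f where f: "tau_exp f = A" "mu_exp f = B" using ex_exponents by blast
  ultimately obtain h where h: "h \<in> kerexp" "root_perm h False = False" "tau_exp (tree_sec False h) = C - tau_exp (tree_sec False f)" by blast
  then show ?thesis using f by (intro exI[of _ "h + f"]) (simp add: kerexp_def)
qed

text \<open>The order of the quantifiers makes the induction work: the \<tau>-exponent is forced by
  \<open>\<alpha>\<close>, but the \<mu>-exponent must stay free, since the sections of the
  auxiliary element \<open>f\<close> dictate the \<mu>-exponents of the two partial solutions. These
  then differ from the sections of \<open>f\<close> by elements of H, which
  \<open>node_embed\<close> can insert.\<close>

lemma ex_level_exponents:
  "\<exists>A. \<forall>B. \<exists>g. tau_exp g = A \<and> mu_exp g = B \<and> (\<forall>v. length v = k \<longrightarrow> tau_exp (tree_secs v g) = \<alpha> v)"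
proof (induction k arbitrary: \<alpha>)
  case 0
  have "\<exists>g. tau_exp g = \<alpha> [] \<and> mu_exp g = B \<and> (\<forall>v. length v = 0 \<longrightarrow> tau_exp (tree_secs v g) = \<alpha> v)" for B
    using ex_exponents[of "\<alpha> []" B] by auto
  then show ?case by blast
next
  case (Suc k)
  obtain AF where AF: "\<forall>B. \<exists>g. tau_exp g = AF \<and> mu_exp g = B \<and> (\<forall>v. length v = k \<longrightarrow> tau_exp (tree_secs v g) = \<alpha> (False # v))"
    using Suc[of "\<lambda>v. \<alpha> (False # v)"] by blast
  obtain AT where AT: "\<forall>B. \<exists>g. tau_exp g = AT \<and> mu_exp g = B \<and> (\<forall>v. length v = k \<longrightarrow> tau_exp (tree_secs v g) = \<alpha> (True # v))"
    using Suc[of "\<lambda>v. \<alpha> (True # v)"] by blast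
  have "\<exists>g. tau_exp g = AF + AT \<and> mu_exp g = B \<and> (\<forall>v. length v = Suc k \<longrightarrow> tau_exp (tree_secs v g) = \<alpha> v)" for B
  proof -
    obtain f where f: "tau_exp f = AF + AT" "mu_exp f = B" "tau_exp (tree_sec False f) = AF" using ex_section_exponent by blast
    then have fT: "tau_exp (tree_sec True f) = AT" using tau_exp_sections[of f] by simp
    obtain h where h: "tau_exp h = AF" "mu_exp h = mu_exp (tree_sec False f)" "\<And>v. length v = k \<Longrightarrow> tau_exp (tree_secs v h) = \<alpha> (False # v)"
      using AF by blast
    obtain l where l: "tau_exp l = AT" "mu_exp l = mu_exp (tree_sec True f)" "\<And>v. length v = k \<Longrightarrow> tau_exp (tree_secs v l) = \<alpha> (True # v)"
      using AT by blast
    have hk: "h - tree_sec False f \<in> kerexp" "l - tree_sec True f \<in> kerexp" using h l f fT by (auto simp: kerexp_def)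
    define g where "g = node_embed False (h - tree_sec False f) + node_embed True (l - tree_sec True f) + f"
    have s: "tree_sec False g = h" "tree_sec True g = l" using hk by (simp_all add: g_def node_embed node_embed_tree_sec)
    have "node_embed False (h - tree_sec False f) \<in> kerexp" "node_embed True (l - tree_sec True f) \<in> kerexp" using hk node_embed_in by blast+
    then have "tau_exp g = AF + AT" "mu_exp g = B" using f by (simp_all add: g_def kerexp_def)
    moreover have "tau_exp (tree_secs v g) = \<alpha> v" if "length v = Suc k" for v
    proof -
      obtain b w where "v = b # w" "length w = k" using \<open>length v = Suc k\<close> by (cases v) auto
      then show ?thesis using s h(3) l(3) by (cases b) auto
    qed
    ultimately show ?thesis by blast
  qed
  then show ?case by blast
qed

section \<open>Group algebras over the field with two elements\<close>

lemma pm_add_self [simp]: "(x :: 'k \<Rightarrow>\<^sub>0 bit) + x = 0"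
  by (rule poly_mapping_eqI) (simp add: lookup_add)

lemma pm_add_self_left [simp]: "(x :: 'k \<Rightarrow>\<^sub>0 bit) + (x + y) = y"
  by (simp flip: add.assoc)

lemma pm_uminus [simp]: "- (x :: 'k \<Rightarrow>\<^sub>0 bit) = x"
  by (rule minus_unique) simp

abbreviation el :: "'k \<Rightarrow> 'k \<Rightarrow>\<^sub>0 bit" where "el g \<equiv> Poly_Mapping.single g 1"

lemma el_add: "el (g + h) = el g * el h"
  by (simp add: mult_single)

lemma lookup_bit: "Poly_Mapping.lookup (x :: 'k \<Rightarrow>\<^sub>0 bit) k = (if k \<in> Poly_Mapping.keys x then 1 else 0)"
  by (auto simp: in_keys_iff)

lemma el_expand: "(x :: 'k \<Rightarrow>\<^sub>0 bit) = (\<Sum>k\<in>Poly_Mapping.keys x. el k)"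
proof (rule poly_mapping_eqI)
  fix k
  have "(\<Sum>l\<in>Poly_Mapping.keys x. Poly_Mapping.lookup (el l) k)
    = (\<Sum>l\<in>Poly_Mapping.keys x. if l = k then (1::bit) else 0)"
    by (intro sum.cong) (auto simp: lookup_single when_def)
  then have "Poly_Mapping.lookup (\<Sum>k\<in>Poly_Mapping.keys x. el k) k = (if k \<in> Poly_Mapping.keys x then (1::bit) else 0)"
    unfolding lookup_sum by simp
  then show "Poly_Mapping.lookup x k = Poly_Mapping.lookup (\<Sum>k\<in>Poly_Mapping.keys x. el k) k"
    by (simp only: lookup_bit[of x])
qed

lemma keys_el_sum:
  assumes "finite D" shows "Poly_Mapping.keys (\<Sum>k\<in>D. el k) = D"
proof -
  have "Poly_Mapping.lookup (\<Sum>l\<in>D. el l) k = (\<Sum>l\<in>D. if l = k then (1::bit) else 0)" for k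
    unfolding lookup_sum by (intro sum.cong) (auto simp: lookup_single when_def)
  then show ?thesis using assms by (auto simp: in_keys_iff split: if_splits)
qed

lemma pm_induct [case_names zero add]:
  fixes x :: "'k \<Rightarrow>\<^sub>0 bit"
  assumes "P 0" "\<And>x k. P x \<Longrightarrow> P (x + el k)"
  shows "P x"
proof -
  have "P (\<Sum>k\<in>D. el k)" if "finite D" for D
    using that
  proof (induction D)
    case (insert k D)
    have "(\<Sum>k\<in>insert k D. el k) = (\<Sum>k\<in>D. el k) + (el k :: 'k \<Rightarrow>\<^sub>0 bit)"
      using insert by (simp add: add.commute)
    then show ?case using assms(2) insert.IH by simp
  qed (simp add: assms(1))
  from this[of "Poly_Mapping.keys x"] show ?thesis by (simp flip: el_expand)
qed

lemma keys_add_bit: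
  fixes x :: "'k \<Rightarrow>\<^sub>0 bit"
  shows "Poly_Mapping.keys (x + y) = (Poly_Mapping.keys x - Poly_Mapping.keys y) \<union> (Poly_Mapping.keys y - Poly_Mapping.keys x)"
proof -
  have *: "k \<in> Poly_Mapping.keys (x + y) \<longleftrightarrow> Poly_Mapping.lookup x k + Poly_Mapping.lookup y k \<noteq> 0" for k
    by (simp add: in_keys_iff lookup_add)
  show ?thesis
  proof (rule Set.set_eqI)
    fix k
    show "k \<in> Poly_Mapping.keys (x + y) \<longleftrightarrow> k \<in> (Poly_Mapping.keys x - Poly_Mapping.keys y) \<union> (Poly_Mapping.keys y - Poly_Mapping.keys x)"
      unfolding * lookup_bit[of x] lookup_bit[of y]
      by (cases "k \<in> Poly_Mapping.keys x"; cases "k \<in> Poly_Mapping.keys y") simp_all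
  qed
qed

text \<open>Coefficients are 0 or 1, so the linear extension is a sum over the support. It is
  additive when r + r = 0 in the target, because keys common to both summands then cancel.\<close>

definition linext :: "('k \<Rightarrow> 'r::ab_group_add) \<Rightarrow> ('k \<Rightarrow>\<^sub>0 bit) \<Rightarrow> 'r" where
  "linext f x = (\<Sum>k\<in>Poly_Mapping.keys x. f k)"

lemma linext_el [simp]: "linext f (el k) = f k"
  by (simp add: linext_def)

lemma linext_zero [simp]: "linext f 0 = 0"
  by (simp add: linext_def)

lemma linext_add:
  fixes f :: "'k \<Rightarrow> 'r::ab_group_add"
  assumes "\<And>r::'r. r + r = 0"
  shows "linext f (x + y) = linext f x + linext f y"
proof -
  let ?K = "Poly_Mapping.keys x" and ?L = "Poly_Mapping.keys y"
  have "sum f ?K = sum f (?K - ?L) + sum f (?K \<inter> ?L)" "sum f ?L = sum f (?L - ?K) + sum f (?K \<inter> ?L)"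
    by (subst sum.union_disjoint[symmetric]; auto intro!: sum.cong)+
  moreover have "sum f (?K - ?L \<union> (?L - ?K)) = sum f (?K - ?L) + sum f (?L - ?K)"
    by (rule sum.union_disjoint) auto
  ultimately show ?thesis
    unfolding linext_def keys_add_bit using assms[of "sum f (?K \<inter> ?L)"] by (simp add: algebra_simps)
qed

lemma linext_mult:
  fixes f :: "'k::monoid_add \<Rightarrow> 'r::ring_1"
  assumes two: "\<And>r::'r. r + r = 0" and f: "\<And>a b. f (a + b) = f a * f b"
  shows "linext f (x * y) = linext f x * linext f y"
proof (induction x rule: pm_induct)
  case zero then show ?case by simp
next
  case (add x k)
  have "linext f (el k * y) = f k * linext f y"
  proof (induction y rule: pm_induct)
    case zero then show ?case by simp
  next
    case (add y l)
    then show ?case by (simp add: algebra_simps linext_add[OF two] f mult_single)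
  qed
  with add show ?case by (simp add: algebra_simps linext_add[OF two])
qed

inductive_set aspan :: "'r::monoid_add set \<Rightarrow> 'r set" for S where
  zero: "0 \<in> aspan S"
| step: "x \<in> aspan S \<Longrightarrow> s \<in> S \<Longrightarrow> x + s \<in> aspan S"

lemma aspan_incl: "s \<in> S \<Longrightarrow> s \<in> aspan S"
  using aspan.step[OF aspan.zero] by force

lemma aspan_add: "y \<in> aspan S \<Longrightarrow> x \<in> aspan S \<Longrightarrow> x + y \<in> aspan S"
  by (induction rule: aspan.induct) (auto simp flip: add.assoc intro: aspan.step)

lemma aspan_map:
  assumes "\<And>x y. f (x + y) = f x + f y" "f 0 = 0" "\<And>s. s \<in> S \<Longrightarrow> f s \<in> aspan T"
  shows "x \<in> aspan S \<Longrightarrow> f x \<in> aspan T"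
  by (induction rule: aspan.induct) (use assms in \<open>auto intro: aspan.zero aspan_add\<close>)

lemma aspan_mono: "S \<subseteq> aspan T \<Longrightarrow> aspan S \<subseteq> aspan T"
proof
  fix x assume "x \<in> aspan S" "S \<subseteq> aspan T"
  then show "x \<in> aspan T" by induction (auto intro: aspan.zero aspan_add)
qed

text \<open>Coefficient vectors are subsets: adding a generator \<open>f c\<close> toggles the
  membership of \<open>c\<close> in \<open>D\<close>. Counting subsets can then replace dimension
  arguments.\<close>

lemma aspan_representative:
  fixes f :: "'c \<Rightarrow> 'k \<Rightarrow>\<^sub>0 bit"
  assumes "x \<in> aspan (f ` C \<union> J)" "finite C" "0 \<in> J" "\<And>x y. x \<in> J \<Longrightarrow> y \<in> J \<Longrightarrow> x + y \<in> J"
  shows "\<exists>D\<subseteq>C. x + (\<Sum>c\<in>D. f c) \<in> J"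
  using assms(1)
proof (induction rule: aspan.induct)
  case zero then show ?case using assms(3) by (intro exI[of _ "{}"]) simp
next
  case (step x s)
  then obtain D where D: "D \<subseteq> C" "x + (\<Sum>c\<in>D. f c) \<in> J" by blast
  have fin: "finite D" using D assms(2) finite_subset by blast
  show ?case
  proof (cases "s \<in> J")
    case True
    have "x + s + (\<Sum>c\<in>D. f c) = (x + (\<Sum>c\<in>D. f c)) + s" by (simp add: algebra_simps)
    then show ?thesis using D assms(4) True by metis
  next
    case False
    then obtain c where c: "c \<in> C" "s = f c" using step by blast
    show ?thesis
    proof (cases "c \<in> D")
      case True
      have "(\<Sum>c\<in>D. f c) = f c + (\<Sum>c\<in>D - {c}. f c)" by (rule sum.remove[OF fin True])
      then have "x + s + (\<Sum>c\<in>D - {c}. f c) = x + (\<Sum>c\<in>D. f c)" using c by (simp add: algebra_simps)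
      then have "x + s + (\<Sum>c\<in>D - {c}. f c) \<in> J" by (simp only: D(2))
      then show ?thesis using D(1) by (intro exI[of _ "D - {c}"]) auto
    next
      case False
      have "x + s + (\<Sum>c\<in>insert c D. f c) = x + (\<Sum>c\<in>D. f c)" using c fin False by (simp add: algebra_simps)
      then have "x + s + (\<Sum>c\<in>insert c D. f c) \<in> J" by (simp only: D(2))
      then show ?thesis using D(1) c by (intro exI[of _ "insert c D"]) auto
    qed
  qed
qed

section \<open>The augmentation ideal and its powers\<close>

definition aug :: "('g::group_add \<Rightarrow>\<^sub>0 bit) \<Rightarrow> bit" where "aug = linext (\<lambda>_. 1)"

lemma aug_add [simp]: "aug (x + y) = aug x + aug y"
  unfolding aug_def by (rule linext_add) simp

lemma aug_mult [simp]: "aug (x * y) = aug x * aug y"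
  unfolding aug_def by (rule linext_mult) simp_all

lemma aug_simps [simp]: "aug 0 = 0" "aug (el g) = 1" "aug 1 = 1"
  using linext_el[of "\<lambda>_. 1::bit" "0::'g::group_add"] by (simp_all add: aug_def)

primrec aug_pow :: "nat \<Rightarrow> ('g::group_add \<Rightarrow>\<^sub>0 bit) set" where
  "aug_pow 0 = UNIV"
| "aug_pow (Suc n) = aspan {a * b | a b. a \<in> aug_pow n \<and> aug b = 0}"

declare aug_pow.simps(2) [simp del]

lemma aug_pow_zero [simp]: "0 \<in> aug_pow n"
  by (cases n) (auto simp: aug_pow.simps(2) intro: aspan.zero)

lemma aug_pow_add: "x \<in> aug_pow n \<Longrightarrow> y \<in> aug_pow n \<Longrightarrow> x + y \<in> aug_pow n"
  by (cases n) (auto simp: aug_pow.simps(2) intro: aspan_add)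

lemma aug_pow_prod: "a \<in> aug_pow n \<Longrightarrow> aug b = 0 \<Longrightarrow> a * b \<in> aug_pow (Suc n)"
  by (auto simp: aug_pow.simps(2) intro: aspan_incl)

lemma aug_pow_mult_left: "x \<in> aug_pow n \<Longrightarrow> y * x \<in> aug_pow n"
proof (induction n arbitrary: x y)
  case (Suc n)
  have "y * (a * b) \<in> aspan {a * b | a b. a \<in> aug_pow n \<and> aug b = 0}" if "a \<in> aug_pow n" "aug b = 0" for a b
    unfolding mult.assoc[symmetric] using that Suc.IH
    by (intro aspan_incl CollectI exI[of _ "y * a"] exI[of _ b]) simp
  note prod = this
  have "x \<in> aspan {a * b | a b. a \<in> aug_pow n \<and> aug b = 0}" using Suc.prems by (simp only: aug_pow.simps(2))
  then show ?case unfolding aug_pow.simps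
    by (rule aspan_map[where f = "\<lambda>x. y * x", OF distrib_left mult_zero_right, rotated]) (use prod in blast)
qed simp

lemma aug_pow_mult_right: "x \<in> aug_pow n \<Longrightarrow> x * y \<in> aug_pow n"
proof (cases n)
  case (Suc m)
  assume x: "x \<in> aug_pow n"
  have "a * b * y \<in> aspan {a * b | a b. a \<in> aug_pow m \<and> aug b = 0}" if "a \<in> aug_pow m" "aug b = 0" for a b
    unfolding mult.assoc using that by (intro aspan_incl CollectI exI[of _ a] exI[of _ "b * y"]) simp
  note prod = this
  have "x \<in> aspan {a * b | a b. a \<in> aug_pow m \<and> aug b = 0}" using x Suc by (simp only: aug_pow.simps(2))
  then show ?thesis unfolding Suc aug_pow.simps
    by (rule aspan_map[where f = "\<lambda>x. x * y", OF distrib_right mult_zero_left, rotated]) (use prod in blast)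
qed simp

lemma aug_pow_mult: "b \<in> aug_pow n \<Longrightarrow> a \<in> aug_pow m \<Longrightarrow> a * b \<in> aug_pow (m + n)"
proof (induction n arbitrary: b)
  case 0 then show ?case by (simp add: aug_pow_mult_right)
next
  case (Suc n)
  have "a * (c * d) \<in> aug_pow (m + Suc n)" if "c \<in> aug_pow n" "aug d = 0" for c d
    using aug_pow_prod[OF Suc.IH[OF that(1) Suc.prems(2)] that(2)] by (simp add: mult.assoc)
  note prod = this
  have "b \<in> aspan {a * b | a b. a \<in> aug_pow n \<and> aug b = 0}" using Suc.prems by (simp only: aug_pow.simps(2))
  then show ?case
  proof induction
    case zero show ?case by (simp only: mult_zero_right aug_pow_zero)
  next
    case (step x s)
    then obtain c d where s: "s = c * d" "c \<in> aug_pow n" "aug d = 0" by blast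
    show ?case unfolding distrib_left s(1) by (rule aug_pow_add[OF step.IH prod[OF s(2,3)]])
  qed
qed

lemma aug_pow_Suc: "aug_pow (Suc n) \<subseteq> aug_pow n"
proof
  fix x :: "'a \<Rightarrow>\<^sub>0 bit" assume "x \<in> aug_pow (Suc n)"
  then have "x \<in> aspan {a * b | a b. a \<in> aug_pow n \<and> aug b = 0}" by (simp only: aug_pow.simps(2))
  then show "x \<in> aug_pow n"
  proof induction
    case (step x s)
    then obtain a b where s: "s = a * b" "a \<in> aug_pow n" by blast
    show ?case unfolding s(1) by (rule aug_pow_add[OF step.IH aug_pow_mult_right[OF s(2)]])
  qed simp
qed

lemma aug_pow_antimono: "m \<le> n \<Longrightarrow> aug_pow n \<subseteq> aug_pow m"
  using lift_Suc_antimono_le[of aug_pow, OF aug_pow_Suc] by blast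

lemma aug_pow_1: "aug_pow 1 = {x. aug x = 0}"
proof -
  have "x \<in> aug_pow (Suc 0)" if "aug x = 0" for x :: "'a \<Rightarrow>\<^sub>0 bit"
    using aug_pow_prod[of 1 0 x] that by simp
  moreover have "aug x = 0" if "x \<in> aug_pow (Suc 0)" for x :: "'a \<Rightarrow>\<^sub>0 bit"
  proof -
    have "x \<in> aspan {a * b | a b. a \<in> UNIV \<and> aug b = 0}" using that by (simp only: aug_pow.simps)
    then show ?thesis by induction auto
  qed
  ultimately show ?thesis unfolding One_nat_def by blast
qed

lemma aug_pow_power: "x \<in> aug_pow w \<Longrightarrow> x ^ i \<in> aug_pow (i * w)"
  by (induction i) (auto intro: aug_pow_mult)

lemma aug_pow_cancel: "x + y \<in> aug_pow n \<Longrightarrow> x \<in> aug_pow n \<longleftrightarrow> y \<in> aug_pow n"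
  using aug_pow_add[of "x + y" n x] aug_pow_add[of "x + y" n y] by (auto simp: add.commute add.left_commute)

text \<open>In characteristic 2 the element \<open>el g + 1\<close> is \<open>g - 1\<close>.\<close>

lemma el_add_plus_1: "el (g + h) + 1 = (el g + 1) * el h + (el h + 1)"
  and el_add_plus_1': "el (g + h) + 1 = (el g + 1) * (el h + 1) + ((el g + 1) + (el h + 1))"
  by (simp_all add: el_add algebra_simps)

lemma el_uminus_plus_1: "el (- g) + 1 = el (- g) * (el g + 1)" for g :: "'g::group_add"
proof -
  have "el (- g) * el g = 1" by (simp flip: el_add)
  then show ?thesis by (simp add: algebra_simps)
qed

text \<open>Two identities are behind it: [h, x] - 1 = h^(-1) x^(-1) ((h - 1)(x - 1) - (x - 1)(h -
  1)) and x^2 - 1 = (x - 1)^2.\<close>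

lemma dimser_aug_pow:
  fixes g :: "'g::group_add"
  shows "g \<in> dimser n \<Longrightarrow> el g + 1 \<in> aug_pow n"
proof (induction n arbitrary: g rule: less_induct)
  case (less n)
  let ?D = "{g :: 'g. el g + 1 \<in> aug_pow n}"
  have sub: "subgrp ?D" unfolding subgrp_def
  proof (intro conjI ballI)
    show "0 \<in> ?D" by simp
  next
    fix x y :: 'g assume "x \<in> ?D" "y \<in> ?D"
    then show "x + y \<in> ?D" unfolding mem_Collect_eq el_add_plus_1 using aug_pow_add[OF aug_pow_mult_right] by blast
  next
    fix x :: 'g assume "x \<in> ?D"
    then show "- x \<in> ?D" unfolding mem_Collect_eq el_uminus_plus_1 by (rule aug_pow_mult_left)
  qed
  show ?case
  proof (cases "n \<le> 1")
    case True
    then consider "n = 0" | "n = 1" by linarith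
    then show ?thesis by cases (simp, simp only: aug_pow_1, simp)
  next
    case False
    have "comm h x \<in> ?D" if "x \<in> dimser (n - 1)" for h x :: 'g
    proof -
      have x: "el x + 1 \<in> aug_pow (n - 1)" using less.IH that False by simp
      have h: "el h + 1 \<in> aug_pow 1" by (simp only: aug_pow_1) simp
      let ?z = "(el h + 1) * (el x + 1) + (el x + 1) * (el h + 1)"
      have z: "?z \<in> aug_pow n" using aug_pow_mult[OF x h] aug_pow_mult[OF h x] False by (intro aug_pow_add) simp_all
      have "el (comm h x) + 1 = el (- h) * el (- x) * (el h * el x) + el (- h) * el (- x) * (el x * el h)"
      proof -
        have "el (- h) * el (- x) * (el x * el h) = el (- h + - x + (x + h))" by (simp only: el_add)
        also have "- h + - x + (x + h) = 0" by (simp only: grp_norm)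
        finally show ?thesis by (simp add: comm_def el_add mult.assoc del: add_uminus_conv_diff)
      qed
      also have "\<dots> = el (- h) * el (- x) * ?z" by (simp add: algebra_simps)
      finally show ?thesis using aug_pow_mult_left[OF z, of "el (- h) * el (- x)"] by simp
    qed
    then have 1: "gen {comm g x | g x. x \<in> dimser (n - 1)} \<subseteq> ?D" by (intro gen_least[OF sub]) blast
    have "x + x \<in> ?D" if "x \<in> dimser ((n + 1) div 2)" for x :: 'g
    proof -
      have x: "el x + 1 \<in> aug_pow ((n + 1) div 2)" using less.IH that False by simp
      have "el (x + x) + 1 = (el x + 1) * (el x + 1)" by (simp add: el_add algebra_simps)
      also have "\<dots> \<in> aug_pow ((n + 1) div 2 + (n + 1) div 2)" using x x by (rule aug_pow_mult)
      finally have "el (x + x) + 1 \<in> aug_pow ((n + 1) div 2 + (n + 1) div 2)" .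
      moreover have "n \<le> (n + 1) div 2 + (n + 1) div 2" by linarith
      ultimately show ?thesis using aug_pow_antimono by blast
    qed
    then have 2: "gen {x + x | x. x \<in> dimser ((n + 1) div 2)} \<subseteq> ?D" by (intro gen_least[OF sub]) blast
    have "g \<in> setsum (gen {comm g x | g x. x \<in> dimser (n - 1)}) (gen {x + x | x. x \<in> dimser ((n + 1) div 2)})"
      using less.prems False by (simp add: dimser.simps[of n])
    then have "g \<in> ?D" using 1 2 subgrpD(2)[OF sub] unfolding setsum_def by blast
    then show ?thesis by simp
  qed
qed

text \<open>The error (g - 1)(h - 1) has degree 2n > n. So g - 1 depends additively on g modulo the
  next power, which turns products in a layer into sums.\<close>

lemma el_additive:
  assumes "g \<in> dimser n" "h \<in> dimser n" "n > 0"
  shows "(el (g + h) + 1) + ((el g + 1) + (el h + 1)) \<in> aug_pow (Suc n)"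
proof -
  have "(el g + 1) * (el h + 1) \<in> aug_pow (n + n)" using dimser_aug_pow assms by (intro aug_pow_mult)
  then have "(el g + 1) * (el h + 1) \<in> aug_pow (Suc n)" using aug_pow_antimono[of "Suc n" "n + n"] assms(3) by auto
  then show ?thesis unfolding el_add_plus_1' by (simp add: add.assoc)
qed

section \<open>Ordered monomials span\<close>

text \<open>The same multisets index the ordered monomials of the group algebra and the monomials of
  the polynomial module, and this one weight grades both. Hence the two counts compared in
  \<open>mon_independent\<close> agree by construction.\<close>

definition weight :: "nat multiset \<Rightarrow> nat" where "weight P = (\<Sum>m\<in>#P. wt m)"

lemma weight_simps [simp]: "weight {#} = 0" "weight (add_mset m P) = wt m + weight P" "weight (P + Q) = weight P + weight Q"
  by (simp_all add: weight_def)

definition weight_le :: "nat \<Rightarrow> nat multiset set" where "weight_le n = {P. weight P \<le> n}"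

lemma wt_le_weight: "m \<in># P \<Longrightarrow> wt m \<le> weight P"
  by (auto dest!: multi_member_split)

lemma le_wt: "m \<le> wt m" by (simp add: wt_def)

lemma size_le_weight: "size P \<le> weight P"
proof (induction P)
  case (add m P)
  have "wt m \<ge> 1" using wt_pos[of m] by linarith
  with add show ?case by (simp only: weight_simps size_add_mset)
qed simp

lemma finite_weight_le: "finite (weight_le n)"
proof -
  have "finite (\<Union>j\<le>n. multisets_of_size {..n} j)"
    by (intro finite_UN_I finite_atMost finite_multisets_of_size)
  moreover have "weight_le n \<subseteq> (\<Union>j\<le>n. multisets_of_size {..n} j)"
  proof
    fix P assume "P \<in> weight_le n"
    then have "weight P \<le> n" by (simp add: weight_le_def)
    moreover have "m \<le> weight P" if "m \<in># P" for m
      using wt_le_weight[OF that] le_wt[of m] by linarith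
    ultimately have "set_mset P \<subseteq> {..n}" by force
    moreover have "size P \<le> n" using size_le_weight[of P] \<open>weight P \<le> n\<close> by linarith
    ultimately show "P \<in> (\<Union>j\<le>n. multisets_of_size {..n} j)"
      by (auto simp: multisets_of_size_def)
  qed
  ultimately show ?thesis by (rule finite_subset[rotated])
qed

abbreviation pc_diff :: "nat \<Rightarrow> bsv \<Rightarrow>\<^sub>0 bit" where "pc_diff m \<equiv> el (pc_gen m) + 1"

definition list_mon :: "nat list \<Rightarrow> nat multiset \<Rightarrow> bsv \<Rightarrow>\<^sub>0 bit" where
  "list_mon ms P = prod_list (map (\<lambda>m. pc_diff m ^ count P m) ms)"

lemma pc_diff_aug_pow: "pc_diff m \<in> aug_pow (wt m)"
  by (rule dimser_aug_pow[OF pc_gen_dimser])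

lemma list_mon_aug_pow: "distinct ms \<Longrightarrow> set_mset P \<subseteq> set ms \<Longrightarrow> list_mon ms P \<in> aug_pow (weight P)"
proof (induction ms arbitrary: P)
  case Nil then show ?case by (simp add: list_mon_def)
next
  case (Cons m ms)
  let ?Q = "filter_mset (\<lambda>x. x \<noteq> m) P"
  have P: "P = replicate_mset (count P m) m + ?Q"
    by (rule multiset_eqI) auto
  have "weight (replicate_mset j m) = j * wt m" for j by (induction j) simp_all
  then have w: "weight P = count P m * wt m + weight ?Q" by (subst P) (simp only: weight_simps)
  have *: "map (\<lambda>x. pc_diff x ^ count P x) ms = map (\<lambda>x. pc_diff x ^ count ?Q x) ms" using Cons.prems by auto
  have "list_mon (m # ms) P = pc_diff m ^ count P m * list_mon ms ?Q"
    unfolding list_mon_def list.map prod_list.Cons * ..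
  moreover have "list_mon ms ?Q \<in> aug_pow (weight ?Q)" using Cons.prems by (intro Cons.IH) auto
  ultimately show ?case unfolding w using aug_pow_mult aug_pow_power[OF pc_diff_aug_pow] by metis
qed

definition mon_span_upto :: "nat \<Rightarrow> nat list \<Rightarrow> (bsv \<Rightarrow>\<^sub>0 bit) set" where
  "mon_span_upto n ms = aspan (list_mon ms ` {P. set_mset P \<subseteq> set ms \<and> weight P \<le> n} \<union> aug_pow (Suc n))"

lemma mon_span_upto_add: "x \<in> mon_span_upto n ms \<Longrightarrow> y \<in> mon_span_upto n ms \<Longrightarrow> x + y \<in> mon_span_upto n ms"
  unfolding mon_span_upto_def by (rule aspan_add)

text \<open>As \<open>m\<close> heads the list, multiplying on the left just raises its exponent; if
  the weight passes \<open>n\<close>, the product has fallen into the next power of the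
  ideal.\<close>

lemma mon_span_upto_mult_X:
  assumes "distinct (m # ms)" "x \<in> mon_span_upto n (m # ms)" shows "pc_diff m * x \<in> mon_span_upto n (m # ms)"
  using assms(2) unfolding mon_span_upto_def
proof (rule aspan_map[rotated 3])
  fix s assume "s \<in> list_mon (m # ms) ` {P. set_mset P \<subseteq> set (m # ms) \<and> weight P \<le> n} \<union> aug_pow (Suc n)"
  then consider P where "set_mset P \<subseteq> set (m # ms)" "weight P \<le> n" "s = list_mon (m # ms) P" | "s \<in> aug_pow (Suc n)" by blast
  then show "pc_diff m * s \<in> aspan (list_mon (m # ms) ` {P. set_mset P \<subseteq> set (m # ms) \<and> weight P \<le> n} \<union> aug_pow (Suc n))"
  proof cases
    case 1
    let ?P = "add_mset m P"
    have *: "map (\<lambda>x. pc_diff x ^ count ?P x) ms = map (\<lambda>x. pc_diff x ^ count P x) ms" using assms(1) by auto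
    have e: "pc_diff m * s = list_mon (m # ms) ?P"
      unfolding 1(3) list_mon_def list.map prod_list.Cons * by (simp add: mult.assoc)
    have s: "set_mset ?P \<subseteq> set (m # ms)" using 1 by simp
    show ?thesis
    proof (cases "weight ?P \<le> n")
      case True then show ?thesis unfolding e using s by (intro aspan_incl) blast
    next
      case False
      then have "pc_diff m * s \<in> aug_pow (Suc n)"
        unfolding e using list_mon_aug_pow[OF assms(1) s] aug_pow_antimono[of "Suc n" "weight ?P"] by auto
      then show ?thesis by (intro aspan_incl) blast
    qed
  next
    case 2 then show ?thesis using aug_pow_mult_left by (intro aspan_incl) blast
  qed
qed (simp_all add: algebra_simps)

lemma mon_span_upto_mono: assumes "distinct (m # ms)" shows "mon_span_upto n ms \<subseteq> mon_span_upto n (m # ms)"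
  unfolding mon_span_upto_def
proof (rule aspan_mono, rule subsetI)
  fix s assume "s \<in> list_mon ms ` {P. set_mset P \<subseteq> set ms \<and> weight P \<le> n} \<union> aug_pow (Suc n)"
  then consider P where "set_mset P \<subseteq> set ms" "weight P \<le> n" "s = list_mon ms P" | "s \<in> aug_pow (Suc n)" by blast
  then show "s \<in> aspan (list_mon (m # ms) ` {P. set_mset P \<subseteq> set (m # ms) \<and> weight P \<le> n} \<union> aug_pow (Suc n))"
  proof cases
    case 1
    then have "count P m = 0" using assms by (auto simp: count_eq_zero_iff)
    then have "s = list_mon (m # ms) P" using 1 by (simp add: list_mon_def)
    then show ?thesis using 1 by (intro aspan_incl) auto
  next
    case 2 then show ?thesis by (intro aspan_incl) blast
  qed
qed

lemma nf_mon_span_upto: "g \<in> nf (dimser (Suc n)) ms \<Longrightarrow> distinct ms \<Longrightarrow> el g \<in> mon_span_upto n ms"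
proof (induction ms arbitrary: g)
  case Nil
  have "el g = 1 + (el g + 1)" by simp
  moreover have "1 \<in> mon_span_upto n []" unfolding mon_span_upto_def
    by (rule aspan_incl, rule UnI1, rule image_eqI[of _ _ "{#}"]) (simp_all add: list_mon_def)
  moreover have "el g + 1 \<in> mon_span_upto n []" unfolding mon_span_upto_def
    using dimser_aug_pow[of g "Suc n"] Nil by (intro aspan_incl) simp
  ultimately show ?case using mon_span_upto_add[of 1 n "[]" "el g + 1"] by (simp only:)
next
  case (Cons m ms)
  then obtain e y where g: "g = npow e (pc_gen m) + y" "y \<in> nf (dimser (Suc n)) ms" by auto
  have "el (npow e (pc_gen m) + y) \<in> mon_span_upto n (m # ms)"
  proof (induction e)
    case 0
    show ?case using Cons.IH[OF g(2)] Cons.prems(2) mon_span_upto_mono[OF Cons.prems(2)] by auto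
  next
    case (Suc e)
    \<comment> \<open>Writing g = (g - 1) + 1 strips off one factor of the group element at a
      time.\<close>
    have "el (npow (Suc e) (pc_gen m) + y) = pc_diff m * el (npow e (pc_gen m) + y) + el (npow e (pc_gen m) + y)"
      by (simp add: el_add algebra_simps)
    then show ?case using mon_span_upto_add[OF mon_span_upto_mult_X[OF Cons.prems(2) Suc] Suc] by simp
  qed
  then show ?case using g by simp
qed

abbreviation mon :: "nat \<Rightarrow> nat multiset \<Rightarrow> bsv \<Rightarrow>\<^sub>0 bit" where "mon k \<equiv> list_mon [0..<2 ^ k + 1]"

lemma weight_le_set_mset: "n \<le> 2 ^ k \<Longrightarrow> P \<in> weight_le n \<Longrightarrow> set_mset P \<subseteq> set [0..<2 ^ k + 1]"
proof
  fix m assume "n \<le> 2 ^ k" "P \<in> weight_le n" "m \<in># P"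
  then have "m \<le> 2 ^ k" using wt_le_weight[of m P] le_wt[of m] by (simp add: weight_le_def)
  then show "m \<in> set [0..<2 ^ k + 1]" by (simp add: le_imp_less_Suc del: upt_Suc)
qed

lemma mon_aug_pow: "weight P \<le> 2 ^ k \<Longrightarrow> mon k P \<in> aug_pow (weight P)"
  by (rule list_mon_aug_pow[OF distinct_upt]) (rule weight_le_set_mset[of "weight P"], simp_all add: weight_le_def)

lemma mon_span:
  assumes "n \<le> 2 ^ k" shows "\<exists>D\<subseteq>weight_le n. x + (\<Sum>P\<in>D. mon k P) \<in> aug_pow (Suc n)"
proof -
  let ?ms = "[0..<2 ^ k + 1]"
  have "branch k \<subseteq> dimser (Suc n)" using branch_dimser[of k] dimser_antimono[of "Suc n" "2 ^ k + 1"] assms by auto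
  then have nf: "nf (dimser (Suc n)) ?ms = UNIV" by (intro nf_UNIV[OF nsubgrp_dimser pc_gen_npow_dimser])
  have "x \<in> mon_span_upto n ?ms"
  proof (induction x rule: pm_induct)
    case zero show ?case by (simp add: mon_span_upto_def aspan.zero)
  next
    case (add x g)
    have "el g \<in> mon_span_upto n ?ms" using nf by (intro nf_mon_span_upto distinct_upt) blast
    with add show ?case by (rule mon_span_upto_add)
  qed
  moreover have "list_mon ?ms ` {P. set_mset P \<subseteq> set ?ms \<and> weight P \<le> n} \<subseteq> mon k ` weight_le n" by (auto simp: weight_le_def)
  then have "list_mon ?ms ` {P. set_mset P \<subseteq> set ?ms \<and> weight P \<le> n} \<union> aug_pow (Suc n)
      \<subseteq> aspan (mon k ` weight_le n \<union> aug_pow (Suc n))" by (blast intro: aspan_incl)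
  from aspan_mono[OF this] have "mon_span_upto n ?ms \<subseteq> aspan (mon k ` weight_le n \<union> aug_pow (Suc n))" by (simp only: mon_span_upto_def)
  ultimately have "x \<in> aspan (mon k ` weight_le n \<union> aug_pow (Suc n))" by blast
  then show ?thesis by (rule aspan_representative[OF _ finite_weight_le]) (auto intro: aug_pow_add)
qed

section \<open>Balls span\<close>

definition letters :: "bsv set" where "letters = {gtau, gmu, - gtau, - gmu}"

definition ball :: "nat \<Rightarrow> bsv set" where
  "ball n = {sum_list w | w. length w \<le> n \<and> set w \<subseteq> letters}"

lemma finite_ball: "finite (ball n)"
proof -
  have "ball n = sum_list ` {w. set w \<subseteq> letters \<and> length w \<le> n}" by (auto simp: ball_def)
  then show ?thesis using finite_lists_length_le[of letters n] by (simp add: letters_def)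
qed

lemma ball_add: "b \<in> ball n \<Longrightarrow> s \<in> letters \<Longrightarrow> b + s \<in> ball (Suc n)" "ball n \<subseteq> ball (Suc n)"
proof -
  assume "b \<in> ball n" "s \<in> letters"
  then obtain w where "length w \<le> n" "set w \<subseteq> letters" "b = sum_list w" by (auto simp: ball_def)
  then show "b + s \<in> ball (Suc n)" using \<open>s \<in> letters\<close>
    unfolding ball_def by (intro CollectI exI[of _ "w @ [s]"]) auto
qed (auto simp: ball_def le_SucI)

text \<open>The step rests on a (s - 1) for letters s. If a is in the ball of radius n, this is a
  difference of two elements of the next ball; if a is in the power n + 1, it lies in the power n +
  2. For a of degree n, longer words reduce to letters because the mixed term a (g - 1)(s - 1) has
  degree n + 2.\<close>

lemma ball_span: "x \<in> aspan (el ` ball n \<union> aug_pow (Suc n))"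
proof (induction n arbitrary: x)
  case 0
  have 1: "el 0 \<in> aspan (el ` ball 0 \<union> aug_pow (Suc 0))"
    by (rule aspan_incl, rule UnI1, rule imageI) (auto simp: ball_def)
  have p: "y \<in> aspan (el ` ball 0 \<union> aug_pow (Suc 0))" if "aug y = 0" for y
    using that aug_pow_1 by (intro aspan_incl UnI2) auto
  show ?case
  proof (cases "aug x")
    case zero then show ?thesis by (rule p)
  next
    case one
    then have "aug (x + el 0) = 0" by simp
    from aspan_add[OF 1 p[OF this]] show ?thesis by (simp add: add.assoc)
  qed
next
  case (Suc n)
  let ?V = "aspan (el ` ball (Suc n) \<union> aug_pow (Suc (Suc n)))"
  have letter: "a * (el s + 1) \<in> ?V" if s: "s \<in> letters" for a s
  proof (rule aspan_map[where f = "\<lambda>a. a * (el s + 1)", OF _ _ _ Suc.IH])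
    fix b assume "b \<in> el ` ball n \<union> aug_pow (Suc n)"
    then consider c where "c \<in> ball n" "b = el c" | "b \<in> aug_pow (Suc n)" by blast
    then show "b * (el s + 1) \<in> ?V"
    proof cases
      case 1
      then have "el (c + s) \<in> ?V" "el c \<in> ?V" using ball_add s by (blast intro: aspan_incl)+
      then have "el (c + s) + el c \<in> ?V" using aspan_add by blast
      then show ?thesis using 1 by (simp add: el_add algebra_simps)
    next
      case 2
      have "aug (el s + 1) = 0" by simp
      from aug_pow_prod[OF 2 this] show ?thesis by (intro aspan_incl UnI2)
    qed
  qed (simp_all add: algebra_simps)
  have el: "a * (el g + 1) \<in> ?V" if a: "a \<in> aug_pow n" for a g
  proof -
    have step: "a * (el (g + s) + 1) \<in> ?V" if g: "a * (el g + 1) \<in> ?V" and s: "s \<in> letters" for g s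
    proof -
      have "a * (el g + 1) \<in> aug_pow (Suc n)" "aug (el s + 1) = 0" using aug_pow_prod[OF a, of "el g + 1"] by simp_all
      then have "a * (el g + 1) * (el s + 1) \<in> ?V" by (intro aspan_incl UnI2) (rule aug_pow_prod)
      moreover have "a * (el (g + s) + 1) = a * (el g + 1) * (el s + 1) + (a * (el g + 1) + a * (el s + 1))"
        unfolding el_add_plus_1' mult.assoc
        by (simp only: distrib_left[of a "(el g + 1) * (el s + 1)"] distrib_left[of a "el g + 1" "el s + 1"])
      ultimately show ?thesis using g letter[OF s] aspan_add by metis
    qed
    show ?thesis
    proof (induction g rule: bsv_induct)
      case zero show ?case by (simp add: aspan.zero)
    next
      case (tau g) then show ?case by (rule step) (simp add: letters_def)
    next
      case (mu g) then show ?case by (rule step) (simp add: letters_def)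
    next
      case (tau_inv g) then show ?case unfolding diff_conv_add_uminus by (rule step) (simp add: letters_def)
    next
      case (mu_inv g) then show ?case unfolding diff_conv_add_uminus by (rule step) (simp add: letters_def)
    qed
  qed
  have "aug_pow (Suc n) \<subseteq> ?V" unfolding aug_pow.simps(2)[of n]
  proof (rule aspan_mono, rule subsetI)
    fix y :: "bsv \<Rightarrow>\<^sub>0 bit" assume "y \<in> {a * b | a b. a \<in> aug_pow n \<and> aug b = 0}"
    then obtain a b where y: "y = a * b" "a \<in> aug_pow n" "aug b = 0" by blast
    \<comment> \<open>Induction over the support leaves the augmentation ideal, so 1 is added
      whenever the augmentation is 1; for the given b the correction is 0.\<close>
    have "a * (b + of_bool (aug b = 1)) \<in> ?V" for b
    proof (induction b rule: pm_induct)
      case zero show ?case by (simp add: aspan.zero)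
    next
      case (add b g)
      have "b + el g + of_bool (aug (b + el g) = 1) = (b + of_bool (aug b = 1)) + (el g + 1)"
        by (cases "aug b") (simp_all add: algebra_simps)
      then have "a * (b + el g + of_bool (aug (b + el g) = 1)) = a * (b + of_bool (aug b = 1)) + a * (el g + 1)"
        by (simp only: distrib_left)
      then show ?case using add el[OF y(2)] aspan_add by metis
    qed
    from this[of b] show "y \<in> ?V" using y by simp
  qed
  moreover have "el ` ball n \<subseteq> ?V" using ball_add(2) by (blast intro: aspan_incl)
  ultimately have "aspan (el ` ball n \<union> aug_pow (Suc n)) \<subseteq> ?V" by (intro aspan_mono) blast
  then show ?case using Suc.IH by blast
qed

section \<open>A weighted polynomial module\<close>

text \<open>Polynomials whose monomials are multisets of variable numbers. Variable 0 is the w of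
  the overview; the variables 1 to 2^k form the weighted basis of the linear forms.\<close>

type_synonym wpoly = "nat multiset \<Rightarrow>\<^sub>0 bit"

definition weight_ideal :: "nat \<Rightarrow> wpoly set" where
  "weight_ideal n = {f. \<forall>P\<in>Poly_Mapping.keys f. n \<le> weight P}"

lemma weight_ideal_zero [simp]: "0 \<in> weight_ideal n"
  by (simp add: weight_ideal_def)

lemma weight_ideal_all [simp]: "f \<in> weight_ideal 0"
  by (simp add: weight_ideal_def)

lemma weight_ideal_add: "f \<in> weight_ideal n \<Longrightarrow> g \<in> weight_ideal n \<Longrightarrow> f + g \<in> weight_ideal n"
  using Poly_Mapping.keys_add[of f g] by (auto simp: weight_ideal_def)

lemma weight_ideal_antimono: "m \<le> n \<Longrightarrow> f \<in> weight_ideal n \<Longrightarrow> f \<in> weight_ideal m"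
  by (force simp: weight_ideal_def)

lemma weight_ideal_mult: assumes "f \<in> weight_ideal m" "g \<in> weight_ideal n" shows "f * g \<in> weight_ideal (m + n)"
  unfolding weight_ideal_def
proof (intro CollectI ballI)
  fix P assume "P \<in> Poly_Mapping.keys (f * g)"
  then obtain a b where "P = a + b" "a \<in> Poly_Mapping.keys f" "b \<in> Poly_Mapping.keys g"
    using Poly_Mapping.keys_mult[of f g] by blast
  then show "m + n \<le> weight P" using assms by (simp add: weight_ideal_def add_mono)
qed

lemma weight_ideal_mult_right: "f \<in> weight_ideal n \<Longrightarrow> f * g \<in> weight_ideal n"
  using weight_ideal_mult[of f n g 0] by simp

lemma weight_ideal_mult_left: "f \<in> weight_ideal n \<Longrightarrow> g * f \<in> weight_ideal n"
  using weight_ideal_mult[of g 0 f n] by simp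

lemma weight_ideal_power: "f \<in> weight_ideal 1 \<Longrightarrow> f ^ n \<in> weight_ideal n"
proof (induction n)
  case (Suc n) then show ?case using weight_ideal_mult[of f 1 "f ^ n" n] by simp
qed simp

lemma weight_ideal_sum: "(\<And>i. i \<in> I \<Longrightarrow> f i \<in> weight_ideal n) \<Longrightarrow> sum f I \<in> weight_ideal n"
  by (induction I rule: infinite_finite_induct) (simp_all add: weight_ideal_add)

lemma el_weight_ideal: "el P \<in> weight_ideal (weight P)"
  by (simp add: weight_ideal_def)

lemma weight_ideal_cong_trans: "f + g \<in> weight_ideal n \<Longrightarrow> g + h \<in> weight_ideal n \<Longrightarrow> f + h \<in> weight_ideal n"
  using weight_ideal_add[of "f + g" n "g + h"] by (simp add: add.assoc)

lemma weight_ideal_cong_mult: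
  assumes "a + b \<in> weight_ideal n" "c + d \<in> weight_ideal n" shows "a * c + b * d \<in> weight_ideal n"
proof -
  have "a * c + b * d = (a + b) * c + b * (c + d)" by (simp add: algebra_simps)
  then show ?thesis using weight_ideal_add[OF weight_ideal_mult_right[OF assms(1)] weight_ideal_mult_left[OF assms(2)]] by simp
qed

lemma weight_ideal_cong_prod:
  assumes "\<And>i. i \<in> I \<Longrightarrow> f i + g i \<in> weight_ideal n" shows "prod f I + prod g I \<in> weight_ideal n"
  using assms by (induction I rule: infinite_finite_induct) (simp_all add: weight_ideal_cong_mult)

lemma weight_ideal_cong_power: "a + b \<in> weight_ideal n \<Longrightarrow> a ^ i + b ^ i \<in> weight_ideal n"
  by (induction i) (simp_all add: weight_ideal_cong_mult)

lemma frobenius_one_plus: "(1 + x) ^ 2 ^ k = 1 + (x :: wpoly) ^ 2 ^ k"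
proof (induction k)
  case (Suc k)
  have "(1 + x) ^ 2 ^ Suc k = (1 + x ^ 2 ^ k) * (1 + x ^ 2 ^ k)"
    by (simp only: power_Suc mult.commute[of 2] power_mult Suc power2_eq_square)
  also have "\<dots> = 1 + x ^ 2 ^ k * x ^ 2 ^ k" by (simp add: algebra_simps)
  also have "x ^ 2 ^ k * x ^ 2 ^ k = x ^ 2 ^ Suc k" by (simp only: power_Suc mult_2 power_add)
  finally show ?case .
qed simp

text \<open>By Frobenius (1 + x)^(2^k) = 1 + x^(2^k), which is 1 modulo weight 2^k. Exponents thus
  matter only modulo 2^k, which makes sense of negative ones.\<close>

lemma pow_cong_mod:
  assumes "x \<in> weight_ideal 1" "i mod 2 ^ k = j mod 2 ^ k" shows "(1 + x) ^ i + (1 + x) ^ j \<in> weight_ideal (2 ^ k)"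
proof -
  have one: "(1 + x) ^ i + (1 + x) ^ (i mod 2 ^ k) \<in> weight_ideal (2 ^ k)" for i
  proof -
    have "(1 + x) ^ 2 ^ k + 1 \<in> weight_ideal (2 ^ k)"
      using weight_ideal_power[OF assms(1), of "2 ^ k"] by (simp add: frobenius_one_plus algebra_simps)
    from weight_ideal_cong_power[OF this, of "i div 2 ^ k"]
    have "((1 + x) ^ 2 ^ k) ^ (i div 2 ^ k) + 1 \<in> weight_ideal (2 ^ k)" by simp
    from weight_ideal_mult_right[OF this, of "(1 + x) ^ (i mod 2 ^ k)"]
    have "(1 + x) ^ (2 ^ k * (i div 2 ^ k) + i mod 2 ^ k) + (1 + x) ^ (i mod 2 ^ k) \<in> weight_ideal (2 ^ k)"
      by (simp only: distrib_right power_add power_mult mult_1_left)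
    then show ?thesis by simp
  qed
  have "(1 + x) ^ (i mod 2 ^ k) + (1 + x) ^ j \<in> weight_ideal (2 ^ k)"
    using one[of j] assms(2) by (simp add: add.commute)
  with one[of i] show ?thesis by (rule weight_ideal_cong_trans)
qed

section \<open>Sums over bitwise smaller words and the unitriangular action\<close>

primrec downset_sum :: "bool list \<Rightarrow> (bool list \<Rightarrow> 'm::comm_monoid_add) \<Rightarrow> 'm" where
  "downset_sum [] f = f []"
| "downset_sum (b # u) f = downset_sum u (\<lambda>r. f (False # r)) + (if b then downset_sum u (\<lambda>r. f (True # r)) else 0)"

lemma downset_sum_add: "downset_sum u (\<lambda>r. f r + g r) = downset_sum u f + downset_sum u g"
  by (induction u arbitrary: f g) (simp_all add: algebra_simps)

lemma downset_sum_zero [simp]: "downset_sum u (\<lambda>r. 0) = 0"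
  by (induction u) simp_all

lemma downset_sum_hom:
  assumes "\<And>x y. h (x + y) = h x + h y" "h 0 = 0"
  shows "h (downset_sum u f) = downset_sum u (\<lambda>r. h (f r))"
  by (induction u arbitrary: f) (simp_all add: assms)

lemma downset_sum_cong: "(\<And>r. length r = length u \<Longrightarrow> f r = g r) \<Longrightarrow> downset_sum u f = downset_sum u g"
proof (induction u arbitrary: f g)
  case (Cons b u)
  have "downset_sum u (\<lambda>r. f (c # r)) = downset_sum u (\<lambda>r. g (c # r))" for c
    by (rule Cons.IH) (simp add: Cons.prems)
  then show ?case by simp
qed simp

text \<open>\<open>downset_sum\<close> is the zeta transform of the Boolean lattice of words, and in
  characteristic 2 it is its own Moebius inverse. So basis forms and vertex forms are expressed
  through each other by the same formula.\<close>

lemma downset_sum_downset_sum: "downset_sum u (\<lambda>r. downset_sum r f) = (f u :: 'k \<Rightarrow>\<^sub>0 bit)"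
proof (induction u arbitrary: f)
  case (Cons b u)
  have "downset_sum (b # u) (\<lambda>r. downset_sum r f) = downset_sum u (\<lambda>r. downset_sum r (\<lambda>r. f (False # r)))
    + (if b then downset_sum u (\<lambda>r. downset_sum r (\<lambda>r. f (False # r)) + downset_sum r (\<lambda>r. f (True # r))) else 0)"
    by simp
  also have "\<dots> = f (b # u)" unfolding downset_sum_add Cons.IH by simp
  finally show ?case .
qed simp

primrec val :: "bool list \<Rightarrow> nat" where
  "val [] = 0"
| "val (b # v) = of_bool b + 2 * val v"

primrec unval :: "nat \<Rightarrow> nat \<Rightarrow> bool list" where
  "unval 0 j = []"
| "unval (Suc k) j = odd j # unval k (j div 2)"

lemma length_unval [simp]: "length (unval k j) = k"
  by (induction k arbitrary: j) simp_all

lemma val_unval: "j < 2 ^ k \<Longrightarrow> val (unval k j) = j"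
  by (induction k arbitrary: j) (auto simp: less_mult_imp_div_less mult.commute)

lemma unval_val: "unval (length v) (val v) = v"
  by (induction v) auto

lemma val_less: "val v < 2 ^ length v"
  by (induction v) auto

text \<open>A tree automorphism acts unitriangularly with respect to the basis dual to bit monomials.\<close>

lemma downset_sum_triangular:
  assumes "\<And>q. length q = length r \<Longrightarrow> z q \<in> weight_ideal (t + s * val q)"
  shows "downset_sum r (\<lambda>v. downset_sum (app h v) z) + z r \<in> weight_ideal (t + s * (val r + 1))"
  using assms
proof (induction r arbitrary: h z t s)
  case Nil then show ?case by simp
next
  case (Cons b r)
  let ?z = "\<lambda>c q. z (c # q)"
  \<comment> \<open>Splitting by the first letter replaces t and s by t and 2s on the half with
    letter 0, and by t + s and 2s on the half with letter 1; this is why t and s are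
    general.\<close>
  have z0: "?z False q \<in> weight_ideal (t + (2 * s) * val q)" and z1: "?z True q \<in> weight_ideal ((t + s) + (2 * s) * val q)"
    if "length q = length r" for q
    using Cons.prems[of "False # q"] Cons.prems[of "True # q"] that by (simp_all add: algebra_simps)
  define A where "A g = downset_sum r (\<lambda>v. downset_sum (app g v) (?z False))" for g
  define B where "B g = downset_sum r (\<lambda>v. downset_sum (app g v) (?z True))" for g
  have A: "A g + z (False # r) \<in> weight_ideal (t + (2 * s) * (val r + 1))" for g
    unfolding A_def using Cons.IH[of "?z False", OF z0] by simp
  have B: "B g + z (True # r) \<in> weight_ideal ((t + s) + (2 * s) * (val r + 1))" for g
    unfolding B_def using Cons.IH[of "?z True", OF z1] by simp
  have split: "downset_sum r (\<lambda>v. downset_sum (app h (c # v)) z) = A (tree_sec c h) + (if root_perm h c then B (tree_sec c h) else 0)" for c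
    by (simp add: A_def B_def downset_sum_add)
  let ?n = "t + s * (val (b # r) + 1)"
  show ?case
  proof (cases b)
    case False
    have 1: "A (tree_sec False h) + z (False # r) \<in> weight_ideal ?n"
      using weight_ideal_antimono[OF _ A] False by (simp add: algebra_simps)
    \<comment> \<open>For letter 0 the contribution of the other half is an error term, since its
      leading term already has the required weight.\<close>
    have 2: "B (tree_sec False h) \<in> weight_ideal ?n"
    proof -
      have "B (tree_sec False h) + z (True # r) \<in> weight_ideal ?n" using weight_ideal_antimono[OF _ B] False by (simp add: algebra_simps)
      moreover have "z (True # r) \<in> weight_ideal ?n" using z1[of r] False by (simp add: algebra_simps)
      ultimately have "B (tree_sec False h) + z (True # r) + z (True # r) \<in> weight_ideal ?n" by (rule weight_ideal_add)
      then show ?thesis by (simp only: add.assoc pm_add_self add_0_right)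
    qed
    have "downset_sum (b # r) (\<lambda>v. downset_sum (app h v) z) + z (b # r)
      = (A (tree_sec False h) + z (False # r)) + (if root_perm h False then B (tree_sec False h) else 0)"
      using False by (simp only: downset_sum.simps split if_False) (simp add: algebra_simps)
    then show ?thesis using weight_ideal_add[OF 1 2] 1 by auto
  next
    case True
    have root_perm: "root_perm h True = (\<not> root_perm h False)" using root_perm_Not[of h False] by simp
    have "A (tree_sec False h) + A (tree_sec True h) = (A (tree_sec False h) + z (False # r)) + (A (tree_sec True h) + z (False # r))"
      by (simp add: algebra_simps)
    moreover have "\<dots> \<in> weight_ideal ?n" using weight_ideal_antimono[OF _ weight_ideal_add[OF A A], of ?n] True by (simp add: algebra_simps)
    ultimately have 1: "A (tree_sec False h) + A (tree_sec True h) \<in> weight_ideal ?n" by simp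
    \<comment> \<open>For letter 1 both letters contribute: the two leading terms from the 0-half
      cancel, and exactly one letter is sent to 1, so the leading term of the 1-half survives once.
      That letter equals the image of 1, a permutation of two letters being its own inverse.\<close>
    define c where "c = root_perm h True"
    have 2: "B (tree_sec c h) + z (True # r) \<in> weight_ideal ?n"
      using weight_ideal_antimono[OF _ B, of ?n] True by (simp add: algebra_simps)
    have "downset_sum (b # r) (\<lambda>v. downset_sum (app h v) z) + z (b # r)
      = (A (tree_sec False h) + A (tree_sec True h)) + (B (tree_sec c h) + z (True # r))"
      using True root_perm by (simp only: downset_sum.simps split c_def) (cases "root_perm h True"; simp add: algebra_simps)
    then show ?thesis using weight_ideal_add[OF 1 2] by simp
  qed
qed

section \<open>Linear forms and the action by substitution\<close>

definition basis_form :: "bool list \<Rightarrow> wpoly" where "basis_form r = el {#val r + 1#}"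
definition vertex_form :: "bool list \<Rightarrow> wpoly" where "vertex_form v = downset_sum v basis_form"

lemma basis_form_weight_ideal: "basis_form r \<in> weight_ideal (1 + 1 * val r)"
  using el_weight_ideal[of "{#val r + 1#}"] by (simp add: basis_form_def wt_def)

lemma downset_sum_weight_ideal: "(\<And>r. f r \<in> weight_ideal n) \<Longrightarrow> downset_sum v f \<in> weight_ideal n"
  by (induction v arbitrary: f) (simp_all add: weight_ideal_add)

lemma vertex_form_weight_ideal: "vertex_form v \<in> weight_ideal 1"
  unfolding vertex_form_def by (rule downset_sum_weight_ideal, rule weight_ideal_antimono[OF _ basis_form_weight_ideal]) simp

text \<open>A tree automorphism should permute the vertex forms; a variable is a basis form, that
  is, a sum of vertex forms over a downset, and its image is read off from that. Variable 0 and
  those beyond 2^k stay fixed.\<close>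

definition subst_var :: "nat \<Rightarrow> bsv \<Rightarrow> nat \<Rightarrow> wpoly" where
  "subst_var k h m = (if 1 \<le> m \<and> m \<le> 2 ^ k then downset_sum (unval k (m - 1)) (\<lambda>v. vertex_form (app h v)) else el {#m#})"

lemma subst_var_weight_ideal: "subst_var k h m + el {#m#} \<in> weight_ideal (wt m + 1)"
proof (cases "1 \<le> m \<and> m \<le> 2 ^ k")
  case True
  then have v: "val (unval k (m - 1)) = m - 1" by (intro val_unval) auto
  then have z: "el {#m#} = basis_form (unval k (m - 1))" using True by (simp add: basis_form_def)
  have "subst_var k h m + el {#m#} = downset_sum (unval k (m - 1)) (\<lambda>v. downset_sum (app h v) basis_form) + basis_form (unval k (m - 1))"
    using True z by (simp add: subst_var_def vertex_form_def)
  also have "\<dots> \<in> weight_ideal (1 + 1 * (val (unval k (m - 1)) + 1))" by (rule downset_sum_triangular[OF basis_form_weight_ideal])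
  finally show ?thesis using v True by (simp add: wt_def)
qed (auto simp: subst_var_def)

definition subst_mon :: "nat \<Rightarrow> bsv \<Rightarrow> nat multiset \<Rightarrow> wpoly" where
  "subst_mon k h P = (\<Prod>m\<in>#P. subst_var k h m)"

definition poly_subst :: "nat \<Rightarrow> bsv \<Rightarrow> wpoly \<Rightarrow> wpoly" where "poly_subst k h = linext (subst_mon k h)"

lemma poly_subst_add: "poly_subst k h (x + y) = poly_subst k h x + poly_subst k h y"
  unfolding poly_subst_def by (rule linext_add) simp

lemma poly_subst_mult: "poly_subst k h (x * y) = poly_subst k h x * poly_subst k h y"
  unfolding poly_subst_def by (rule linext_mult) (simp_all add: subst_mon_def)

lemma poly_subst_el: "poly_subst k h (el P) = subst_mon k h P"
  by (simp add: poly_subst_def)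

lemma poly_subst_zero: "poly_subst k h 0 = 0"
  by (simp add: poly_subst_def)

lemma poly_subst_one: "poly_subst k h 1 = 1"
  using poly_subst_el[of k h 0] by (simp add: subst_mon_def)

lemma poly_subst_power: "poly_subst k h (x ^ n) = poly_subst k h x ^ n"
  by (induction n) (simp_all add: poly_subst_one poly_subst_mult)

lemma poly_subst_prod: "poly_subst k h (prod f I) = (\<Prod>i\<in>I. poly_subst k h (f i))"
  by (induction I rule: infinite_finite_induct) (simp_all add: poly_subst_one poly_subst_mult)

lemma poly_subst_basis_form: "length r = k \<Longrightarrow> poly_subst k h (basis_form r) = downset_sum r (\<lambda>v. vertex_form (app h v))"
  using val_less[of r] unval_val[of r] by (simp add: basis_form_def poly_subst_el subst_mon_def subst_var_def Suc_leI)

lemma poly_subst_vertex_form: assumes "length v = k" shows "poly_subst k h (vertex_form v) = vertex_form (app h v)"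
proof -
  have "poly_subst k h (vertex_form v) = downset_sum v (\<lambda>r. poly_subst k h (basis_form r))"
    unfolding vertex_form_def by (rule downset_sum_hom[OF poly_subst_add poly_subst_zero])
  also have "\<dots> = downset_sum v (\<lambda>r. downset_sum r (\<lambda>v. vertex_form (app h v)))"
    by (rule downset_sum_cong) (simp add: assms poly_subst_basis_form)
  finally show ?thesis by (simp only: downset_sum_downset_sum)
qed

lemma subst_mon_weight_ideal: "subst_mon k h P + el P \<in> weight_ideal (weight P + 1)" "subst_mon k h P \<in> weight_ideal (weight P)"
proof -
  have "subst_mon k h P + el P \<in> weight_ideal (weight P + 1) \<and> subst_mon k h P \<in> weight_ideal (weight P)"
  proof (induction P)
    case empty show ?case by (simp add: subst_mon_def flip: zero_multiset_def)
  next
    case (add m P)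
    have e: "el (add_mset m P) = el {#m#} * el P" by (simp flip: el_add)
    have s: "subst_mon k h (add_mset m P) = subst_var k h m * subst_mon k h P" by (simp add: subst_mon_def)
    have "subst_mon k h (add_mset m P) + el (add_mset m P)
      = (subst_var k h m + el {#m#}) * subst_mon k h P + el {#m#} * (subst_mon k h P + el P)"
      unfolding e s by (simp add: algebra_simps)
    moreover have "(subst_var k h m + el {#m#}) * subst_mon k h P \<in> weight_ideal (weight (add_mset m P) + 1)"
      using weight_ideal_mult[OF subst_var_weight_ideal[of k h m] conjunct2[OF add]] by (simp add: algebra_simps)
    moreover have "el {#m#} * (subst_mon k h P + el P) \<in> weight_ideal (weight (add_mset m P) + 1)"
      using weight_ideal_mult[OF el_weight_ideal[of "{#m#}"] conjunct1[OF add]] by (simp add: algebra_simps)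
    ultimately have 1: "subst_mon k h (add_mset m P) + el (add_mset m P) \<in> weight_ideal (weight (add_mset m P) + 1)"
      by (simp only: weight_ideal_add)
    have "subst_mon k h (add_mset m P) + el (add_mset m P) \<in> weight_ideal (weight (add_mset m P))"
      by (rule weight_ideal_antimono[OF _ 1]) simp
    from weight_ideal_add[OF this el_weight_ideal] have "subst_mon k h (add_mset m P) \<in> weight_ideal (weight (add_mset m P))"
      by (simp only: add.assoc pm_add_self add_0_right)
    with 1 show ?case by blast
  qed
  then show "subst_mon k h P + el P \<in> weight_ideal (weight P + 1)" "subst_mon k h P \<in> weight_ideal (weight P)" by auto
qed

lemma poly_subst_weight_ideal: assumes "f \<in> weight_ideal n" shows "poly_subst k h f + f \<in> weight_ideal (n + 1)"
proof -
  have "poly_subst k h f + f = (\<Sum>P\<in>Poly_Mapping.keys f. subst_mon k h P) + (\<Sum>P\<in>Poly_Mapping.keys f. el P)"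
    by (simp add: poly_subst_def linext_def flip: el_expand)
  also have "\<dots> = (\<Sum>P\<in>Poly_Mapping.keys f. subst_mon k h P + el P)" by (simp add: sum.distrib)
  also have "\<dots> \<in> weight_ideal (n + 1)"
  proof (rule weight_ideal_sum)
    fix P assume "P \<in> Poly_Mapping.keys f"
    then have "n + 1 \<le> weight P + 1" using assms by (simp add: weight_ideal_def)
    then show "subst_mon k h P + el P \<in> weight_ideal (n + 1)" using subst_mon_weight_ideal(1) by (rule weight_ideal_antimono)
  qed
  finally show ?thesis .
qed

lemma poly_subst_FF': assumes "f \<in> weight_ideal n" shows "poly_subst k h f \<in> weight_ideal n"
proof -
  have "poly_subst k h f + f \<in> weight_ideal n" by (rule weight_ideal_antimono[OF _ poly_subst_weight_ideal[OF assms]]) simp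
  from weight_ideal_add[OF this assms] show ?thesis by (simp only: add.assoc pm_add_self add_0_right)
qed

section \<open>The cocycle and its linear extension\<close>

definition level :: "nat \<Rightarrow> bool list set" where "level k = {v. length v = k}"

lemma finite_level: "finite (level k)"
  using finite_lists_length_eq[of "UNIV :: bool set" k] by (simp add: level_def)

definition grouplike :: "nat \<Rightarrow> (bool list \<Rightarrow> nat) \<Rightarrow> nat \<Rightarrow> wpoly" where
  "grouplike k \<alpha> b = (\<Prod>v\<in>level k. (1 + vertex_form v) ^ \<alpha> v) * (1 + el {#0#}) ^ b"

lemma grouplike_cong:
  assumes "\<And>v. length v = k \<Longrightarrow> \<alpha> v mod 2 ^ k = \<alpha>' v mod 2 ^ k" "b mod 2 ^ k = b' mod 2 ^ k"
  shows "grouplike k \<alpha> b + grouplike k \<alpha>' b' \<in> weight_ideal (2 ^ k)"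
  unfolding grouplike_def
proof (rule weight_ideal_cong_mult)
  show "(\<Prod>v\<in>level k. (1 + vertex_form v) ^ \<alpha> v) + (\<Prod>v\<in>level k. (1 + vertex_form v) ^ \<alpha>' v) \<in> weight_ideal (2 ^ k)"
    by (rule weight_ideal_cong_prod, rule pow_cong_mod[OF vertex_form_weight_ideal]) (simp add: assms(1) level_def)
  have "el {#0#} \<in> weight_ideal 1" using el_weight_ideal[of "{#0#}"] by (simp add: wt_def)
  then show "(1 + el {#0#}) ^ b + (1 + el {#0#}) ^ b' \<in> weight_ideal (2 ^ k)" using assms(2) by (rule pow_cong_mod)
qed

lemma grouplike_one: "grouplike k \<alpha> b + 1 \<in> weight_ideal 1"
proof -
  have e: "el {#0#} \<in> weight_ideal 1" using el_weight_ideal[of "{#0#}"] by (simp add: wt_def)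
  have pow: "(1 + x) ^ i + 1 \<in> weight_ideal 1" if "x \<in> weight_ideal 1" for x :: wpoly and i
    using weight_ideal_cong_power[of "1 + x" 1 1 i] that by (simp add: algebra_simps)
  have "(\<Prod>v\<in>level k. (1 + vertex_form v) ^ \<alpha> v) + (\<Prod>v\<in>level k. 1) \<in> weight_ideal 1"
    by (rule weight_ideal_cong_prod, rule pow[OF vertex_form_weight_ideal])
  from weight_ideal_cong_mult[OF this pow[OF e, of b]] show ?thesis by (simp add: grouplike_def)
qed

text \<open>Exponents are integers, possibly negative; the representative below 2^k is harmless by
  \<open>pow_cong_mod\<close>, at the price that the cocycle identity holds modulo weight
  2^k.\<close>

definition exp_mod :: "nat \<Rightarrow> int \<Rightarrow> nat" where "exp_mod k z = nat (z mod 2 ^ k)"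

lemma int_exp_mod: "int (exp_mod k z) = z mod 2 ^ k"
  by (simp add: exp_mod_def)

lemma exp_mod_add: "exp_mod k (a + b) mod 2 ^ k = (exp_mod k a + exp_mod k b) mod 2 ^ k"
proof -
  have "int (exp_mod k (a + b) mod 2 ^ k) = int ((exp_mod k a + exp_mod k b) mod 2 ^ k)"
    by (simp add: zmod_int int_exp_mod mod_add_eq)
  then show ?thesis by (simp only: of_nat_eq_iff)
qed

lemma exp_mod_int: "exp_mod k (int n) mod 2 ^ k = n mod 2 ^ k"
proof -
  have "int (exp_mod k (int n) mod 2 ^ k) = int (n mod 2 ^ k)" by (simp add: zmod_int int_exp_mod)
  then show ?thesis by (simp only: of_nat_eq_iff)
qed

definition cocycle :: "nat \<Rightarrow> bsv \<Rightarrow> wpoly" where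
  "cocycle k g = grouplike k (\<lambda>v. exp_mod k (tau_exp (tree_secs v g))) (exp_mod k (mu_exp g))"

lemma tree_secs_add: "tree_secs v (s + g) = tree_secs v s + tree_secs (app s v) g"
  by (induction v arbitrary: s g) simp_all

text \<open>The substitution sends the form of v to that of its image under \<open>- s\<close>;
  reindexing the product moves the exponents along \<open>s\<close>, which matches the second
  summand in \<open>tree_secs_add\<close>.\<close>

lemma poly_subst_grouplike: "poly_subst k (- s) (grouplike k \<alpha> b) = grouplike k (\<lambda>v. \<alpha> (app s v)) b"
proof -
  have "(\<Prod>v\<in>level k. poly_subst k (- s) (1 + vertex_form v) ^ \<alpha> v) = (\<Prod>v\<in>level k. (1 + vertex_form (app (- s) v)) ^ \<alpha> v)"
    by (rule prod.cong) (simp_all add: poly_subst_add poly_subst_one poly_subst_vertex_form level_def)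
  also have "\<dots> = (\<Prod>v\<in>level k. (1 + vertex_form v) ^ \<alpha> (app s v))"
    by (rule prod.reindex_bij_witness[where i = "app s" and j = "app (- s)"]) (simp_all add: level_def)
  finally show ?thesis
    by (simp add: grouplike_def poly_subst_mult poly_subst_prod poly_subst_power poly_subst_add poly_subst_one poly_subst_el subst_mon_def subst_var_def)
qed

lemma cocycle_add: "cocycle k (s + g) + cocycle k s * poly_subst k (- s) (cocycle k g) \<in> weight_ideal (2 ^ k)"
proof -
  have "cocycle k s * poly_subst k (- s) (cocycle k g)
    = grouplike k (\<lambda>v. exp_mod k (tau_exp (tree_secs v s)) + exp_mod k (tau_exp (tree_secs (app s v) g))) (exp_mod k (mu_exp s) + exp_mod k (mu_exp g))"
    unfolding cocycle_def poly_subst_grouplike by (simp add: grouplike_def power_add prod.distrib)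
  then show ?thesis
    unfolding cocycle_def by (simp only:) (rule grouplike_cong; simp add: tree_secs_add exp_mod_add)
qed

definition cocycle_ext :: "nat \<Rightarrow> (bsv \<Rightarrow>\<^sub>0 bit) \<Rightarrow> wpoly" where "cocycle_ext k = linext (cocycle k)"

lemma cocycle_ext_add: "cocycle_ext k (x + y) = cocycle_ext k x + cocycle_ext k y"
  unfolding cocycle_ext_def by (rule linext_add) simp

lemma cocycle_ext_el: "cocycle_ext k (el g) = cocycle k g" and cocycle_ext_zero: "cocycle_ext k 0 = 0"
  by (simp_all add: cocycle_ext_def)

lemma cocycle_ext_el_mult: "cocycle_ext k (el s * x) + cocycle k s * poly_subst k (- s) (cocycle_ext k x) \<in> weight_ideal (2 ^ k)"
proof (induction x rule: pm_induct)
  case zero show ?case by (simp add: cocycle_ext_zero poly_subst_zero)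
next
  case (add x g)
  have "cocycle_ext k (el s * (x + el g)) + cocycle k s * poly_subst k (- s) (cocycle_ext k (x + el g))
    = (cocycle_ext k (el s * x) + cocycle k s * poly_subst k (- s) (cocycle_ext k x)) + (cocycle k (s + g) + cocycle k s * poly_subst k (- s) (cocycle k g))"
    by (simp add: distrib_left cocycle_ext_add cocycle_ext_el poly_subst_add mult_single add_ac)
  then show ?case using weight_ideal_add[OF add cocycle_add] by simp
qed

text \<open>With C the cocycle, f the image of x and y the result of moving f by s, the image of (s
  - 1) x is (C(s) - 1) y + (y - f) up to weight 2^k. The first term gains a unit of weight because
  C(s) is 1 modulo weight 1, the second because the action is unipotent; the bound on
  \<open>d\<close> leaves room for the error.\<close>

lemma cocycle_ext_aug:
  assumes x: "cocycle_ext k x \<in> weight_ideal d" and d: "d + 1 \<le> 2 ^ k" and "aug b = 0"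
  shows "cocycle_ext k (b * x) \<in> weight_ideal (d + 1)"
proof -
  have el: "cocycle_ext k ((el s + 1) * x) \<in> weight_ideal (d + 1)" for s
  proof -
    let ?y = "poly_subst k (- s) (cocycle_ext k x)"
    have 1: "cocycle_ext k (el s * x) + cocycle k s * ?y \<in> weight_ideal (d + 1)" using d cocycle_ext_el_mult by (rule weight_ideal_antimono)
    have "(cocycle k s + 1) * ?y \<in> weight_ideal (1 + d)" unfolding cocycle_def by (rule weight_ideal_mult[OF grouplike_one poly_subst_FF'[OF x]])
    then have 2: "(cocycle k s + 1) * ?y \<in> weight_ideal (d + 1)" by (simp only: add.commute)
    have 3: "?y + cocycle_ext k x \<in> weight_ideal (d + 1)" by (rule poly_subst_weight_ideal[OF x])
    have "cocycle_ext k ((el s + 1) * x) = cocycle_ext k (el s * x) + cocycle_ext k x" by (simp only: distrib_right mult_1_left cocycle_ext_add)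
    also have "\<dots> = (cocycle_ext k (el s * x) + cocycle k s * ?y) + ((cocycle k s + 1) * ?y + (?y + cocycle_ext k x))"
      by (simp add: distrib_right add_ac)
    finally show ?thesis using weight_ideal_add[OF 1 weight_ideal_add[OF 2 3]] by simp
  qed
  have "cocycle_ext k ((b + of_bool (aug b = 1)) * x) \<in> weight_ideal (d + 1)"
  proof (induction b rule: pm_induct)
    case zero show ?case by (simp add: cocycle_ext_zero)
  next
    case (add b g)
    have "b + el g + of_bool (aug (b + el g) = 1) = (b + of_bool (aug b = 1)) + (el g + 1)"
      by (cases "aug b") (simp_all add: algebra_simps)
    then have "cocycle_ext k ((b + el g + of_bool (aug (b + el g) = 1)) * x)
      = cocycle_ext k ((b + of_bool (aug b = 1)) * x) + cocycle_ext k ((el g + 1) * x)"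
      by (simp only: distrib_right[of "b + of_bool (aug b = 1)"] cocycle_ext_add)
    then show ?case using weight_ideal_add[OF add el] by simp
  qed
  then show ?thesis using assms(3) by simp
qed

text \<open>The powers are built from the right: in a b x the factor b is absorbed into x and raises
  d by one, which is why x and d vary in the induction.\<close>

lemma cocycle_ext_aug_pow: "a \<in> aug_pow n \<Longrightarrow> cocycle_ext k x \<in> weight_ideal d \<Longrightarrow> d + n \<le> 2 ^ k \<Longrightarrow> cocycle_ext k (a * x) \<in> weight_ideal (d + n)"
proof (induction n arbitrary: a x d)
  case 0
  have "cocycle_ext k (a * x) \<in> weight_ideal d"
  proof (induction a rule: pm_induct)
    case zero show ?case by (simp add: cocycle_ext_zero)
  next
    case (add a g)
    have "d \<le> 2 ^ k" using 0 by simp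
    from weight_ideal_antimono[OF this cocycle_ext_el_mult] have "cocycle_ext k (el g * x) + cocycle k g * poly_subst k (- g) (cocycle_ext k x) \<in> weight_ideal d" .
    moreover have "cocycle k g * poly_subst k (- g) (cocycle_ext k x) \<in> weight_ideal d" by (rule weight_ideal_mult_left[OF poly_subst_FF'[OF 0(2)]])
    ultimately have "cocycle_ext k (el g * x) + cocycle k g * poly_subst k (- g) (cocycle_ext k x) + cocycle k g * poly_subst k (- g) (cocycle_ext k x) \<in> weight_ideal d"
      by (rule weight_ideal_add)
    then have "cocycle_ext k (el g * x) \<in> weight_ideal d"
      by (simp only: add.assoc pm_add_self add_0_right)
    from weight_ideal_add[OF add this] show ?case by (simp only: distrib_right cocycle_ext_add)
  qed
  then show ?case by simp
next
  case (Suc n)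
  have "a \<in> aspan {a * b | a b. a \<in> aug_pow n \<and> aug b = 0}" using Suc.prems(1) by (simp only: aug_pow.simps)
  then show ?case
  proof induction
    case zero show ?case by (simp add: cocycle_ext_zero)
  next
    case (step y s)
    then obtain a b where s: "s = a * b" "a \<in> aug_pow n" "aug b = 0" by blast
    have "cocycle_ext k (b * x) \<in> weight_ideal (d + 1)" using cocycle_ext_aug[OF Suc.prems(2) _ s(3)] Suc.prems(3) by simp
    from Suc.IH[OF s(2) this] have "cocycle_ext k (s * x) \<in> weight_ideal (d + Suc n)"
      using Suc.prems(3) s(1) by (simp add: mult.assoc)
    from weight_ideal_add[OF step.IH this] show ?case by (simp only: distrib_right cocycle_ext_add)
  qed
qed

lemma ex_cocycle: "\<exists>g. cocycle k g + grouplike k \<alpha> b \<in> weight_ideal (2 ^ k)"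
proof -
  obtain A where A: "\<forall>B. \<exists>g. tau_exp g = A \<and> mu_exp g = B \<and> (\<forall>v. length v = k \<longrightarrow> tau_exp (tree_secs v g) = int (\<alpha> v))"
    using ex_level_exponents[of k "\<lambda>v. int (\<alpha> v)"] by blast
  then obtain g where g: "mu_exp g = int b" "\<And>v. length v = k \<Longrightarrow> tau_exp (tree_secs v g) = int (\<alpha> v)" by blast
  then have "cocycle k g + grouplike k \<alpha> b \<in> weight_ideal (2 ^ k)" unfolding cocycle_def by (intro grouplike_cong) (simp_all add: exp_mod_int)
  then show ?thesis by blast
qed

section \<open>Surjectivity modulo weight 2^k\<close>

definition grouplike_span :: "nat \<Rightarrow> wpoly set" where "grouplike_span k = aspan {grouplike k \<alpha> b | \<alpha> b. True}"

lemma grouplike_span_mult: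
  assumes "\<And>\<alpha> b. m * grouplike k \<alpha> b \<in> grouplike_span k" "x \<in> grouplike_span k" shows "m * x \<in> grouplike_span k"
  using assms(2) unfolding grouplike_span_def
  by (rule aspan_map[where f = "\<lambda>x. m * x", OF distrib_left mult_zero_right, rotated])
    (use assms(1) in \<open>auto simp: grouplike_span_def\<close>)

lemma grouplike_span_add: "x \<in> grouplike_span k \<Longrightarrow> y \<in> grouplike_span k \<Longrightarrow> x + y \<in> grouplike_span k"
  unfolding grouplike_span_def by (rule aspan_add)

text \<open>Multiplication by 1 + x_u raises one exponent, so the span is stable under x_u = (1 +
  x_u) - 1. The same holds for w, hence for all variables up to 2^k, and the span contains every
  polynomial in them.\<close>

lemma grouplike_span_vertex_form: assumes "length u = k" "x \<in> grouplike_span k" shows "vertex_form u * x \<in> grouplike_span k"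
proof -
  have "(1 + vertex_form u) * grouplike k \<alpha> b \<in> grouplike_span k" for \<alpha> b
  proof -
    have u: "u \<in> level k" using assms by (simp add: level_def)
    let ?\<alpha> = "\<alpha>(u := Suc (\<alpha> u))"
    have "(\<Prod>v\<in>level k - {u}. (1 + vertex_form v) ^ ?\<alpha> v) = (\<Prod>v\<in>level k - {u}. (1 + vertex_form v) ^ \<alpha> v)"
      by (rule prod.cong) auto
    then have "(1 + vertex_form u) * grouplike k \<alpha> b = grouplike k ?\<alpha> b"
      unfolding grouplike_def prod.remove[OF finite_level u] by (simp add: mult.assoc)
    then show ?thesis unfolding grouplike_span_def by (auto intro: aspan_incl)
  qed
  from grouplike_span_add[OF grouplike_span_mult[OF this assms(2)] assms(2)] show ?thesis by (simp add: distrib_right add_ac)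
qed

lemma grouplike_span_el0: assumes "x \<in> grouplike_span k" shows "el {#0#} * x \<in> grouplike_span k"
proof -
  have "(1 + el {#0#}) * grouplike k \<alpha> b \<in> grouplike_span k" for \<alpha> b
  proof -
    have "(1 + el {#0#}) * grouplike k \<alpha> b = grouplike k \<alpha> (Suc b)" by (simp add: grouplike_def mult_ac)
    then show ?thesis unfolding grouplike_span_def by (auto intro: aspan_incl)
  qed
  from grouplike_span_add[OF grouplike_span_mult[OF this assms] assms] show ?thesis by (simp add: distrib_right add_ac)
qed

lemma grouplike_span_el: assumes "m \<le> 2 ^ k" "x \<in> grouplike_span k" shows "el {#m#} * x \<in> grouplike_span k"
proof (cases "m = 0")
  case True then show ?thesis using grouplike_span_el0 assms by simp
next
  case False
  have d: "downset_sum r f * x \<in> grouplike_span k" if "\<And>q. length q = length r \<Longrightarrow> f q * x \<in> grouplike_span k" for r f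
    using that
  proof (induction r arbitrary: f)
    case (Cons b r)
    have "downset_sum r (\<lambda>q. f (c # q)) * x \<in> grouplike_span k" for c by (rule Cons.IH) (simp add: Cons.prems)
    then show ?case by (cases b) (simp_all add: distrib_right grouplike_span_add)
  qed simp
  define r where "r = unval k (m - 1)"
  have "val r = m - 1" unfolding r_def using assms False by (intro val_unval) auto
  then have "el {#m#} = basis_form r" using False by (simp add: basis_form_def)
  also have "\<dots> = downset_sum r vertex_form" using downset_sum_downset_sum[of r basis_form] unfolding vertex_form_def[abs_def] by simp
  finally show ?thesis using d[of r vertex_form] grouplike_span_vertex_form assms by (simp add: r_def)
qed

lemma el_grouplike_span: "set_mset P \<subseteq> {..2 ^ k} \<Longrightarrow> el P \<in> grouplike_span k"
proof (induction P)
  case empty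
  have "grouplike k (\<lambda>_. 0) 0 = el {#}" by (simp add: grouplike_def flip: zero_multiset_def)
  then show ?case unfolding grouplike_span_def by (intro aspan_incl) (metis (mono_tags, lifting) mem_Collect_eq)
next
  case (add m P)
  have "el (add_mset m P) = el {#m#} * el P" by (simp flip: el_add)
  then show ?case using grouplike_span_el[of m k "el P"] add by simp
qed

lemma cocycle_ext_surj: assumes "set_mset P \<subseteq> {..2 ^ k}" shows "\<exists>f. cocycle_ext k f + el P \<in> weight_ideal (2 ^ k)"
proof -
  have "el P \<in> aspan {grouplike k \<alpha> b | \<alpha> b. True}" using el_grouplike_span[OF assms] by (simp only: grouplike_span_def)
  then show ?thesis
  proof induction
    case zero then show ?case by (intro exI[of _ 0]) (simp add: cocycle_ext_zero)
  next
    case (step x s)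
    then obtain f \<alpha> b where f: "cocycle_ext k f + x \<in> weight_ideal (2 ^ k)" "s = grouplike k \<alpha> b" by blast
    obtain g where g: "cocycle k g + s \<in> weight_ideal (2 ^ k)" using ex_cocycle f(2) by blast
    have "cocycle_ext k (f + el g) + (x + s) = (cocycle_ext k f + x) + (cocycle k g + s)" by (simp add: cocycle_ext_add cocycle_ext_el add_ac)
    then have "cocycle_ext k (f + el g) + (x + s) \<in> weight_ideal (2 ^ k)" using weight_ideal_add[OF f(1) g] by (simp only:)
    then show ?case by blast
  qed
qed

section \<open>Independence of the ordered monomials\<close>

text \<open>\<open>cocycle_ext\<close> maps the group algebra onto a space with as many elements as there are subsets of
  the spanning set of monomials; hence the monomials are independent.\<close>

theorem mon_independent:
  assumes n: "n < 2 ^ k" and D: "D \<subseteq> weight_le n" "(\<Sum>P\<in>D. mon k P) \<in> aug_pow (Suc n)"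
  shows "D = {}"
proof -
  \<comment> \<open>\<open>T D\<close> records the image modulo weight \<open>n + 1\<close>, where a
    polynomial is determined by its support in \<open>weight_le n\<close>.\<close>
  define T where "T D = Poly_Mapping.keys (cocycle_ext k (\<Sum>P\<in>D. mon k P)) \<inter> weight_le n" for D
  have aug_pow_weight_ideal: "cocycle_ext k a \<in> weight_ideal (Suc n)" if "a \<in> aug_pow (Suc n)" for a
  proof -
    have "cocycle_ext k (a * 1) \<in> weight_ideal (0 + Suc n)" using n by (intro cocycle_ext_aug_pow[OF that]) simp_all
    then show ?thesis by simp
  qed
  have keys_weight_ideal: "P \<in> Poly_Mapping.keys x \<longleftrightarrow> P \<in> Poly_Mapping.keys y" if "x + y \<in> weight_ideal (Suc n)" "P \<in> weight_le n" for x y :: wpoly and P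
  proof -
    have "P \<notin> Poly_Mapping.keys (x + y)" using that by (auto simp: weight_ideal_def weight_le_def)
    then show ?thesis by (auto simp: keys_add_bit)
  qed
  have "T ` Pow (weight_le n) = Pow (weight_le n)"
  proof
    show "T ` Pow (weight_le n) \<subseteq> Pow (weight_le n)" by (auto simp: T_def)
    show "Pow (weight_le n) \<subseteq> T ` Pow (weight_le n)"
    proof
      fix E assume "E \<in> Pow (weight_le n)"
      then have E: "E \<subseteq> weight_le n" "finite E" using finite_weight_le finite_subset by auto
      have "\<exists>f. cocycle_ext k f + (\<Sum>P\<in>E. el P) \<in> weight_ideal (2 ^ k)" using E(2,1)
      proof (induction E)
        case empty show ?case by (intro exI[of _ 0]) (simp add: cocycle_ext_zero)
      next
        case (insert P E)
        then obtain f where f: "cocycle_ext k f + (\<Sum>P\<in>E. el P) \<in> weight_ideal (2 ^ k)" by auto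
        have "set_mset P \<subseteq> {..2 ^ k}" using weight_le_set_mset[of n k P] insert.prems n by force
        from cocycle_ext_surj[OF this] obtain g where g: "cocycle_ext k g + el P \<in> weight_ideal (2 ^ k)" by blast
        have "cocycle_ext k (f + g) + (\<Sum>P\<in>insert P E. el P) = (cocycle_ext k f + (\<Sum>P\<in>E. el P)) + (cocycle_ext k g + el P)"
          using insert.hyps by (simp add: cocycle_ext_add add_ac)
        then have "cocycle_ext k (f + g) + (\<Sum>P\<in>insert P E. el P) \<in> weight_ideal (2 ^ k)" using weight_ideal_add[OF f g] by (simp only:)
        then show ?case by blast
      qed
      then obtain f where f: "cocycle_ext k f + (\<Sum>P\<in>E. el P) \<in> weight_ideal (2 ^ k)" by blast
      have f': "cocycle_ext k f + (\<Sum>P\<in>E. el P) \<in> weight_ideal (Suc n)" by (rule weight_ideal_antimono[OF _ f]) (use n in simp)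
      obtain D where D: "D \<subseteq> weight_le n" "f + (\<Sum>P\<in>D. mon k P) \<in> aug_pow (Suc n)"
        using mon_span[of n k f] n by auto
      have "cocycle_ext k f + cocycle_ext k (\<Sum>P\<in>D. mon k P) \<in> weight_ideal (Suc n)" using aug_pow_weight_ideal[OF D(2)] by (simp only: cocycle_ext_add)
      then have "cocycle_ext k (\<Sum>P\<in>D. mon k P) + cocycle_ext k f \<in> weight_ideal (Suc n)" by (subst add.commute)
      from weight_ideal_cong_trans[OF this f'] have "cocycle_ext k (\<Sum>P\<in>D. mon k P) + (\<Sum>P\<in>E. el P) \<in> weight_ideal (Suc n)" .
      from keys_weight_ideal[OF this] have "T D = E" using E by (auto simp: T_def keys_el_sum)
      then show "E \<in> T ` Pow (weight_le n)" using D(1) by blast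
    qed
  qed
  then have inj: "inj_on T (Pow (weight_le n))" using finite_weight_le by (simp add: eq_card_imp_inj_on)
  have "P \<notin> Poly_Mapping.keys (cocycle_ext k (\<Sum>P\<in>D. mon k P))" if "P \<in> weight_le n" for P
    using aug_pow_weight_ideal[OF D(2)] that by (auto simp: weight_ideal_def weight_le_def)
  then have "T D = T {}" by (auto simp: T_def cocycle_ext_zero)
  then show ?thesis using inj D(1) by (auto dest: inj_onD)
qed

section \<open>Layers of the 2-dimension series\<close>

lemma wt_neq_0 [simp]: "wt m \<noteq> 0" by (simp add: wt_def)

text \<open>The generators having a 2-power of weight exactly \<open>n\<close>; these powers will
  form a basis of the layer. Number 0 counts with weight 1 here, which causes the extra rank at
  powers of 2.\<close>

definition layer_index :: "nat \<Rightarrow> nat set" where "layer_index n = {m. \<exists>j. wt m * 2 ^ j = n}"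

lemma layer_index_D: "m \<in> layer_index n \<Longrightarrow> \<exists>j. n div wt m = 2 ^ j \<and> wt m * 2 ^ j = n"
proof -
  assume "m \<in> layer_index n"
  then obtain j where j: "wt m * 2 ^ j = n" by (auto simp: layer_index_def)
  moreover have "n div wt m = 2 ^ j" unfolding j[symmetric] by (simp only: nonzero_mult_div_cancel_left[OF gr_implies_not0[OF wt_pos]])
  ultimately show ?thesis by blast
qed

lemma layer_index_le: "m \<in> layer_index n \<Longrightarrow> m \<le> n"
proof -
  assume "m \<in> layer_index n"
  then obtain j where "wt m * 2 ^ j = n" by (auto simp: layer_index_def)
  then have "wt m \<le> n" using mult_le_mono2[of 1 "2 ^ j" "wt m"] by simp
  then show ?thesis using le_wt[of m] by linarith
qed

lemma finite_layer_index: "finite (layer_index n)"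
  by (rule finite_subset[of _ "{..n}"]) (auto dest: layer_index_le)

definition layer_elem :: "nat \<Rightarrow> nat \<Rightarrow> bsv" where "layer_elem n m = npow (n div wt m) (pc_gen m)"

lemma layer_elem_dimser: "m \<in> layer_index n \<Longrightarrow> layer_elem n m \<in> dimser n"
proof -
  assume "m \<in> layer_index n"
  then obtain j where j: "n div wt m = 2 ^ j" "wt m * 2 ^ j = n" using layer_index_D by blast
  have "npow (2 ^ j) (pc_gen m) \<in> dimser (2 ^ j * wt m)" by (rule npow_two_in_dimser[OF pc_gen_dimser])
  then show ?thesis using j by (simp add: layer_elem_def mult.commute)
qed

text \<open>Absent factors are kept as 0 along the full list of generators, so that the product can
  be compared with a normal form factor by factor.\<close>

definition layer_prod :: "nat \<Rightarrow> nat \<Rightarrow> nat set \<Rightarrow> bsv" where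
  "layer_prod k n E = sum_list (map (\<lambda>m. if m \<in> E then layer_elem n m else 0) [0..<2 ^ k + 1])"

lemma sum_list_in: "subgrp H \<Longrightarrow> (\<And>x. x \<in> set xs \<Longrightarrow> x \<in> H) \<Longrightarrow> sum_list xs \<in> H"
  by (induction xs) (auto dest: subgrpD)

lemma layer_prod_dimser: "E \<subseteq> layer_index n \<Longrightarrow> layer_prod k n E \<in> dimser n"
  unfolding layer_prod_def by (rule sum_list_in[OF subgrp_dimser]) (auto simp: dimserD(1) intro: layer_elem_dimser simp del: upt_Suc)

lemma el_cong: "- x + y \<in> dimser n \<Longrightarrow> el x + el y \<in> aug_pow n"
proof -
  assume "- x + y \<in> dimser n"
  then have "el x * (el (- x + y) + 1) \<in> aug_pow n" by (intro aug_pow_mult_left dimser_aug_pow)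
  moreover have "el x * el (- x + y) = el y" by (simp only: el_add[symmetric] add_minus_cancel)
  ultimately show ?thesis by (simp only: distrib_left mult_1_right add.commute[of "el x"])
qed

lemma el_sum_list:
  assumes "n > 0" "\<And>x. x \<in> set xs \<Longrightarrow> x \<in> dimser n"
  shows "(el (sum_list xs) + 1) + sum_list (map (\<lambda>x. el x + 1) xs) \<in> aug_pow (Suc n)"
  using assms(2)
proof (induction xs)
  case Nil then show ?case by simp
next
  case (Cons x xs)
  let ?s = "sum_list xs" and ?S = "sum_list (map (\<lambda>x. el x + 1) xs)"
  have "?s \<in> dimser n" using Cons.prems by (intro sum_list_in[OF subgrp_dimser]) simp
  from el_additive[OF _ this assms(1), of x] have 1: "(el (x + ?s) + 1) + ((el x + 1) + (el ?s + 1)) \<in> aug_pow (Suc n)"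
    using Cons.prems by simp
  have 2: "(el ?s + 1) + ?S \<in> aug_pow (Suc n)" using Cons by simp
  have "(el (sum_list (x # xs)) + 1) + sum_list (map (\<lambda>x. el x + 1) (x # xs))
    = ((el (x + ?s) + 1) + ((el x + 1) + (el ?s + 1))) + ((el ?s + 1) + ?S)"
    by (simp add: add_ac)
  then show ?case using aug_pow_add[OF 1 2] by (simp only:)
qed

lemma el_npow: "el (npow i g) = el g ^ i"
  by (induction i) (simp_all add: el_add)

lemma add_one_pow_two: "(x + 1) ^ 2 ^ j = (x :: 'g::group_add \<Rightarrow>\<^sub>0 bit) ^ 2 ^ j + 1"
proof (induction j)
  case (Suc j)
  have "(x + 1) ^ 2 ^ Suc j = (x ^ 2 ^ j + 1) * (x ^ 2 ^ j + 1)"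
    by (simp only: power_Suc mult_2 power_add Suc)
  also have "\<dots> = x ^ 2 ^ j * x ^ 2 ^ j + 1" by (simp add: algebra_simps)
  also have "x ^ 2 ^ j * x ^ 2 ^ j = x ^ 2 ^ Suc j" by (simp only: power_Suc mult_2 power_add)
  finally show ?case .
qed simp

lemma weight_replicate: "weight (replicate_mset j m) = j * wt m"
  by (induction j) simp_all

lemma mon_replicate:
  assumes "m \<le> 2 ^ k" shows "list_mon [0..<2 ^ k + 1] (replicate_mset i m) = pc_diff m ^ i"
proof -
  have "prod_list (map (\<lambda>x. pc_diff x ^ count (replicate_mset i m) x) ms)
    = (if m \<in> set ms then pc_diff m ^ i else 1)" if "distinct ms" for ms
    using that by (induction ms) auto
  from this[of "[0..<2 ^ k + 1]"] show ?thesis using assms by (simp add: list_mon_def le_imp_less_Suc del: upt_Suc)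
qed

text \<open>For a 2-power q one has g^q - 1 = (g - 1)^q, so each factor corresponds to a monomial of
  weight n in a single generator; additivity in the layer turns the product into the sum of these
  monomials.\<close>

lemma layer_prod_el:
  assumes "0 < n" "n < 2 ^ k" "E \<subseteq> layer_index n"
  shows "(el (layer_prod k n E) + 1) + (\<Sum>m\<in>E. mon k (replicate_mset (n div wt m) m)) \<in> aug_pow (Suc n)"
proof -
  have eq: "el (layer_elem n m) + 1 = mon k (replicate_mset (n div wt m) m)" if "m \<in> E" for m
  proof -
    have m: "m \<in> layer_index n" "m \<le> 2 ^ k" using that assms layer_index_le[of m n] by auto
    then obtain j where "n div wt m = 2 ^ j" using layer_index_D by blast
    then show ?thesis using m mon_replicate[OF m(2)] by (simp only: layer_elem_def el_npow add_one_pow_two[symmetric])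
  qed
  have "sum_list (map (\<lambda>x. el x + 1) (map (\<lambda>m. if m \<in> E then layer_elem n m else 0) [0..<2 ^ k + 1]))
    = sum_list (map (\<lambda>m. if m \<in> E then el (layer_elem n m) + 1 else 0) [0..<2 ^ k + 1])"
    unfolding map_map by (intro arg_cong[where f = sum_list] map_cong) auto
  also have "\<dots> = (\<Sum>m\<in>set [0..<2 ^ k + 1]. if m \<in> E then el (layer_elem n m) + 1 else 0)"
    by (rule sum_list_distinct_conv_sum_set) simp
  also have "\<dots> = (\<Sum>m\<in>set [0..<2 ^ k + 1] \<inter> E. el (layer_elem n m) + 1)"
    by (rule sum.inter_restrict[symmetric]) simp
  also have "set [0..<2 ^ k + 1] \<inter> E = E" using assms layer_index_le by fastforce
  also have "(\<Sum>m\<in>E. el (layer_elem n m) + 1) = (\<Sum>m\<in>E. mon k (replicate_mset (n div wt m) m))"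
    by (rule sum.cong[OF refl eq])
  finally have s: "sum_list (map (\<lambda>x. el x + 1) (map (\<lambda>m. if m \<in> E then layer_elem n m else 0) [0..<2 ^ k + 1]))
    = (\<Sum>m\<in>E. mon k (replicate_mset (n div wt m) m))" .
  have mem: "x \<in> dimser n" if "x \<in> set (map (\<lambda>m. if m \<in> E then layer_elem n m else 0) [0..<2 ^ k + 1])" for x
    using that assms(3) by (auto simp: dimserD(1) intro: layer_elem_dimser simp del: upt_Suc)
  show ?thesis
    using el_sum_list[OF assms(1), of "map (\<lambda>m. if m \<in> E then layer_elem n m else 0) [0..<2 ^ k + 1]", OF mem]
    unfolding s layer_prod_def[symmetric] by blast
qed

lemma sum_add_self_sym_diff:
  fixes f :: "'i \<Rightarrow> 'k \<Rightarrow>\<^sub>0 bit"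
  assumes "finite E" "finite F"
  shows "sum f E + sum f F = sum f ((E - F) \<union> (F - E))"
proof -
  have "sum f E = sum f (E - F) + sum f (E \<inter> F)" "sum f F = sum f (F - E) + sum f (E \<inter> F)"
    using assms by (subst sum.union_disjoint[symmetric]; auto intro!: sum.cong)+
  moreover have "sum f ((E - F) \<union> (F - E)) = sum f (E - F) + sum f (F - E)"
    using assms by (intro sum.union_disjoint) auto
  ultimately show ?thesis by (simp add: add_ac)
qed

lemma mon_sum_eq:
  assumes "n < 2 ^ k" "E \<subseteq> weight_le n" "F \<subseteq> weight_le n" "sum (mon k) E + sum (mon k) F \<in> aug_pow (Suc n)"
  shows "E = F"
proof -
  have fin: "finite E" "finite F" using assms finite_weight_le finite_subset by blast+
  have "(E - F) \<union> (F - E) = {}"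
    by (rule mon_independent[OF assms(1)]) (use assms sum_add_self_sym_diff[OF fin, of "mon k"] in auto)
  then show ?thesis by auto
qed

lemma layer_prod_inj:
  assumes n: "0 < n" "n < 2 ^ k" and E: "E \<subseteq> layer_index n" "F \<subseteq> layer_index n"
    and eq: "- layer_prod k n E + layer_prod k n F \<in> dimser (Suc n)"
  shows "E = F"
proof -
  let ?r = "\<lambda>m. replicate_mset (n div wt m) m"
  have inj: "inj_on ?r (layer_index n)"
  proof (rule inj_onI)
    fix m m' assume "m \<in> layer_index n" "m' \<in> layer_index n" "?r m = ?r m'"
    moreover from this have "n div wt m > 0" using layer_index_D by fastforce
    ultimately show "m = m'" by (metis in_replicate_mset)
  qed
  have s: "(\<Sum>m\<in>X. mon k (?r m)) = sum (mon k) (?r ` X)" if "X \<subseteq> layer_index n" for X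
    using inj_on_subset[OF inj that] by (simp add: sum.reindex)
  have c: "?r ` X \<subseteq> weight_le n" if "X \<subseteq> layer_index n" for X
    using that layer_index_D by (fastforce simp: weight_le_def weight_replicate mult.commute)
  have 1: "(el (layer_prod k n E) + 1) + sum (mon k) (?r ` E) \<in> aug_pow (Suc n)"
    and 2: "(el (layer_prod k n F) + 1) + sum (mon k) (?r ` F) \<in> aug_pow (Suc n)"
    using layer_prod_el[OF n] E s by simp_all
  have 3: "el (layer_prod k n E) + el (layer_prod k n F) \<in> aug_pow (Suc n)" by (rule el_cong[OF eq])
  have "sum (mon k) (?r ` E) + sum (mon k) (?r ` F) =
    ((el (layer_prod k n E) + 1) + sum (mon k) (?r ` E)) + (((el (layer_prod k n F) + 1) + sum (mon k) (?r ` F))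
     + (el (layer_prod k n E) + el (layer_prod k n F)))" by (simp add: add_ac)
  then have "sum (mon k) (?r ` E) + sum (mon k) (?r ` F) \<in> aug_pow (Suc n)"
    using aug_pow_add[OF 1 aug_pow_add[OF 2 3]] by (simp only:)
  then have "?r ` E = ?r ` F" by (rule mon_sum_eq[OF n(2) c[OF E(1)] c[OF E(2)]])
  then show ?thesis using inj E by (simp add: inj_on_image_eq_iff)
qed

section \<open>Coordinates of a normal form in a layer\<close>

definition cong_mod :: "'g::group_add set \<Rightarrow> 'g \<Rightarrow> 'g \<Rightarrow> bool" where "cong_mod K x y \<longleftrightarrow> - x + y \<in> K"

lemma cong_mod_add: assumes "nsubgrp K" "cong_mod K x y" "cong_mod K x' y'" shows "cong_mod K (x + x') (y + y')"
proof -
  have "- (x + x') + (y + y') = (- x' + (- x + y) + x') + (- x' + y')" by (simp only: grp_norm)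
  then show ?thesis using assms nrmD(2) subgrpD(2)[OF nrmD(1)] unfolding cong_mod_def by metis
qed

lemma cong_mod_sum_list:
  assumes "nsubgrp K" "\<And>m. m \<in> set ms \<Longrightarrow> cong_mod K (f m) (g m)"
  shows "cong_mod K (sum_list (map f ms)) (sum_list (map g ms))"
  using assms(2)
proof (induction ms)
  case Nil then show ?case using subgrpD(1)[OF nrmD(1)[OF assms(1)]] by (simp add: cong_mod_def)
next
  case (Cons m ms) then show ?case using cong_mod_add[OF assms(1)] by simp
qed

text \<open>For n > 0 this says that e is a multiple of the least 2^j with
  \<open>n \<le> wt m * 2 ^ j\<close>, so that the e-th power of the generator lies in
  \<open>dimser n\<close>. The condition is vacuous as long as \<open>n \<le> wt m\<close>.\<close>

definition dyadic_dvd :: "nat \<Rightarrow> nat \<Rightarrow> nat \<Rightarrow> bool" where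
  "dyadic_dvd n m e \<longleftrightarrow> (\<forall>j. wt m * 2 ^ j < n \<longrightarrow> 2 ^ Suc j dvd e)"

lemma dyadic_dvd_cases:
  assumes "0 < n" "dyadic_dvd n m e"
  obtains f j where "e = 2 ^ j * f" "n \<le> wt m * 2 ^ j" "m \<in> layer_index n \<Longrightarrow> wt m * 2 ^ j = n"
proof -
  define j where "j = (LEAST j. n \<le> wt m * 2 ^ j)"
  have ex: "\<exists>j. n \<le> wt m * 2 ^ j"
  proof
    have "n < 2 ^ n" by (rule less_exp)
    also have "(2::nat) ^ n \<le> wt m * 2 ^ n" using wt_pos[of m] by (metis One_nat_def Suc_leI mult_le_mono1 mult_1)
    finally show "n \<le> wt m * 2 ^ n" by simp
  qed
  have j: "n \<le> wt m * 2 ^ j" unfolding j_def using ex by (rule LeastI_ex)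
  have min: "wt m * 2 ^ i < n" if "i < j" for i
    using not_less_Least[of i "\<lambda>j. n \<le> wt m * 2 ^ j"] that unfolding j_def by simp
  have dvd: "2 ^ j dvd e"
  proof (cases j)
    case (Suc i) then show ?thesis using min[of i] assms(2) by (auto simp: dyadic_dvd_def)
  qed simp
  have "wt m * 2 ^ j = n" if m: "m \<in> layer_index n"
  proof -
    have "\<exists>i. wt m * 2 ^ i = n" using m by (simp add: layer_index_def)
    then obtain i where i: "wt m * 2 ^ i = n" by blast
    then have "j \<le> i" unfolding j_def by (intro Least_le) simp
    then have "wt m * 2 ^ j \<le> wt m * 2 ^ i" by simp
    then show ?thesis using i j by simp
  qed
  then show thesis using that dvd j by (auto simp: dvd_def)
qed

text \<open>The coordinates modulo \<open>dimser (Suc n)\<close> of a normal form whose exponents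
  all satisfy \<open>dyadic_dvd n\<close>: only parities count, since squares of layer elements lie
  deeper.\<close>

definition odd_set :: "nat \<Rightarrow> (nat \<Rightarrow> nat) \<Rightarrow> nat set" where
  "odd_set n e = {m \<in> layer_index n. odd (e m div (n div wt m))}"

lemma npow_cong_mod:
  assumes n: "0 < n" and D: "dyadic_dvd n m e"
  shows "cong_mod (dimser (Suc n)) (if m \<in> layer_index n \<and> odd (e div (n div wt m)) then layer_elem n m else 0) (npow e (pc_gen m))"
proof -
  obtain f j where f: "e = 2 ^ j * f" "n \<le> wt m * 2 ^ j" "m \<in> layer_index n \<Longrightarrow> wt m * 2 ^ j = n"
    using dyadic_dvd_cases[OF n D] by metis
  have b: "npow (2 ^ j) (pc_gen m) \<in> dimser (wt m * 2 ^ j)"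
    using npow_two_in_dimser[OF pc_gen_dimser, of j m] by (simp add: mult.commute)
  have e: "npow e (pc_gen m) = npow f (npow (2 ^ j) (pc_gen m))" using npow_mult[of f "2 ^ j" "pc_gen m"] f(1) by (simp add: mult.commute)
  show ?thesis
  proof (cases "m \<in> layer_index n")
    case True
    then have w: "wt m * 2 ^ j = n" "n div wt m = 2 ^ j"
      using f(3) layer_index_D[OF True] by (auto simp: nonzero_mult_div_cancel_left)
    have layer_elem: "npow (2 ^ j) (pc_gen m) = layer_elem n m" by (simp only: layer_elem_def w(2))
    have dd: "npow (2 * i) (layer_elem n m) \<in> dimser (Suc n)" for i
    proof -
      have "layer_elem n m + layer_elem n m \<in> dimser (2 * n)" using double_in_dimser[OF layer_elem_dimser[OF True]] .
      then have "npow 2 (layer_elem n m) \<in> dimser (Suc n)"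
        using dimser_antimono[of "Suc n" "2 * n"] n by (auto simp: numeral_2_eq_2)
      from npow_in[OF subgrp_dimser this, of i] show ?thesis by (simp only: npow_mult[symmetric] mult.commute)
    qed
    have ef: "e div (n div wt m) = f" using f(1) w(2) by simp
    show ?thesis
    proof (cases "odd f")
      case odd: True
      then obtain i where i: "f = 2 * i + 1" by (rule oddE)
      have "- layer_elem n m + npow f (layer_elem n m) = npow (2 * i) (layer_elem n m)"
        by (simp only: i add.commute[of "2 * i"] npow_add npow_one minus_add_cancel)
      then show ?thesis using dd True odd unfolding cong_mod_def e layer_elem ef by simp
    next
      case False
      then obtain i where "f = 2 * i" by auto
      then show ?thesis using dd False unfolding cong_mod_def e layer_elem ef by simp
    qed
  next
    case False
    then have "Suc n \<le> wt m * 2 ^ j" using f(2) unfolding layer_index_def by (metis (mono_tags, lifting) Suc_leI le_neq_implies_less mem_Collect_eq)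
    then have "npow (2 ^ j) (pc_gen m) \<in> dimser (Suc n)" using b dimser_antimono by blast
    from npow_in[OF subgrp_dimser this, of f] show ?thesis using False e by (simp add: cong_mod_def)
  qed
qed

lemma nf_cong_mod:
  assumes n: "0 < n" and D: "\<And>m. dyadic_dvd n m (e m)" and y: "y \<in> dimser (Suc n)"
  shows "cong_mod (dimser (Suc n)) (layer_prod k n (odd_set n e))
    (sum_list (map (\<lambda>m. npow (e m) (pc_gen m)) [0..<2 ^ k + 1]) + y)"
proof -
  have 1: "cong_mod (dimser (Suc n)) (layer_prod k n (odd_set n e)) (sum_list (map (\<lambda>m. npow (e m) (pc_gen m)) [0..<2 ^ k + 1]))"
    unfolding layer_prod_def
  proof (rule cong_mod_sum_list[OF nsubgrp_dimser])
    fix m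
    show "cong_mod (dimser (Suc n)) (if m \<in> odd_set n e then layer_elem n m else 0) (npow (e m) (pc_gen m))"
      using npow_cong_mod[OF n D[of m]] by (simp add: odd_set_def)
  qed
  have "cong_mod (dimser (Suc n)) 0 y" using y by (simp add: cong_mod_def)
  from cong_mod_add[OF nsubgrp_dimser 1 this] show ?thesis by simp
qed

lemma odd_set_layer_index: "odd_set n e \<subseteq> layer_index n" by (auto simp: odd_set_def)

lemma dyadic_dvd_Suc:
  assumes n: "0 < n" and D: "dyadic_dvd n m e" and even: "m \<in> layer_index n \<Longrightarrow> even (e div (n div wt m))"
  shows "dyadic_dvd (Suc n) m e"
  unfolding dyadic_dvd_def
proof (intro allI impI)
  fix j assume "wt m * 2 ^ j < Suc n"
  then consider "wt m * 2 ^ j < n" | "wt m * 2 ^ j = n" by linarith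
  then show "2 ^ Suc j dvd e"
  proof cases
    case 1 then show ?thesis using D by (simp add: dyadic_dvd_def)
  next
    case 2
    then have m: "m \<in> layer_index n" by (auto simp: layer_index_def)
    obtain f i where f: "e = 2 ^ i * f" "wt m * 2 ^ i = n" using dyadic_dvd_cases[OF n D] m by metis
    then have "wt m * 2 ^ i = wt m * 2 ^ j" using 2 by simp
    then have "i = j" using wt_pos[of m] by simp
    moreover have "n div wt m = 2 ^ i" using f(2) wt_pos[of m] by (metis gr_implies_not0 nonzero_mult_div_cancel_left)
    ultimately have "even f" using even[OF m] f(1) by simp
    then show ?thesis using f(1) \<open>i = j\<close> by (auto simp: dvd_def)
  qed
qed

text \<open>A normal form of \<open>h\<close> a priori has arbitrary exponents. For N < n the
  element lies in \<open>dimser (Suc N)\<close>, so its coordinates in layer N agree with those of 0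
  and vanish by \<open>layer_prod_inj\<close>; each such N doubles the divisibility of the exponents
  concerned. Thus injectivity in the earlier layers yields surjectivity in layer n.\<close>

lemma layer_prod_surj:
  assumes n: "0 < n" "n < 2 ^ k" and h: "h \<in> dimser n"
  shows "\<exists>E\<subseteq>layer_index n. - layer_prod k n E + h \<in> dimser (Suc n)"
proof -
  obtain e y where y: "y \<in> dimser (Suc n)"
    "h = sum_list (map (\<lambda>m. npow (e m) (pc_gen m)) [0..<2 ^ k + 1]) + y"
    using normal_form[of "Suc n" k h] n by auto
  define e' where "e' m = (if m \<le> 2 ^ k then e m else 0)" for m
  have h': "h = sum_list (map (\<lambda>m. npow (e' m) (pc_gen m)) [0..<2 ^ k + 1]) + y"
    unfolding y(2) by (intro arg_cong2[where f = "(+)"] arg_cong[where f = sum_list] map_cong) (auto simp: e'_def)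
  have "\<forall>m. dyadic_dvd N m (e' m)" if "N \<le> n" "0 < N" for N
    using that
  proof (induction N)
    case (Suc N)
    show ?case
    proof (cases "N = 0")
      case True then show ?thesis by (auto simp: dyadic_dvd_def)
    next
      case False
      then have N: "0 < N" "N < 2 ^ k" and D: "\<And>m. dyadic_dvd N m (e' m)" using Suc n by auto
      have y': "y \<in> dimser (Suc N)" using y(1) dimser_antimono[of "Suc N" "Suc n"] Suc.prems by auto
      have "- layer_prod k N (odd_set N e') + h \<in> dimser (Suc N)"
        using nf_cong_mod[OF N(1) D y', of k] unfolding cong_mod_def h'[symmetric] .
      moreover have "h \<in> dimser (Suc N)" using h dimser_antimono[of "Suc N" n] Suc.prems by auto
      ultimately have "- layer_prod k N (odd_set N e') \<in> dimser (Suc N)" by (simp only: subgrp_cancel[OF subgrp_dimser])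
      moreover have "sum_list (replicate i 0) = (0 :: bsv)" for i by (induction i) simp_all
      then have "layer_prod k N {} = 0" by (simp add: layer_prod_def map_replicate_const del: upt_Suc)
      ultimately have "- layer_prod k N (odd_set N e') + layer_prod k N {} \<in> dimser (Suc N)" by simp
      from layer_prod_inj[OF N odd_set_layer_index _ this] have "odd_set N e' = {}" by simp
      then have "even (e' m div (N div wt m))" if "m \<in> layer_index N" for m using that by (auto simp: odd_set_def)
      then show ?thesis using dyadic_dvd_Suc[OF N(1) D] by blast
    qed
  qed simp
  then have D: "\<And>m. dyadic_dvd n m (e' m)" using n by blast
  show ?thesis using nf_cong_mod[OF n(1) D y(1), of k] odd_set_layer_index unfolding cong_mod_def h'[symmetric] by blast
qed

section \<open>Vector spaces over the two-element field\<close>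

lemma F2_simps: "carrier F2 = {0, 1}" "\<zero>\<^bsub>F2\<^esub> = 0" "\<one>\<^bsub>F2\<^esub> = 1"
  "a \<oplus>\<^bsub>F2\<^esub> b = (a + b) mod 2" "a \<otimes>\<^bsub>F2\<^esub> b = (a * b) mod 2"
  by (auto simp: residue_ring_def)

lemma field_F2: "field F2"
proof -
  have "residues_prime 2" by unfold_locales simp_all
  from residues_prime.is_field[OF this] show ?thesis by simp
qed

lemma vectorspace_F2I:
  fixes Q :: "('v, 'b) monoid_scheme" and V :: "(int, 'v, 'd) module_scheme"
  assumes Q: "comm_group Q" "\<And>x. x \<in> carrier Q \<Longrightarrow> x \<otimes>\<^bsub>Q\<^esub> x = \<one>\<^bsub>Q\<^esub>"
    and V: "carrier V = carrier Q" "\<zero>\<^bsub>V\<^esub> = \<one>\<^bsub>Q\<^esub>" "\<And>x y. x \<oplus>\<^bsub>V\<^esub> y = x \<otimes>\<^bsub>Q\<^esub> y"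
      "\<And>x. x \<in> carrier Q \<Longrightarrow> 0 \<odot>\<^bsub>V\<^esub> x = \<one>\<^bsub>Q\<^esub>" "\<And>x. x \<in> carrier Q \<Longrightarrow> 1 \<odot>\<^bsub>V\<^esub> x = x"
  shows "vectorspace F2 V"
proof -
  interpret Q: comm_group Q by (rule Q(1))
  interpret F: field F2 by (rule field_F2)
  have "module F2 V"
  proof (rule moduleI)
    show "cring F2" by (rule F.is_cring)
    show "abelian_group V"
    proof (rule abelian_groupI)
      fix x assume "x \<in> carrier V"
      then show "\<exists>y\<in>carrier V. y \<oplus>\<^bsub>V\<^esub> x = \<zero>\<^bsub>V\<^esub>" using Q(2) by (auto simp: V)
    qed (auto simp: V Q.m_assoc intro: Q.m_comm)
  next
    fix a b x assume "a \<in> carrier F2" "b \<in> carrier F2" "x \<in> carrier V"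
    then have ab: "a = 0 \<or> a = 1" "b = 0 \<or> b = 1" and x: "x \<in> carrier Q" by (simp_all add: F2_simps(1) V(1))
    show "(a \<oplus>\<^bsub>F2\<^esub> b) \<odot>\<^bsub>V\<^esub> x = a \<odot>\<^bsub>V\<^esub> x \<oplus>\<^bsub>V\<^esub> b \<odot>\<^bsub>V\<^esub> x"
      using ab x by (elim disjE) (simp_all add: F2_simps V Q(2))
    show "(a \<otimes>\<^bsub>F2\<^esub> b) \<odot>\<^bsub>V\<^esub> x = a \<odot>\<^bsub>V\<^esub> (b \<odot>\<^bsub>V\<^esub> x)"
      using ab x by (elim disjE) (simp_all add: F2_simps V)
  qed (auto simp: F2_simps V)
  then show ?thesis using field_F2 by (simp add: vectorspace_def)
qed

lemma has_dim_F2_card: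
  fixes V :: "(int, 'b, 'd) module_scheme"
  assumes V: "vectorspace F2 V" and card: "card (carrier V) = 2 ^ d"
  shows "has_dim F2 V d"
proof -
  interpret V: vectorspace F2 V by (rule V)
  have fin: "finite (carrier V)" using card by (metis card.infinite power_eq_0_iff zero_neq_numeral)
  have "V.span (carrier V) = carrier V"
    using V.span_is_subset2[of "carrier V"] V.in_own_span[of "carrier V"] by auto
  then have fd: "V.fin_dim" using fin by (auto simp: V.fin_dim_def)
  then obtain B where B: "finite B" "V.basis B" using V.finite_basis_exists by blast
  then have BV: "B \<subseteq> carrier V" by (simp add: V.basis_def)
  let ?A = "B \<rightarrow>\<^sub>E carrier F2"
  have ex1: "\<exists>!a. a \<in> ?A \<and> V.lincomb a B = v" if "v \<in> carrier V" for v
    using B V.basis_criterion[OF B(1) BV] that by blast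
  have "bij_betw (\<lambda>a. V.lincomb a B) ?A (carrier V)"
  proof (rule bij_betwI')
    fix a assume "a \<in> ?A"
    then show "V.lincomb a B \<in> carrier V" by (intro V.lincomb_closed[OF BV]) auto
  next
    fix a b assume a: "a \<in> ?A" and b: "b \<in> ?A"
    have "V.lincomb a B \<in> carrier V" by (intro V.lincomb_closed[OF BV]) (use a in auto)
    have uniq: "\<exists>!x. P x \<Longrightarrow> P x \<Longrightarrow> P y \<Longrightarrow> x = y" for P and x y :: "'b \<Rightarrow> int" by blast
    show "V.lincomb a B = V.lincomb b B \<longleftrightarrow> a = b"
      using uniq[OF ex1[OF \<open>V.lincomb a B \<in> carrier V\<close>], of a b] a b by auto
  next
    fix v assume "v \<in> carrier V"
    from ex1[OF this] obtain a where "a \<in> ?A \<and> V.lincomb a B = v" by (rule ex1E)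
    then show "\<exists>a\<in>?A. v = V.lincomb a B" by (intro bexI[of _ a]) auto
  qed
  then have "card ?A = 2 ^ d" using card bij_betw_same_card by metis
  moreover have "card ?A = 2 ^ card B" using B(1) by (simp add: card_PiE F2_simps(1) numeral_2_eq_2)
  ultimately have "card B = d" by simp
  then show ?thesis using V fd V.dim_basis[OF B] by (simp add: has_dim_def)
qed

text \<open>Common frame for both kinds of layers: \<open>\<rho>\<close> carries \<open>D\<close>
  onto the carrier of \<open>H\<close>, and the representatives \<open>rep E\<close> put the cosets
  in bijection with the subsets of \<open>J\<close>, so the quotient has 2^|J| elements. The last
  assumption may use that the quotient is a group, because in \<open>power_module\<close> the scalar
  acts as a power.\<close>

lemma has_dim_quotient:
  fixes \<rho> :: "'g::group_add \<Rightarrow> 'v" and H :: "('v, 'b) monoid_scheme" and V :: "(int, 'v set, 'd) module_scheme"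
  assumes \<rho>: "inj \<rho>" "carrier H = \<rho> ` D" "\<And>x y. x \<in> D \<Longrightarrow> y \<in> D \<Longrightarrow> \<rho> x \<otimes>\<^bsub>H\<^esub> \<rho> y = \<rho> (x + y)" "\<one>\<^bsub>H\<^esub> = \<rho> 0"
    and D: "subgrp D" "subgrp K" "K \<subseteq> D" "\<And>x y. x \<in> D \<Longrightarrow> y \<in> D \<Longrightarrow> comm x y \<in> K" "\<And>x. x \<in> D \<Longrightarrow> x + x \<in> K"
    and J: "finite J" "\<And>E. E \<subseteq> J \<Longrightarrow> rep E \<in> D" "\<And>x. x \<in> D \<Longrightarrow> \<exists>E\<subseteq>J. - rep E + x \<in> K"
      "\<And>E F. E \<subseteq> J \<Longrightarrow> F \<subseteq> J \<Longrightarrow> - rep E + rep F \<in> K \<Longrightarrow> E = F"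
    and V: "carrier V = rcosets\<^bsub>H\<^esub> (\<rho> ` K)" "\<zero>\<^bsub>V\<^esub> = \<rho> ` K" "\<And>X Y. X \<oplus>\<^bsub>V\<^esub> Y = X <#>\<^bsub>H\<^esub> Y"
      "\<And>X. X \<in> rcosets\<^bsub>H\<^esub> (\<rho> ` K) \<Longrightarrow> 0 \<odot>\<^bsub>V\<^esub> X = \<rho> ` K"
      "\<And>X. X \<in> rcosets\<^bsub>H\<^esub> (\<rho> ` K) \<Longrightarrow> group (H Mod \<rho> ` K) \<Longrightarrow> 1 \<odot>\<^bsub>V\<^esub> X = X"
  shows "has_dim F2 V (card J)"
proof -
  note Dc = subgrpD[OF D(1)] and Kc = subgrpD[OF D(2)]
  have grp: "group H"
  proof (rule groupI)
    fix x assume "x \<in> carrier H"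
    then obtain u where u: "x = \<rho> u" "u \<in> D" by (auto simp: \<rho>(2))
    have "\<rho> (- u) \<otimes>\<^bsub>H\<^esub> x = \<one>\<^bsub>H\<^esub>" using u Dc by (simp add: \<rho>)
    then show "\<exists>y\<in>carrier H. y \<otimes>\<^bsub>H\<^esub> x = \<one>\<^bsub>H\<^esub>" using u Dc(3) by (auto simp: \<rho>(2))
  qed (use Dc in \<open>auto simp: \<rho>(2,3,4) add.assoc\<close>)
  interpret H: group H by (rule grp)
  have inv: "inv\<^bsub>H\<^esub> (\<rho> u) = \<rho> (- u)" if "u \<in> D" for u
    by (rule H.inv_equality) (use that Dc in \<open>auto simp: \<rho>(2,3,4)\<close>)
  have conj: "x + h + - x \<in> K" if "x \<in> D" "h \<in> K" for x h
  proof -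
    have "x + h + - x = h + comm h (- x)" using conj_eq_comm[of "- x" h] by (simp only: minus_minus)
    moreover have "comm h (- x) \<in> K" using D(3,4) that Dc(3) by blast
    ultimately show ?thesis using Kc(2) that by simp
  qed
  have nrmK: "\<rho> ` K \<lhd> H"
    unfolding H.normal_inv_iff
  proof (intro conjI ballI)
    show "subgroup (\<rho> ` K) H"
    proof (rule H.subgroupI)
      show "\<rho> ` K \<subseteq> carrier H" "\<rho> ` K \<noteq> {}" using D(3) Kc(1) by (auto simp: \<rho>(2))
      fix a assume "a \<in> \<rho> ` K"
      then show "inv\<^bsub>H\<^esub> a \<in> \<rho> ` K" using D(3) Kc(3) inv by auto
      fix b assume "b \<in> \<rho> ` K"
      with \<open>a \<in> \<rho> ` K\<close> show "a \<otimes>\<^bsub>H\<^esub> b \<in> \<rho> ` K" using D(3) Kc(2) by (auto simp: \<rho>(3) subset_iff)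
    qed
  next
    fix x h assume "x \<in> carrier H" "h \<in> \<rho> ` K"
    then obtain u k where u: "x = \<rho> u" "u \<in> D" "h = \<rho> k" "k \<in> K" by (auto simp: \<rho>(2))
    then have "k \<in> D" using D(3) by blast
    have "x \<otimes>\<^bsub>H\<^esub> h \<otimes>\<^bsub>H\<^esub> inv\<^bsub>H\<^esub> x = \<rho> (u + k + - u)"
      using u \<open>k \<in> D\<close> Dc by (simp add: inv \<rho>(3) del: add_uminus_conv_diff)
    then show "x \<otimes>\<^bsub>H\<^esub> h \<otimes>\<^bsub>H\<^esub> inv\<^bsub>H\<^esub> x \<in> \<rho> ` K" using conj u by simp
  qed
  interpret N: normal "\<rho> ` K" H by (rule nrmK)
  define co where "co u = (\<rho> ` K) #>\<^bsub>H\<^esub> (\<rho> u)" for u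
  have co: "co u = (\<lambda>h. \<rho> (h + u)) ` K" if "u \<in> D" for u
    using that D(3) by (force simp: co_def r_coset_def \<rho>(3) subset_iff)
  have rc: "rcosets\<^bsub>H\<^esub> (\<rho> ` K) = co ` D" by (auto simp: RCOSETS_def co_def \<rho>(2))
  have co_eq: "co u = co v \<longleftrightarrow> - u + v \<in> K" if u: "u \<in> D" and v: "v \<in> D" for u v
  proof
    assume "co u = co v"
    moreover have "\<rho> v \<in> co v" using Kc(1) by (force simp: co[OF v])
    ultimately obtain h where "h \<in> K" "\<rho> v = \<rho> (h + u)" by (auto simp: co[OF u])
    then have "v = h + u" using \<rho>(1) by (simp add: inj_eq)
    then have "- u + v = - u + h + - (- u)" by (simp only: grp_norm)
    then show "- u + v \<in> K" using conj[OF Dc(3)[OF u] \<open>h \<in> K\<close>] by simp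
  next
    assume k: "- u + v \<in> K"
    have "u + (- u + v) + - u \<in> K" by (rule conj[OF u k])
    then have vu: "v + - u \<in> K" by (simp only: grp_norm)
    have "(\<lambda>h. \<rho> (h + u)) ` K = (\<lambda>h. \<rho> (h + v)) ` K"
    proof
      show "(\<lambda>h. \<rho> (h + v)) ` K \<subseteq> (\<lambda>h. \<rho> (h + u)) ` K"
      proof
        fix z assume "z \<in> (\<lambda>h. \<rho> (h + v)) ` K"
        then obtain h where h: "h \<in> K" "z = \<rho> (h + v)" by blast
        have "z = \<rho> ((h + (v + - u)) + u)" using h by (simp only: grp_norm)
        moreover have "h + (v + - u) \<in> K" using Kc(2) h vu by blast
        ultimately show "z \<in> (\<lambda>h. \<rho> (h + u)) ` K" by blast
      qed
      show "(\<lambda>h. \<rho> (h + u)) ` K \<subseteq> (\<lambda>h. \<rho> (h + v)) ` K"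
      proof
        fix z assume "z \<in> (\<lambda>h. \<rho> (h + u)) ` K"
        then obtain h where h: "h \<in> K" "z = \<rho> (h + u)" by blast
        have "z = \<rho> ((h + - (v + - u)) + v)" using h by (simp only: grp_norm)
        moreover have "h + - (v + - u) \<in> K" using Kc(2)[OF h(1) Kc(3)[OF vu]] .
        ultimately show "z \<in> (\<lambda>h. \<rho> (h + v)) ` K" by blast
      qed
    qed
    then show "co u = co v" by (simp only: co u v)
  qed
  let ?Q = "H Mod (\<rho> ` K)"
  have Qc: "carrier ?Q = co ` D" by (simp add: FactGroup_def rc)
  have Qm: "co u \<otimes>\<^bsub>?Q\<^esub> co v = co (u + v)" if "u \<in> D" "v \<in> D" for u v
    using that N.rcos_sum[of "\<rho> u" "\<rho> v"] by (simp add: FactGroup_def co_def \<rho>(2,3))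
  have Q1: "\<one>\<^bsub>?Q\<^esub> = co 0" using Dc(1) by (simp add: FactGroup_def co)
  have "comm_group ?Q"
  proof (rule group.group_comm_groupI[OF N.factorgroup_is_group])
    fix X Y assume "X \<in> carrier ?Q" "Y \<in> carrier ?Q"
    then obtain u v where uv: "X = co u" "Y = co v" "u \<in> D" "v \<in> D" by (auto simp: Qc)
    have "- (v + u) + (u + v) = comm u v" by (simp only: comm_def grp_norm)
    then have "co (v + u) = co (u + v)" using uv D(4) Dc(2) by (simp add: co_eq)
    then show "X \<otimes>\<^bsub>?Q\<^esub> Y = Y \<otimes>\<^bsub>?Q\<^esub> X" by (simp only: uv(1,2) Qm[OF uv(3,4)] Qm[OF uv(4,3)])
  qed
  moreover have "X \<otimes>\<^bsub>?Q\<^esub> X = \<one>\<^bsub>?Q\<^esub>" if X: "X \<in> carrier ?Q" for X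
  proof -
    obtain u where u: "X = co u" "u \<in> D" using X by (auto simp: Qc)
    have "- 0 + (u + u) \<in> K" using D(5)[OF u(2)] by simp
    then have "co 0 = co (u + u)" using u Dc by (simp only: co_eq)
    then show ?thesis by (simp only: u(1) Qm[OF u(2) u(2)] Q1)
  qed
  ultimately have vs: "vectorspace F2 V"
    by (rule vectorspace_F2I) (simp_all add: FactGroup_def V(1-4) V(5)[OF _ N.factorgroup_is_group])
  have "inj_on (\<lambda>E. co (rep E)) (Pow J)"
    using J by (intro inj_onI) (simp add: co_eq)
  moreover have "(\<lambda>E. co (rep E)) ` Pow J = co ` D"
  proof
    show "(\<lambda>E. co (rep E)) ` Pow J \<subseteq> co ` D" using J(2) by blast
    show "co ` D \<subseteq> (\<lambda>E. co (rep E)) ` Pow J"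
    proof
      fix X assume "X \<in> co ` D"
      then obtain u where u: "X = co u" "u \<in> D" by blast
      obtain E where "E \<subseteq> J" "- rep E + u \<in> K" using J(3) u(2) by blast
      then have "co (rep E) = X" "E \<in> Pow J" using u J(2) by (simp_all add: co_eq)
      then show "X \<in> (\<lambda>E. co (rep E)) ` Pow J" by blast
    qed
  qed
  ultimately have "card (co ` D) = 2 ^ card J" using J(1) by (metis card_Pow card_image)
  then have "card (carrier V) = 2 ^ card J" by (simp only: V(1) rc)
  with vs show ?thesis by (rule has_dim_F2_card)
qed

section \<open>The dimension series as a series of subgroups of the permutation group\<close>

lemma range_Rep: "Rep_bsv ` UNIV = carrier bsv_group"
  using Rep_bsv Rep_bsv_cases by blast

lemma Rep_add: "Rep_bsv (x + y) = Rep_bsv x \<otimes>\<^bsub>bsv_group\<^esub> Rep_bsv y"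
  and Rep_uminus: "Rep_bsv (- x) = inv\<^bsub>bsv_group\<^esub> Rep_bsv x"
  and Rep_zero: "Rep_bsv 0 = \<one>\<^bsub>bsv_group\<^esub>"
  by (rule plus_bsv.rep_eq uminus_bsv.rep_eq zero_bsv.rep_eq)+

lemma generate_Rep: "generate bsv_group (Rep_bsv ` S) = Rep_bsv ` gen S"
proof
  show "generate bsv_group (Rep_bsv ` S) \<subseteq> Rep_bsv ` gen S"
  proof
    fix g assume "g \<in> generate bsv_group (Rep_bsv ` S)"
    then show "g \<in> Rep_bsv ` gen S"
    proof induction
      case one show ?case using gen.zero[of S] by (metis Rep_zero imageI)
    next
      case (incl h) then show ?case by (auto intro: gen.incl)
    next
      case (inv h)
      then obtain x where "x \<in> S" "h = Rep_bsv x" by blast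
      then show ?case using gen.neg[OF gen.incl, of x S] by (metis Rep_uminus imageI)
    next
      case (eng h1 h2)
      then obtain x y where "x \<in> gen S" "y \<in> gen S" "h1 = Rep_bsv x" "h2 = Rep_bsv y" by blast
      then show ?case using gen.add[of x S y] by (metis Rep_add imageI)
    qed
  qed
  show "Rep_bsv ` gen S \<subseteq> generate bsv_group (Rep_bsv ` S)"
  proof
    fix g assume "g \<in> Rep_bsv ` gen S"
    then obtain x where x: "x \<in> gen S" "g = Rep_bsv x" by blast
    have "Rep_bsv x \<in> generate bsv_group (Rep_bsv ` S)" using x(1)
    proof induction
      case zero show ?case unfolding Rep_zero by (rule generate.one)
    next
      case (incl x) then show ?case by (intro generate.incl) blast
    next
      case (add x y) show ?case unfolding Rep_add by (rule generate.eng[OF add.IH])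
    next
      case (neg x)
      have "Rep_bsv ` S \<subseteq> carrier bsv_group" using Rep_bsv by blast
      then show ?case unfolding Rep_uminus using neg.IH bsv.generate_m_inv_closed by blast
    qed
    then show "g \<in> generate bsv_group (Rep_bsv ` S)" using x by simp
  qed
qed

lemma dim_series_Rep: "dim_series bsv_group n = Rep_bsv ` dimser n"
proof (induction n rule: less_induct)
  case (less n)
  show ?case
  proof (cases "n \<le> 1")
    case True then show ?thesis by (simp add: dim_series.simps[of _ n] dimser_le_1 range_Rep del: mult_bsv one_bsv)
  next
    case False
    then have IH: "dim_series bsv_group (n - 1) = Rep_bsv ` dimser (n - 1)"
      "dim_series bsv_group ((n + 1) div 2) = Rep_bsv ` dimser ((n + 1) div 2)"
      using less by simp_all
    let ?c = "\<lambda>h k. inv\<^bsub>bsv_group\<^esub> h \<otimes>\<^bsub>bsv_group\<^esub> inv\<^bsub>bsv_group\<^esub> k \<otimes>\<^bsub>bsv_group\<^esub> h \<otimes>\<^bsub>bsv_group\<^esub> k"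
    have c: "Rep_bsv (comm x y) = ?c (Rep_bsv x) (Rep_bsv y)" for x y
      by (simp only: comm_def Rep_add Rep_uminus)
    have "{?c h k | h k. h \<in> carrier bsv_group \<and> k \<in> Rep_bsv ` dimser (n - 1)}
      = Rep_bsv ` {comm g x | g x. x \<in> dimser (n - 1)}"
    proof (rule subset_antisym; rule subsetI)
      fix z assume "z \<in> {?c h k | h k. h \<in> carrier bsv_group \<and> k \<in> Rep_bsv ` dimser (n - 1)}"
      then obtain h k where "z = ?c h k" "h \<in> Rep_bsv ` UNIV" "k \<in> Rep_bsv ` dimser (n - 1)"
        unfolding range_Rep by blast
      then obtain g x where "z = Rep_bsv (comm g x)" "x \<in> dimser (n - 1)" unfolding c by blast
      then show "z \<in> Rep_bsv ` {comm g x | g x. x \<in> dimser (n - 1)}" by blast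
    next
      fix z assume "z \<in> Rep_bsv ` {comm g x | g x. x \<in> dimser (n - 1)}"
      then obtain g x where "z = ?c (Rep_bsv g) (Rep_bsv x)" "x \<in> dimser (n - 1)" unfolding c[symmetric] by blast
      then show "z \<in> {?c h k | h k. h \<in> carrier bsv_group \<and> k \<in> Rep_bsv ` dimser (n - 1)}" using Rep_bsv by blast
    qed
    then have 1: "commutator_subgroup bsv_group (carrier bsv_group) (Rep_bsv ` dimser (n - 1))
      = Rep_bsv ` gen {comm g x | g x. x \<in> dimser (n - 1)}"
      by (simp only: commutator_subgroup_def generate_Rep)
    have "{h \<otimes>\<^bsub>bsv_group\<^esub> h | h. h \<in> Rep_bsv ` dimser ((n + 1) div 2)}
      = (\<lambda>x. Rep_bsv (x + x)) ` dimser ((n + 1) div 2)" unfolding Rep_add by blast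
    also have "\<dots> = Rep_bsv ` {x + x | x. x \<in> dimser ((n + 1) div 2)}" by blast
    finally have "{h \<otimes>\<^bsub>bsv_group\<^esub> h | h. h \<in> Rep_bsv ` dimser ((n + 1) div 2)}
      = Rep_bsv ` {x + x | x. x \<in> dimser ((n + 1) div 2)}" .
    then have 2: "square_subgroup bsv_group (Rep_bsv ` dimser ((n + 1) div 2))
      = Rep_bsv ` gen {x + x | x. x \<in> dimser ((n + 1) div 2)}"
      by (simp only: square_subgroup_def generate_Rep)
    have "Rep_bsv ` A <#>\<^bsub>bsv_group\<^esub> Rep_bsv ` B = Rep_bsv ` setsum A B" for A B
    proof (rule subset_antisym; rule subsetI)
      fix z assume "z \<in> Rep_bsv ` A <#>\<^bsub>bsv_group\<^esub> Rep_bsv ` B"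
      then obtain a b where "a \<in> A" "b \<in> B" "z = Rep_bsv (a + b)" unfolding set_mult_def Rep_add by blast
      then show "z \<in> Rep_bsv ` setsum A B" unfolding setsum_def by blast
    next
      fix z assume "z \<in> Rep_bsv ` setsum A B"
      then obtain a b where "a \<in> A" "b \<in> B" "z = Rep_bsv a \<otimes>\<^bsub>bsv_group\<^esub> Rep_bsv b"
        unfolding setsum_def Rep_add[symmetric] by blast
      then show "z \<in> Rep_bsv ` A <#>\<^bsub>bsv_group\<^esub> Rep_bsv ` B" unfolding set_mult_def by blast
    qed
    then show ?thesis using False
      by (simp only: dim_series.simps[of _ n] dimser.simps[of n] if_False IH 1 2)
  qed
qed

lemma inj_Rep_bsv: "inj Rep_bsv"
  by (simp add: inj_on_def Rep_bsv_inject)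

theorem has_dim_layer:
  assumes n: "0 < n" shows "has_dim F2 (dim_layer bsv_group n) (card (layer_index n))"
proof -
  let ?H = "bsv_group\<lparr>carrier := dim_series bsv_group n\<rparr>"
  have k: "n < 2 ^ n" by (rule less_exp)
  have rest: "?H Mod dim_series bsv_group (n + 1) = ?H Mod (Rep_bsv ` dimser (Suc n))"
    by (simp only: dim_series_Rep Suc_eq_plus1)
  show ?thesis unfolding dim_layer_def rest
  proof (rule has_dim_quotient[where \<rho> = Rep_bsv and H = ?H and D = "dimser n" and K = "dimser (Suc n)"
        and rep = "layer_prod n n"])
    show "inj Rep_bsv" by (rule inj_Rep_bsv)
    show "carrier ?H = Rep_bsv ` dimser n" by (simp add: dim_series_Rep)
    show "Rep_bsv x \<otimes>\<^bsub>?H\<^esub> Rep_bsv y = Rep_bsv (x + y)" for x y by (simp add: Rep_add)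
    show "\<one>\<^bsub>?H\<^esub> = Rep_bsv 0" by (simp add: Rep_zero)
    show "subgrp (dimser n :: bsv set)" "subgrp (dimser (Suc n) :: bsv set)" by (rule subgrp_dimser)+
    show "dimser (Suc n) \<subseteq> (dimser n :: bsv set)" by (rule dimser_Suc)
    show "comm x y \<in> dimser (Suc n)" if "y \<in> dimser n" for x y :: bsv using that by (rule comm_in_dimser)
    show "x + x \<in> dimser (Suc n)" if "x \<in> dimser n" for x :: bsv
      using double_in_dimser[OF that] dimser_antimono[of "Suc n" "2 * n"] n by auto
    show "finite (layer_index n)" by (rule finite_layer_index)
    show "layer_prod n n E \<in> dimser n" if "E \<subseteq> layer_index n" for E using that by (rule layer_prod_dimser)
    show "\<exists>E\<subseteq>layer_index n. - layer_prod n n E + x \<in> dimser (Suc n)" if "x \<in> dimser n" for x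
      using layer_prod_surj[OF n k that] .
    show "E = F" if "E \<subseteq> layer_index n" "F \<subseteq> layer_index n" "- layer_prod n n E + layer_prod n n F \<in> dimser (Suc n)" for E F
      using layer_prod_inj[OF n k that] .
    fix X assume X: "X \<in> rcosets\<^bsub>?H\<^esub> (Rep_bsv ` dimser (Suc n))"
    let ?Q = "?H Mod (Rep_bsv ` dimser (Suc n))"
    show "0 \<odot>\<^bsub>power_module ?Q\<^esub> X = Rep_bsv ` dimser (Suc n)" by (simp add: power_module_def, (simp add: FactGroup_def)?)
    show "1 \<odot>\<^bsub>power_module ?Q\<^esub> X = X" if "group ?Q"
      using group.int_pow_1[OF that, of X] X by (simp add: power_module_def, (simp add: FactGroup_def)?)
  qed (simp_all add: power_module_def FactGroup_def)
qed

section \<open>Counting the basis of a layer\<close>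

lemma card_layer_index_power: "card (layer_index (2 ^ i)) = i + 2"
proof -
  have "layer_index (2 ^ i) = insert 0 ((\<lambda>t. 2 ^ t) ` {..i})"
  proof (rule Set.set_eqI)
    fix m
    show "m \<in> layer_index (2 ^ i) \<longleftrightarrow> m \<in> insert 0 ((\<lambda>t. 2 ^ t) ` {..i})"
    proof (cases "m = 0")
      case True then show ?thesis by (auto simp: layer_index_def wt_def)
    next
      case False
      have "(\<exists>j. m * 2 ^ j = 2 ^ i) \<longleftrightarrow> (\<exists>t\<le>i. m = 2 ^ t)"
      proof
        assume "\<exists>j. m * 2 ^ j = 2 ^ i"
        then have "m dvd 2 ^ i" by (metis dvd_triv_left)
        then show "\<exists>t\<le>i. m = 2 ^ t" by (simp add: divides_primepow_nat)
      next
        assume "\<exists>t\<le>i. m = 2 ^ t"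
        then obtain t where "t \<le> i" "m = 2 ^ t" by blast
        then have "m * 2 ^ (i - t) = 2 ^ i" by (simp flip: power_add)
        then show "\<exists>j. m * 2 ^ j = 2 ^ i" by blast
      qed
      then show ?thesis using False by (auto simp: layer_index_def wt_def)
    qed
  qed
  moreover have "inj_on (\<lambda>t. (2::nat) ^ t) {..i}" by (auto simp: inj_on_def)
  ultimately show ?thesis by (simp add: card_insert_if card_image image_iff)
qed

text \<open>Number 0 has weight 1 and could only contribute when n is a power of 2; otherwise the
  members are the quotients n / 2^i, one for each 2^i dividing n.\<close>

lemma card_layer_index_other:
  assumes n: "0 < n" "\<nexists>i. n = 2 ^ i"
  shows "card (layer_index n) = Max {i + 1 | i::nat. 2 ^ i dvd n}"
proof -
  let ?v = "multiplicity 2 n"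
  have dvd: "2 ^ i dvd n \<longleftrightarrow> i \<le> ?v" for i using n(1) by (simp add: power_dvd_iff_le_multiplicity)
  have "layer_index n = (\<lambda>i. n div 2 ^ i) ` {..?v}"
  proof (rule Set.set_eqI)
    fix m
    show "m \<in> layer_index n \<longleftrightarrow> m \<in> (\<lambda>i. n div 2 ^ i) ` {..?v}"
    proof
      assume "m \<in> layer_index n"
      then obtain j where j: "wt m * 2 ^ j = n" by (auto simp: layer_index_def)
      have m: "m \<noteq> 0"
      proof
        assume "m = 0"
        then have "n = 2 ^ j" using j by (simp add: wt_def)
        then show False using n(2) by blast
      qed
      then have "m = n div 2 ^ j" "2 ^ j dvd n" using j by (auto simp: wt_def)
      then show "m \<in> (\<lambda>i. n div 2 ^ i) ` {..?v}" by (simp add: dvd)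
    next
      assume "m \<in> (\<lambda>i. n div 2 ^ i) ` {..?v}"
      then obtain j where j: "m = n div 2 ^ j" "2 ^ j dvd n" by (auto simp: dvd)
      then have "m * 2 ^ j = n" by simp
      moreover from this have "m \<noteq> 0" using n(1) by auto
      ultimately show "m \<in> layer_index n" by (auto simp: layer_index_def wt_def)
    qed
  qed
  moreover have "inj_on (\<lambda>i. n div 2 ^ i) {..?v}"
  proof (rule inj_onI)
    fix i j assume "i \<in> {..?v}" "j \<in> {..?v}" and eq: "n div 2 ^ i = n div 2 ^ j"
    then have "2 ^ i dvd n" "2 ^ j dvd n" by (simp_all only: dvd atMost_iff)
    then have "n div 2 ^ i * 2 ^ i = n" "n div 2 ^ j * 2 ^ j = n" by (simp_all only: dvd_div_mult_self)
    then have "n div 2 ^ i * 2 ^ i = n div 2 ^ i * 2 ^ j" "n div 2 ^ i \<noteq> 0" using n(1) eq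
      by (simp, metis less_irrefl mult_0)
    then show "i = j" by simp
  qed
  moreover have "{i + 1 | i::nat. 2 ^ i dvd n} = Suc ` {..?v}" by (auto simp: dvd)
  moreover have "Max (Suc ` {..?v}) = Suc ?v" by (intro Max_eqI) auto
  ultimately show ?thesis by (simp add: card_image)
qed

section \<open>The group ring\<close>

definition bit_int :: "bit \<Rightarrow> int" where "bit_int b = (if b = 1 then 1 else 0)"

lemma bit_int_simps [simp]: "bit_int 0 = 0" "bit_int 1 = 1"
  by (simp_all add: bit_int_def)

lemma bit_int_inj: "bit_int a = bit_int b \<longleftrightarrow> a = b"
  by (cases a; cases b) simp_all

lemma bit_int_add: "bit_int (a + b) = (bit_int a + bit_int b) mod 2" and bit_int_mult: "bit_int (a * b) = (bit_int a * bit_int b) mod 2"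
  by (cases a; cases b; simp)+

lemma bit_int_in: "bit_int b \<in> carrier F2"
  by (cases b) (simp_all add: F2_simps(1))

lemma finsum_bit_int: "finite A \<Longrightarrow> (\<Oplus>\<^bsub>F2\<^esub>x\<in>A. bit_int (f x)) = bit_int (sum f A)"
proof (induction A rule: finite_induct)
  case empty
  interpret F: field F2 by (rule field_F2)
  show ?case by (simp add: F2_simps(2))
next
  case (insert x A)
  interpret F: field F2 by (rule field_F2)
  have "(\<Oplus>\<^bsub>F2\<^esub>y\<in>insert x A. bit_int (f y)) = bit_int (f x) \<oplus>\<^bsub>F2\<^esub> (\<Oplus>\<^bsub>F2\<^esub>y\<in>A. bit_int (f y))"
    using insert.hyps bit_int_in by (intro F.finsum_insert) auto
  then show ?case by (simp only: F2_simps(4) sum.insert[OF insert.hyps] bit_int_add insert.IH)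
qed

text \<open>An isomorphism from finitely supported maps on \<open>bsv\<close> onto
  \<open>group_ring F2 bsv_group\<close>; the lemmas up to
  \<open>augmentation_power_ring_embed\<close> transport the ring structure, the augmentation and
  the powers of its kernel.\<close>

definition ring_embed :: "(bsv \<Rightarrow>\<^sub>0 bit) \<Rightarrow> (bool list \<Rightarrow> bool list) \<Rightarrow> int" where
  "ring_embed x = (\<lambda>f\<in>carrier bsv_group. bit_int (Poly_Mapping.lookup x (Abs_bsv f)))"

abbreviation F2bsv where "F2bsv \<equiv> group_ring F2 bsv_group"

lemma ring_embed_Rep [simp]: "ring_embed x (Rep_bsv g) = bit_int (Poly_Mapping.lookup x g)"
  using Rep_bsv[of g] by (simp add: ring_embed_def Rep_bsv_inverse)

lemma ring_embed_outside: "f \<notin> carrier bsv_group \<Longrightarrow> ring_embed x f = undefined"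
  by (simp add: ring_embed_def)

lemma fun_bsv_eqI:
  assumes "\<And>g. f (Rep_bsv g) = h (Rep_bsv g)" "\<And>x. x \<notin> carrier bsv_group \<Longrightarrow> f x = h x"
  shows "f = h"
proof
  fix x show "f x = h x"
    using assms by (cases "x \<in> carrier bsv_group") (metis Abs_bsv_inverse)+
qed

lemma ring_embed_inj: "inj ring_embed"
proof (rule injI)
  fix x y assume "ring_embed x = ring_embed y"
  then have "bit_int (Poly_Mapping.lookup x g) = bit_int (Poly_Mapping.lookup y g)" for g by (metis ring_embed_Rep)
  then show "x = y" by (intro poly_mapping_eqI) (simp only: bit_int_inj)
qed

lemma supp_ring_embed: "supp F2 bsv_group (ring_embed x) = Rep_bsv ` Poly_Mapping.keys x"
proof
  show "supp F2 bsv_group (ring_embed x) \<subseteq> Rep_bsv ` Poly_Mapping.keys x"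
  proof
    fix f assume f: "f \<in> supp F2 bsv_group (ring_embed x)"
    then obtain g where g: "f = Rep_bsv g" by (metis (mono_tags, lifting) Rep_bsv_cases mem_Collect_eq supp_def)
    then have "bit_int (Poly_Mapping.lookup x g) \<noteq> 0" using f by (simp add: supp_def F2_simps(2))
    then have "Poly_Mapping.lookup x g \<noteq> 0" by (metis bit_int_simps(1))
    then have "g \<in> Poly_Mapping.keys x" by (simp only: in_keys_iff not_False_eq_True)
    then show "f \<in> Rep_bsv ` Poly_Mapping.keys x" using g by blast
  qed
  show "Rep_bsv ` Poly_Mapping.keys x \<subseteq> supp F2 bsv_group (ring_embed x)"
  proof
    fix f assume "f \<in> Rep_bsv ` Poly_Mapping.keys x"
    then obtain g where g: "f = Rep_bsv g" "g \<in> Poly_Mapping.keys x" by blast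
    then have "ring_embed x f = 1" by (simp add: lookup_bit)
    then show "f \<in> supp F2 bsv_group (ring_embed x)" using g Rep_bsv by (simp add: supp_def F2_simps(2))
  qed
qed

lemma carrier_F2bsv: "carrier F2bsv = ring_embed ` UNIV"
proof
  have "ring_embed x \<in> carrier F2bsv" for x
    by (simp add: group_ring_def supp_ring_embed) (simp add: ring_embed_def bit_int_in)
  then show "ring_embed ` UNIV \<subseteq> carrier F2bsv" by blast
  show "carrier F2bsv \<subseteq> ring_embed ` UNIV"
  proof
    fix f assume f: "f \<in> carrier F2bsv"
    let ?S = "supp F2 bsv_group f"
    have fin: "finite ?S" and f01: "f \<in> carrier bsv_group \<rightarrow>\<^sub>E {0, 1}"
      using f by (simp_all add: group_ring_def F2_simps(1))
    have keys: "Poly_Mapping.keys (\<Sum>k\<in>Abs_bsv ` ?S. el k) = Abs_bsv ` ?S" using fin by (intro keys_el_sum) simp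
    have "ring_embed (\<Sum>k\<in>Abs_bsv ` ?S. el k) = f"
    proof (rule fun_bsv_eqI)
      fix g
      have "g \<in> Abs_bsv ` ?S \<longleftrightarrow> Rep_bsv g \<in> ?S"
      proof
        assume "g \<in> Abs_bsv ` ?S"
        then obtain s where "s \<in> ?S" "g = Abs_bsv s" by blast
        moreover from this have "s \<in> carrier bsv_group" by (simp add: supp_def)
        ultimately show "Rep_bsv g \<in> ?S" by (simp add: Abs_bsv_inverse)
      next
        assume "Rep_bsv g \<in> ?S" then show "g \<in> Abs_bsv ` ?S" by (metis Rep_bsv_inverse imageI)
      qed
      also have "\<dots> \<longleftrightarrow> f (Rep_bsv g) \<noteq> 0" using Rep_bsv[of g] by (simp add: supp_def F2_simps(2))
      finally have "ring_embed (\<Sum>k\<in>Abs_bsv ` ?S. el k) (Rep_bsv g) = (if f (Rep_bsv g) \<noteq> 0 then 1 else 0)"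
        by (simp only: ring_embed_Rep lookup_bit keys) simp
      moreover have "f (Rep_bsv g) \<in> {0, 1}" using f01 Rep_bsv[of g] by blast
      ultimately show "ring_embed (\<Sum>k\<in>Abs_bsv ` ?S. el k) (Rep_bsv g) = f (Rep_bsv g)" by auto
    next
      fix h assume "h \<notin> carrier bsv_group"
      then show "ring_embed (\<Sum>k\<in>Abs_bsv ` ?S. el k) h = f h" using f01 by (auto simp: ring_embed_outside PiE_def extensional_def)
    qed
    then show "f \<in> ring_embed ` UNIV" by (metis rangeI)
  qed
qed

lemma ring_embed_add: "ring_embed x \<oplus>\<^bsub>F2bsv\<^esub> ring_embed y = ring_embed (x + y)"
proof (rule fun_bsv_eqI)
  fix g
  show "(ring_embed x \<oplus>\<^bsub>F2bsv\<^esub> ring_embed y) (Rep_bsv g) = ring_embed (x + y) (Rep_bsv g)"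
    unfolding ring_embed_Rep lookup_add bit_int_add by (simp add: group_ring_def Rep_bsv F2_simps(4))
qed (simp add: group_ring_def ring_embed_outside)

lemma ring_embed_zero: "\<zero>\<^bsub>F2bsv\<^esub> = ring_embed 0"
  by (rule fun_bsv_eqI) (simp_all add: group_ring_def Rep_bsv ring_embed_outside F2_simps(2))

lemma ring_embed_smult: "0 \<odot>\<^bsub>F2bsv\<^esub> ring_embed x = ring_embed 0" "1 \<odot>\<^bsub>F2bsv\<^esub> ring_embed x = ring_embed x"
proof -
  have "bit_int b mod 2 = bit_int b" for b by (cases b) simp_all
  then show "1 \<odot>\<^bsub>F2bsv\<^esub> ring_embed x = ring_embed x"
    by (intro fun_bsv_eqI) (simp_all add: group_ring_def Rep_bsv ring_embed_outside F2_simps(5))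
  show "0 \<odot>\<^bsub>F2bsv\<^esub> ring_embed x = ring_embed 0"
    by (rule fun_bsv_eqI) (simp_all add: group_ring_def Rep_bsv ring_embed_outside F2_simps(5))
qed

lemma lookup_el_mult: "Poly_Mapping.lookup (el u * y) z = Poly_Mapping.lookup y (- u + z)" for u :: "'g::group_add"
proof (induction y rule: pm_induct)
  case zero show ?case by simp
next
  case (add y k)
  have "u + k = z \<longleftrightarrow> k = - u + z" by (metis add_minus_cancel minus_add_cancel)
  then have "Poly_Mapping.lookup (el u * el k) z = Poly_Mapping.lookup (el k) (- u + z)"
    by (auto simp: mult_single lookup_single when_def)
  then show ?case using add by (simp add: distrib_left lookup_add)
qed

lemma lookup_mult_keys:
  "Poly_Mapping.lookup (x * y) z = (\<Sum>u\<in>Poly_Mapping.keys x. Poly_Mapping.lookup x u * Poly_Mapping.lookup y (- u + z))"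
  for x :: "'g::group_add \<Rightarrow>\<^sub>0 bit"
proof -
  have "Poly_Mapping.lookup (x * y) z = Poly_Mapping.lookup ((\<Sum>u\<in>Poly_Mapping.keys x. el u) * y) z"
    by (simp only: el_expand[symmetric])
  also have "\<dots> = (\<Sum>u\<in>Poly_Mapping.keys x. Poly_Mapping.lookup y (- u + z))"
    by (simp only: sum_distrib_right lookup_sum lookup_el_mult)
  also have "\<dots> = (\<Sum>u\<in>Poly_Mapping.keys x. Poly_Mapping.lookup x u * Poly_Mapping.lookup y (- u + z))"
    by (intro sum.cong refl) (simp add: lookup_bit[of x])
  finally show ?thesis .
qed

lemma ring_embed_mult: "ring_embed x \<otimes>\<^bsub>F2bsv\<^esub> ring_embed y = ring_embed (x * y)"
proof (rule fun_bsv_eqI)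
  interpret F: field F2 by (rule field_F2)
  fix z
  have "(ring_embed x \<otimes>\<^bsub>F2bsv\<^esub> ring_embed y) (Rep_bsv z)
    = (\<Oplus>\<^bsub>F2\<^esub>f\<in>Rep_bsv ` Poly_Mapping.keys x. ring_embed x f \<otimes>\<^bsub>F2\<^esub> ring_embed y (inv\<^bsub>bsv_group\<^esub> f \<otimes>\<^bsub>bsv_group\<^esub> Rep_bsv z))"
    using Rep_bsv[of z] by (simp add: group_ring_def supp_ring_embed del: mult_bsv)
  also have "\<dots> = (\<Oplus>\<^bsub>F2\<^esub>u\<in>Poly_Mapping.keys x. ring_embed x (Rep_bsv u) \<otimes>\<^bsub>F2\<^esub>
      ring_embed y (inv\<^bsub>bsv_group\<^esub> (Rep_bsv u) \<otimes>\<^bsub>bsv_group\<^esub> Rep_bsv z))"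
  proof (rule F.finsum_reindex)
    show "inj_on Rep_bsv (Poly_Mapping.keys x)" using inj_Rep_bsv by (rule inj_on_subset) simp
    show "(\<lambda>f. ring_embed x f \<otimes>\<^bsub>F2\<^esub> ring_embed y (inv\<^bsub>bsv_group\<^esub> f \<otimes>\<^bsub>bsv_group\<^esub> Rep_bsv z))
      \<in> Rep_bsv ` Poly_Mapping.keys x \<rightarrow> carrier F2"
    proof
      fix f assume "f \<in> Rep_bsv ` Poly_Mapping.keys x"
      then obtain u where "f = Rep_bsv u" by blast
      then show "ring_embed x f \<otimes>\<^bsub>F2\<^esub> ring_embed y (inv\<^bsub>bsv_group\<^esub> f \<otimes>\<^bsub>bsv_group\<^esub> Rep_bsv z) \<in> carrier F2"
        by (simp only: Rep_uminus[symmetric] Rep_add[symmetric] ring_embed_Rep) (rule F.m_closed[OF bit_int_in bit_int_in])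
    qed
  qed
  also have "\<dots> = (\<Oplus>\<^bsub>F2\<^esub>u\<in>Poly_Mapping.keys x. bit_int (Poly_Mapping.lookup x u * Poly_Mapping.lookup y (- u + z)))"
    by (simp only: Rep_uminus[symmetric] Rep_add[symmetric] ring_embed_Rep F2_simps(5) bit_int_mult)
  also have "\<dots> = bit_int (\<Sum>u\<in>Poly_Mapping.keys x. Poly_Mapping.lookup x u * Poly_Mapping.lookup y (- u + z))"
    by (rule finsum_bit_int) simp
  also have "\<dots> = ring_embed (x * y) (Rep_bsv z)" by (simp only: ring_embed_Rep lookup_mult_keys)
  finally show "(ring_embed x \<otimes>\<^bsub>F2bsv\<^esub> ring_embed y) (Rep_bsv z) = ring_embed (x * y) (Rep_bsv z)" .
qed (simp add: group_ring_def ring_embed_outside)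

lemma augmentation_ring_embed: "augmentation F2 bsv_group (ring_embed x) = bit_int (aug x)"
proof -
  interpret F: field F2 by (rule field_F2)
  have "augmentation F2 bsv_group (ring_embed x) = (\<Oplus>\<^bsub>F2\<^esub>f\<in>Rep_bsv ` Poly_Mapping.keys x. ring_embed x f)"
    by (simp add: augmentation_def supp_ring_embed)
  also have "\<dots> = (\<Oplus>\<^bsub>F2\<^esub>u\<in>Poly_Mapping.keys x. ring_embed x (Rep_bsv u))"
  proof (rule F.finsum_reindex)
    show "inj_on Rep_bsv (Poly_Mapping.keys x)" using inj_Rep_bsv by (rule inj_on_subset) simp
    show "ring_embed x \<in> Rep_bsv ` Poly_Mapping.keys x \<rightarrow> carrier F2" using bit_int_in by auto
  qed
  also have "\<dots> = bit_int (\<Sum>u\<in>Poly_Mapping.keys x. Poly_Mapping.lookup x u)"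
    by (simp only: ring_embed_Rep) (rule finsum_bit_int, simp)
  also have "(\<Sum>u\<in>Poly_Mapping.keys x. Poly_Mapping.lookup x u) = aug x"
    unfolding aug_def linext_def by (intro sum.cong refl) (simp add: lookup_bit)
  finally show ?thesis .
qed

lemma augmentation_ideal_ring_embed: "augmentation_ideal F2 bsv_group = ring_embed ` {x. aug x = 0}"
proof -
  have b0: "bit_int b = 0 \<longleftrightarrow> b = 0" for b by (cases b) simp_all
  have "augmentation_ideal F2 bsv_group = {f \<in> ring_embed ` UNIV. augmentation F2 bsv_group f = 0}"
    by (simp only: augmentation_ideal_def a_kernel_def' carrier_F2bsv F2_simps(2))
  also have "\<dots> = ring_embed ` {x. augmentation F2 bsv_group (ring_embed x) = 0}" by blast
  finally show ?thesis by (simp only: augmentation_ring_embed b0)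
qed

lemma ideal_prod_ring_embed:
  assumes "\<exists>a. a \<in> A" "\<exists>b. b \<in> B"
  shows "ideal_prod F2bsv (ring_embed ` A) (ring_embed ` B) = ring_embed ` aspan {a * b | a b. a \<in> A \<and> b \<in> B}"
proof
  let ?S = "{a * b | a b. a \<in> A \<and> b \<in> B}"
  show "ideal_prod F2bsv (ring_embed ` A) (ring_embed ` B) \<subseteq> ring_embed ` aspan ?S"
  proof
    fix f assume "f \<in> ideal_prod F2bsv (ring_embed ` A) (ring_embed ` B)"
    then show "f \<in> ring_embed ` aspan ?S"
    proof induction
      case (prod i j)
      then obtain a b where "i = ring_embed a" "a \<in> A" "j = ring_embed b" "b \<in> B" by blast
      then have "i \<otimes>\<^bsub>F2bsv\<^esub> j = ring_embed (a * b)" "a * b \<in> aspan ?S" by (simp add: ring_embed_mult, blast intro: aspan_incl)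
      then show ?case by blast
    next
      case (sum s1 s2)
      then obtain x y where "s1 = ring_embed x" "x \<in> aspan ?S" "s2 = ring_embed y" "y \<in> aspan ?S" by blast
      then have "s1 \<oplus>\<^bsub>F2bsv\<^esub> s2 = ring_embed (x + y)" "x + y \<in> aspan ?S" by (simp add: ring_embed_add, blast intro: aspan_add)
      then show ?case by blast
    qed
  qed
  show "ring_embed ` aspan ?S \<subseteq> ideal_prod F2bsv (ring_embed ` A) (ring_embed ` B)"
  proof
    fix f assume "f \<in> ring_embed ` aspan ?S"
    then obtain x where x: "x \<in> aspan ?S" "f = ring_embed x" by blast
    have pr: "ring_embed (a * b) \<in> ideal_prod F2bsv (ring_embed ` A) (ring_embed ` B)" if "a \<in> A" "b \<in> B" for a b
      unfolding ring_embed_mult[symmetric] using that by (intro ideal_prod.prod) auto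
    have "ring_embed x \<in> ideal_prod F2bsv (ring_embed ` A) (ring_embed ` B)" using x(1)
    proof induction
      case zero
      \<comment> \<open>\<open>ideal_prod\<close> has no clause for zero; in characteristic 2 it
        arises as a b + a b, which is where nonemptiness is used.\<close>
      obtain a b where ab: "a \<in> A" "b \<in> B" using assms by blast
      have "ring_embed (a * b + a * b) \<in> ideal_prod F2bsv (ring_embed ` A) (ring_embed ` B)"
        unfolding ring_embed_add[symmetric] by (rule ideal_prod.sum[OF pr pr]) (use ab in auto)
      then show ?case by simp
    next
      case (step y s)
      then obtain a b where "s = a * b" "a \<in> A" "b \<in> B" by blast
      then show ?case unfolding ring_embed_add[symmetric] using step.IH pr by (intro ideal_prod.sum) auto
    qed
    then show "f \<in> ideal_prod F2bsv (ring_embed ` A) (ring_embed ` B)" using x by simp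
  qed
qed

lemma augmentation_power_ring_embed: "augmentation_power F2 bsv_group n = ring_embed ` aug_pow n"
proof (induction n)
  case 0 show ?case by (simp add: augmentation_power_def nat_pow_def ideals_set_def carrier_F2bsv)
next
  case (Suc n)
  have "augmentation_power F2 bsv_group (Suc n)
    = ideal_prod F2bsv (augmentation_power F2 bsv_group n) (augmentation_ideal F2 bsv_group)"
    by (simp add: augmentation_power_def nat_pow_def ideals_set_def)
  also have "\<dots> = ideal_prod F2bsv (ring_embed ` aug_pow n) (ring_embed ` {x. aug x = 0})"
    by (simp only: Suc augmentation_ideal_ring_embed)
  also have "\<dots> = ring_embed ` aspan {a * b | a b. a \<in> aug_pow n \<and> b \<in> {x. aug x = 0}}"
    by (rule ideal_prod_ring_embed) (auto intro: exI[of _ 0])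
  finally show ?case by (simp add: aug_pow.simps(2))
qed

section \<open>Layers of the augmentation filtration\<close>

definition weight_eq :: "nat \<Rightarrow> nat multiset set" where "weight_eq n = {P. weight P = n}"

lemma weight_eq_weight_le: "weight_eq n \<subseteq> weight_le n" by (auto simp: weight_eq_def weight_le_def)

lemma finite_weight_eq: "finite (weight_eq n)"
  using weight_eq_weight_le finite_weight_le by (rule finite_subset)

lemma aug_pow_sum: "(\<And>i. i \<in> I \<Longrightarrow> f i \<in> aug_pow n) \<Longrightarrow> sum f I \<in> aug_pow n"
  by (induction I rule: infinite_finite_induct) (simp_all add: aug_pow_add)

text \<open>A representation by monomials of weight at most n exists by \<open>mon_span\<close>.
  Modulo the n-th power, where x and the monomials of weight n vanish, the lighter monomials sum to
  0, so by independence there are none.\<close>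

lemma layer_surj:
  assumes k: "n < 2 ^ k" and x: "x \<in> aug_pow n"
  shows "\<exists>E\<subseteq>weight_eq n. - (\<Sum>P\<in>E. mon k P) + x \<in> aug_pow (Suc n)"
proof -
  obtain D where D: "D \<subseteq> weight_le n" "x + (\<Sum>P\<in>D. mon k P) \<in> aug_pow (Suc n)"
    using mon_span[of n k x] k by auto
  have fin: "finite D" using D(1) finite_weight_le finite_subset by blast
  have split: "(\<Sum>P\<in>D. mon k P) = (\<Sum>P\<in>D \<inter> weight_eq n. mon k P) + (\<Sum>P\<in>D - weight_eq n. mon k P)"
    by (rule sum.Int_Diff[OF fin])
  have "D - weight_eq n = {}"
  proof (cases n)
    case 0 then show ?thesis using D(1) by (auto simp: weight_le_def weight_eq_def)
  next
    case (Suc m)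
    have "x + (\<Sum>P\<in>D. mon k P) \<in> aug_pow n" using D(2) aug_pow_Suc by blast
    then have "(\<Sum>P\<in>D. mon k P) \<in> aug_pow n" using aug_pow_cancel x by blast
    moreover have "(\<Sum>P\<in>D \<inter> weight_eq n. mon k P) \<in> aug_pow n"
      using mon_aug_pow[of _ k] k by (intro aug_pow_sum) (auto simp: weight_eq_def)
    ultimately have "(\<Sum>P\<in>D - weight_eq n. mon k P) \<in> aug_pow (Suc m)"
      using aug_pow_add[of "\<Sum>P\<in>D. mon k P" n "\<Sum>P\<in>D \<inter> weight_eq n. mon k P"] unfolding split Suc
      by (simp add: add.commute[of "sum _ (D \<inter> _)"] add.assoc)
    moreover have "D - weight_eq n \<subseteq> weight_le m" using D(1) Suc by (auto simp: weight_le_def weight_eq_def)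
    ultimately show ?thesis using mon_independent[of m k "D - weight_eq n"] k Suc by simp
  qed
  then have "D \<subseteq> weight_eq n" by blast
  moreover have "- (\<Sum>P\<in>D. mon k P) + x \<in> aug_pow (Suc n)" using D(2) by (simp add: add.commute)
  ultimately show ?thesis by blast
qed

theorem has_dim_augmentation_layer: "has_dim F2 (augmentation_layer F2 bsv_group n) (card (weight_eq n))"
proof -
  let ?U = "ring_embed ` aug_pow n" and ?W = "ring_embed ` aug_pow (Suc n)" and ?V = "augmentation_layer F2 bsv_group n"
  let ?H = "add_monoid (F2bsv\<lparr>carrier := ?U\<rparr>)"
  have k: "n < 2 ^ n" by (rule less_exp)
  have V: "?V = subquotient F2bsv ?U ?W"
    by (simp only: augmentation_layer_def augmentation_power_ring_embed Suc_eq_plus1)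
  have coset: "?W +>\<^bsub>F2bsv\<^esub> ring_embed x = (\<lambda>h. ring_embed (h + x)) ` aug_pow (Suc n)" for x
    by (auto simp: a_r_coset_def r_coset_def ring_embed_add)
  have rc: "rcosets\<^bsub>?H\<^esub> ?W = {?W +>\<^bsub>F2bsv\<^esub> ring_embed x | x. x \<in> aug_pow n}"
    by (auto simp: RCOSETS_def a_r_coset_def r_coset_def)
  have mem: "X \<subseteq> ring_embed ` UNIV" "X \<noteq> {}" if "X \<in> rcosets\<^bsub>?H\<^esub> ?W" for X
    using that unfolding rc coset by (auto intro: aug_pow_zero)
  have comm0: "comm x y = 0" for x y :: "bsv \<Rightarrow>\<^sub>0 bit" by (simp add: comm_def add_ac)
  have sub: "subgrp (aug_pow m :: (bsv \<Rightarrow>\<^sub>0 bit) set)" for m by (simp add: subgrp_def aug_pow_add)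
  show ?thesis unfolding V
  proof (rule has_dim_quotient[where \<rho> = ring_embed and H = ?H and D = "aug_pow n" and K = "aug_pow (Suc n)"
        and rep = "\<lambda>E. \<Sum>P\<in>E. mon n P"])
    show "inj ring_embed" by (rule ring_embed_inj)
    show "carrier ?H = ring_embed ` aug_pow n" by simp
    show "ring_embed x \<otimes>\<^bsub>?H\<^esub> ring_embed y = ring_embed (x + y)" for x y by (simp add: ring_embed_add)
    show "\<one>\<^bsub>?H\<^esub> = ring_embed 0" by (simp add: ring_embed_zero)
    show "subgrp (aug_pow n :: (bsv \<Rightarrow>\<^sub>0 bit) set)" "subgrp (aug_pow (Suc n) :: (bsv \<Rightarrow>\<^sub>0 bit) set)" by (rule sub)+
    show "aug_pow (Suc n) \<subseteq> (aug_pow n :: (bsv \<Rightarrow>\<^sub>0 bit) set)" by (rule aug_pow_Suc)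
    show "comm x y \<in> aug_pow (Suc n)" for x y :: "bsv \<Rightarrow>\<^sub>0 bit" by (simp add: comm0)
    show "x + x \<in> aug_pow (Suc n)" for x :: "bsv \<Rightarrow>\<^sub>0 bit" by simp
    show "finite (weight_eq n)" by (rule finite_weight_eq)
    show "(\<Sum>P\<in>E. mon n P) \<in> aug_pow n" if "E \<subseteq> weight_eq n" for E
      using that mon_aug_pow[of _ n] k by (intro aug_pow_sum) (auto simp: weight_eq_def)
    show "\<exists>E\<subseteq>weight_eq n. - (\<Sum>P\<in>E. mon n P) + x \<in> aug_pow (Suc n)" if "x \<in> aug_pow n" for x
      by (rule layer_surj[OF k that])
    show "E = F" if "E \<subseteq> weight_eq n" "F \<subseteq> weight_eq n" "- (\<Sum>P\<in>E. mon n P) + (\<Sum>P\<in>F. mon n P) \<in> aug_pow (Suc n)" for E F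
      using mon_sum_eq[OF k, of E F] that weight_eq_weight_le[of n] by auto
    show "carrier (subquotient F2bsv ?U ?W) = rcosets\<^bsub>?H\<^esub> ?W"
      by (simp add: subquotient_def A_RCOSETS_def)
    show "\<zero>\<^bsub>subquotient F2bsv ?U ?W\<^esub> = ?W" by (simp add: subquotient_def)
    show "X \<oplus>\<^bsub>subquotient F2bsv ?U ?W\<^esub> Y = X <#>\<^bsub>?H\<^esub> Y" for X Y
      by (simp add: subquotient_def set_add_def set_mult_def)
    show "0 \<odot>\<^bsub>subquotient F2bsv ?U ?W\<^esub> X = ?W" if "X \<in> rcosets\<^bsub>?H\<^esub> ?W" for X
    proof -
      have "?W +>\<^bsub>F2bsv\<^esub> (0 \<odot>\<^bsub>F2bsv\<^esub> x) = ?W" if "x \<in> X" for x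
      proof -
        obtain y where "x = ring_embed y" using mem(1)[OF \<open>X \<in> rcosets\<^bsub>?H\<^esub> ?W\<close>] \<open>x \<in> X\<close> by blast
        then show ?thesis by (simp add: ring_embed_smult coset)
      qed
      then show ?thesis using mem(2)[OF that] by (simp add: subquotient_def)
    qed
    show "1 \<odot>\<^bsub>subquotient F2bsv ?U ?W\<^esub> X = X" if XX: "X \<in> rcosets\<^bsub>?H\<^esub> ?W" for X
    proof -
      obtain u where u: "X = ?W +>\<^bsub>F2bsv\<^esub> ring_embed u" using XX unfolding rc by blast
      \<comment> \<open>The scalar acts by a union over all representatives; each of them yields the
        coset \<open>X\<close> again.\<close>
      have "?W +>\<^bsub>F2bsv\<^esub> (1 \<odot>\<^bsub>F2bsv\<^esub> x) = X" if "x \<in> X" for x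
      proof -
        obtain h where h: "h \<in> aug_pow (Suc n)" "x = ring_embed (h + u)" using \<open>x \<in> X\<close> unfolding u coset by blast
        have "(\<lambda>g. ring_embed (g + (h + u))) ` aug_pow (Suc n) = (\<lambda>g. ring_embed (g + u)) ` ((\<lambda>g. g + h) ` aug_pow (Suc n))"
          by (simp add: image_image add.assoc)
        also have "(\<lambda>g. g + h) ` aug_pow (Suc n) = aug_pow (Suc n)"
        proof
          show "(\<lambda>g. g + h) ` aug_pow (Suc n) \<subseteq> aug_pow (Suc n)" using h(1) aug_pow_add by blast
          show "aug_pow (Suc n) \<subseteq> (\<lambda>g. g + h) ` aug_pow (Suc n)"
          proof
            fix g :: "bsv \<Rightarrow>\<^sub>0 bit" assume "g \<in> aug_pow (Suc n)"
            then have "g + h \<in> aug_pow (Suc n)" "g = (g + h) + h" using h(1) aug_pow_add by (blast, simp add: add.assoc)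
            then show "g \<in> (\<lambda>g. g + h) ` aug_pow (Suc n)" by blast
          qed
        qed
        finally show ?thesis unfolding h(2) ring_embed_smult u coset .
      qed
      then show ?thesis using mem(2)[OF XX] by (simp add: subquotient_def)
    qed
  qed
qed

section \<open>Multisets of given weight and partitions\<close>

definition part_sets :: "nat \<Rightarrow> nat multiset set" where "part_sets i = {Q. 0 \<notin># Q \<and> sum_mset Q = i}"

lemma weight_nonzero: "0 \<notin># Q \<Longrightarrow> weight Q = sum_mset Q"
  by (induction Q) (auto simp: wt_def)

lemma finite_part_sets: "finite (part_sets i)"
  by (rule finite_subset[OF _ finite_weight_eq[of i]]) (auto simp: part_sets_def weight_eq_def weight_nonzero)

text \<open>Numbers 0 and 1 both have weight 1: removing the n - i copies of 0 leaves a partition of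
  i into positive parts, and i is arbitrary up to n. This is where the sum of partition numbers
  comes from.\<close>

lemma card_weight_eq: "card (weight_eq n) = (\<Sum>i=0..n. partition_number i)"
proof -
  let ?f = "\<lambda>(i, Q). replicate_mset (n - i) 0 + Q"
  have "bij_betw ?f (SIGMA i:{0..n}. part_sets i) (weight_eq n)"
  proof (rule bij_betw_imageI)
    show "inj_on ?f (SIGMA i:{0..n}. part_sets i)"
    proof (rule inj_onI, clarify)
      fix i Q j R
      assume a: "i \<in> {0..n}" "Q \<in> part_sets i" "j \<in> {0..n}" "R \<in> part_sets j"
        and eq: "replicate_mset (n - i) 0 + Q = replicate_mset (n - j) 0 + R"
      have "filter_mset (\<lambda>x. x \<noteq> 0) (replicate_mset m 0 + S) = S" if "0 \<notin># S" for m and S :: "nat multiset"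
        using that by (intro multiset_eqI) (auto simp: not_in_iff)
      then have "Q = R" using eq a by (metis (mono_tags, lifting) part_sets_def mem_Collect_eq)
      then show "i = j \<and> Q = R" using a by (auto simp: part_sets_def)
    qed
    show "?f ` (SIGMA i:{0..n}. part_sets i) = weight_eq n"
    proof
      show "?f ` (SIGMA i:{0..n}. part_sets i) \<subseteq> weight_eq n"
        by (auto simp: weight_eq_def part_sets_def weight_replicate weight_nonzero wt_def)
      show "weight_eq n \<subseteq> ?f ` (SIGMA i:{0..n}. part_sets i)"
      proof
        fix P assume P: "P \<in> weight_eq n"
        let ?Q = "filter_mset (\<lambda>x. x \<noteq> 0) P"
        have e: "P = replicate_mset (count P 0) 0 + ?Q" by (rule multiset_eqI) auto
        have "weight P = count P 0 + sum_mset ?Q"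
          by (subst e) (simp add: weight_replicate weight_nonzero wt_def)
        then have "count P 0 = n - sum_mset ?Q" "sum_mset ?Q \<le> n" using P by (auto simp: weight_eq_def)
        then have "P = ?f (sum_mset ?Q, ?Q)" "(sum_mset ?Q, ?Q) \<in> (SIGMA i:{0..n}. part_sets i)"
          using e by (simp_all add: part_sets_def)
        then show "P \<in> ?f ` (SIGMA i:{0..n}. part_sets i)" by (rule image_eqI)
      qed
    qed
  qed
  then have "card (weight_eq n) = card (SIGMA i:{0..n}. part_sets i)" by (simp add: bij_betw_same_card)
  also have "\<dots> = (\<Sum>i\<in>{0..n}. card (part_sets i))" using finite_part_sets by (intro card_SigmaI) auto
  finally show ?thesis by (simp add: partition_number_def part_sets_def)
qed

section \<open>Word growth\<close>

text \<open>The monomials of weight at most n are independent modulo the power n + 1, and the ball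
  spans. Choosing for each sum of monomials a congruent sum over a subset of the ball injects one
  power set into the other.\<close>

lemma card_weight_le_ball: "card (weight_le n) \<le> card (ball n)"
proof -
  have k: "n < 2 ^ n" by (rule less_exp)
  have "\<exists>F\<subseteq>ball n. x + (\<Sum>g\<in>F. el g) \<in> aug_pow (Suc n)" for x
    using aspan_representative[OF ball_span[of x n] finite_ball aug_pow_zero aug_pow_add] by blast
  then obtain F where F: "\<And>x. F x \<subseteq> ball n" "\<And>x. x + (\<Sum>g\<in>F x. el g) \<in> aug_pow (Suc n)" by metis
  let ?h = "\<lambda>D. F (\<Sum>P\<in>D. mon n P)"
  have "inj_on ?h (Pow (weight_le n))"
  proof (rule inj_onI)
    fix D E assume D: "D \<in> Pow (weight_le n)" "E \<in> Pow (weight_le n)" and eq: "?h D = ?h E"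
    let ?d = "\<Sum>P\<in>D. mon n P" and ?e = "\<Sum>P\<in>E. mon n P" and ?s = "\<Sum>g\<in>?h D. el g"
    have 1: "?d + ?s \<in> aug_pow (Suc n)" and 2: "?e + ?s \<in> aug_pow (Suc n)" using F(2)[of ?d] F(2)[of ?e] eq by simp_all
    have "?d + ?e = (?d + ?s) + (?e + ?s)" by (simp add: add_ac)
    then have "?d + ?e \<in> aug_pow (Suc n)" using aug_pow_add[OF 1 2] by (simp only:)
    then show "D = E" using mon_sum_eq[OF k, of D E] D by blast
  qed
  moreover have "?h ` Pow (weight_le n) \<subseteq> Pow (ball n)" using F(1) by blast
  ultimately have "card (Pow (weight_le n)) \<le> card (Pow (ball n))" using finite_ball by (intro card_inj_on_le) auto
  then have "(2::nat) ^ card (weight_le n) \<le> 2 ^ card (ball n)" using finite_ball finite_weight_le by (simp add: card_Pow)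
  then show ?thesis by simp
qed

text \<open>Sets of distinct numbers from 1 to j have weight at most j^2, and there are 2^j of them;
  this accounts for the square root in the growth estimate.\<close>

lemma card_weight_le_ge: assumes "j * j \<le> n" shows "2 ^ j \<le> card (weight_le n)"
proof -
  have "mset_set ` Pow {1..j} \<subseteq> weight_le n"
  proof
    fix P assume "P \<in> mset_set ` Pow {1..j}"
    then obtain E where E: "E \<subseteq> {1..j}" "P = mset_set E" by blast
    then have fin: "finite E" using finite_subset by blast
    have "weight P = sum wt E" by (simp add: E(2) weight_def sum_unfold_sum_mset)
    also have "\<dots> \<le> (\<Sum>i\<in>E. j)" using E(1) by (intro sum_mono) (auto simp: wt_def)
    also have "\<dots> = card E * j" by simp
    also have "card E \<le> j" using card_mono[OF _ E(1)] by simp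
    finally show "P \<in> weight_le n" using assms by (simp add: weight_le_def)
  qed
  moreover have "inj_on mset_set (Pow {1..j})"
    by (rule inj_onI) (metis PowD finite_atLeastAtMost finite_set_mset_mset_set finite_subset)
  ultimately have "card (Pow {1..j}) \<le> card (weight_le n)" using finite_weight_le by (metis card_image card_mono)
  then show ?thesis by (simp add: card_Pow)
qed

lemma word_growth_ball: "word_growth bsv_group {tau, mu} n = card (ball n)"
proof -
  have inv: "inv\<^bsub>bsv_group\<^esub> tau = Rep_bsv (- gtau)" "inv\<^bsub>bsv_group\<^esub> mu = Rep_bsv (- gmu)"
    by (simp_all only: Rep_uminus app_gtau app_gmu)
  have letters: "{tau, mu} \<union> (\<lambda>s. inv\<^bsub>bsv_group\<^esub> s) ` {tau, mu} = Rep_bsv ` letters"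
    unfolding letters_def image_insert image_empty inv[symmetric] app_gtau app_gmu by blast
  have foldr: "foldr (\<lambda>x y. x \<otimes>\<^bsub>bsv_group\<^esub> y) (map Rep_bsv w) \<one>\<^bsub>bsv_group\<^esub> = Rep_bsv (sum_list w)" for w
    by (induction w) (simp_all only: list.map foldr.simps comp_apply sum_list.Nil sum_list.Cons Rep_zero Rep_add id_apply)
  have "{foldr (\<lambda>x y. x \<otimes>\<^bsub>bsv_group\<^esub> y) w \<one>\<^bsub>bsv_group\<^esub> | w. length w \<le> n \<and> set w \<subseteq> Rep_bsv ` letters}
    = Rep_bsv ` ball n"
  proof (rule subset_antisym; rule subsetI)
    fix z assume "z \<in> {foldr (\<lambda>x y. x \<otimes>\<^bsub>bsv_group\<^esub> y) w \<one>\<^bsub>bsv_group\<^esub> | w. length w \<le> n \<and> set w \<subseteq> Rep_bsv ` letters}"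
    then obtain w where w: "z = foldr (\<lambda>x y. x \<otimes>\<^bsub>bsv_group\<^esub> y) w \<one>\<^bsub>bsv_group\<^esub>" "length w \<le> n" "w \<in> lists (Rep_bsv ` letters)"
      by blast
    then obtain v where v: "w = map Rep_bsv v" "v \<in> lists letters" by (auto simp: lists_image)
    then have "z = Rep_bsv (sum_list v)" "length v \<le> n" "set v \<subseteq> letters" using w foldr by auto
    then show "z \<in> Rep_bsv ` ball n" unfolding ball_def by blast
  next
    fix z assume "z \<in> Rep_bsv ` ball n"
    then obtain v where v: "z = Rep_bsv (sum_list v)" "length v \<le> n" "set v \<subseteq> letters" unfolding ball_def by blast
    then have "z = foldr (\<lambda>x y. x \<otimes>\<^bsub>bsv_group\<^esub> y) (map Rep_bsv v) \<one>\<^bsub>bsv_group\<^esub>"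
      "length (map Rep_bsv v) \<le> n" "set (map Rep_bsv v) \<subseteq> Rep_bsv ` letters" using foldr by auto
    then show "z \<in> {foldr (\<lambda>x y. x \<otimes>\<^bsub>bsv_group\<^esub> y) w \<one>\<^bsub>bsv_group\<^esub> | w. length w \<le> n \<and> set w \<subseteq> Rep_bsv ` letters}"
      by blast
  qed
  then have "word_growth bsv_group {tau, mu} n = card (Rep_bsv ` ball n)"
    unfolding word_growth_def letters by (simp only:)
  also have "\<dots> = card (ball n)" using inj_Rep_bsv by (intro card_image inj_on_subset[OF inj_Rep_bsv]) simp
  finally show ?thesis .
qed

lemma exp_sqrt_le: "exp (sqrt (real n)) \<le> real (word_growth bsv_group {tau, mu} (9 * n))"
proof (cases "n = 0")
  case True
  have "2 ^ 0 \<le> card (weight_le 0)" by (rule card_weight_le_ge) simp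
  then have "1 \<le> card (ball 0)" using card_weight_le_ball[of 0] by simp
  then show ?thesis using True by (simp add: word_growth_ball)
next
  case False
  \<comment> \<open>With s = sqrt n, the floor j of 3 s satisfies j^2 \<le> 9 n, which gives the
    factor 9. From ln 2 \<ge> 1/2 and s \<ge> 1 one gets j ln 2 \<ge> (3 s - 1)/2 \<ge> s; the
    factor 3 absorbs both the base 2 and the rounding.\<close>
  define j where "j = nat \<lfloor>3 * sqrt (real n)\<rfloor>"
  have j: "real j \<le> 3 * sqrt (real n)" "3 * sqrt (real n) - 1 \<le> real j"
  proof -
    have "real j = of_int \<lfloor>3 * sqrt (real n)\<rfloor>" unfolding j_def by simp
    then show "real j \<le> 3 * sqrt (real n)" "3 * sqrt (real n) - 1 \<le> real j"
      using floor_correct[of "3 * sqrt (real n)"] by linarith+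
  qed
  have "real (j * j) \<le> (3 * sqrt (real n)) * (3 * sqrt (real n))" using mult_mono[OF j(1) j(1)] by simp
  then have "real (j * j) \<le> real (9 * n)" by simp
  then have jj: "j * j \<le> 9 * n" by (simp only: of_nat_le_iff)
  have s1: "1 \<le> sqrt (real n)" using False by simp
  have "exp (1 / 2) \<le> (2 :: real)"
  proof -
    have "exp (1 / 2) * exp (1 / 2) = (exp 1 :: real)" by (simp flip: exp_add)
    also have "\<dots> \<le> 2 * 2" using exp_le by simp
    finally show ?thesis using power2_le_imp_le[of "exp (1 / 2) :: real" 2] by (simp add: power2_eq_square)
  qed
  then have ln2: "ln 2 \<ge> (1/2 :: real)" by (simp only: ln_ge_iff[of 2 "1/2 :: real"] zero_less_numeral)
  have "sqrt (real n) \<le> real j * ln 2"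
  proof -
    have "sqrt (real n) \<le> (3 * sqrt (real n) - 1) * (1 / 2)" using s1 by simp
    also have "\<dots> \<le> real j * ln 2" using j(2) ln2 s1 by (intro mult_mono) auto
    finally show ?thesis .
  qed
  then have "exp (sqrt (real n)) \<le> exp (real j * ln 2)" by simp
  also have "\<dots> = 2 ^ j" by (simp add: exp_of_nat_mult)
  also have "(2::real) ^ j = real (2 ^ j)" by simp
  also have "\<dots> \<le> real (word_growth bsv_group {tau, mu} (9 * n))"
    using card_weight_le_ge[OF jj] card_weight_le_ball[of "9 * n"] by (simp only: word_growth_ball of_nat_le_iff)
  finally show ?thesis .
qed

theorem theorem1p1:
  shows "(\<forall>i::nat. has_dim F2 (dim_layer bsv_group (2 ^ i)) (i + 2))
    \<and> (\<forall>n::nat. n \<ge> 1 \<and> (\<nexists>i. n = 2 ^ i) \<longrightarrow>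
          has_dim F2 (dim_layer bsv_group n) (Max {i + 1 | i::nat. 2 ^ i dvd n}))
    \<and> (\<forall>n::nat. has_dim F2 (augmentation_layer F2 bsv_group n) (\<Sum>i=0..n. partition_number i))
    \<and> growth_le (\<lambda>n. exp (sqrt (real n))) (\<lambda>n. real (word_growth bsv_group {tau, mu} n))"
proof (intro conjI allI impI)
  show "has_dim F2 (dim_layer bsv_group (2 ^ i)) (i + 2)" for i
    using has_dim_layer[of "2 ^ i"] by (simp only: card_layer_index_power zero_less_power zero_less_numeral)
  show "has_dim F2 (dim_layer bsv_group n) (Max {i + 1 | i::nat. 2 ^ i dvd n})"
    if "n \<ge> 1 \<and> (\<nexists>i. n = 2 ^ i)" for n :: nat
    using has_dim_layer[of n] card_layer_index_other[of n] that by simp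
  show "has_dim F2 (augmentation_layer F2 bsv_group n) (\<Sum>i=0..n. partition_number i)" for n
    using has_dim_augmentation_layer[of n] by (simp only: card_weight_eq)
  show "growth_le (\<lambda>n. exp (sqrt (real n))) (\<lambda>n. real (word_growth bsv_group {tau, mu} n))"
    unfolding growth_le_def using exp_sqrt_le by (intro exI[of _ 9]) simp
qed

end
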